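(* Let $(\mathcal X,\mathcal A)$ be a measurable space and, for each $n\ge 2$, let $(X_1,Y_1),\ldots,(X_n,Y_n)$ be i.i.d. random vectors with values in $\mathcal X\times\mathbb R$. Let $G$ be the law of $X_1$ and, for $q>0$, let $\mu_q(x)=\mathrm E(|Y_1|^q\mid X_1=x)$. For each $n$ let $K_n:\mathcal X\times\mathcal X\to\mathbb R$ be symmetric and measurable with $\iint K_n^2\,d(G\times G)<\infty$, and set $$U_n=\frac1{n(n-1)}\sum_{1\le r\neq s\le n}K_n(X_r,X_s)Y_rY_s .$$ Assume that $\mu_2$ is uniformly bounded, that conditions (A) and (B) hold, and that there exist finite partitions $\mathcal X=\bigcup_{m=1}^{M_n}\mathcal X_{n,m}$ into measurable sets satisfying (C1)–(C5). Let $I_n=(I_{n,1},\ldots,I_{n,n})$, where $I_{n,r}=m$ if $X_r\in\mathcal X_{n,m}$. Then the bounded Lipschitz distance between the conditional law of $(U_n-\mathrm E U_n)/\sigma(U_n)$ given $I_n$ and the standard normal distribution tends to zero in probability, where $\sigma(U_n)$ is the standard deviation of $U_n$. Furthermore $\operatorname{var}U_n\sim 2k_n/n^2$, i.e. $\operatorname{var}U_n/(2k_n/n^2)\to1$.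
   Context: The kernel operator $K_n:L_2(G)\to L_2(G)$ is $K_nf(x)=\int f(v)K_n(x,v)\,dG(v)$, with operator norm $\|K_n\|=\sup\{\|K_nf\|_G:\|f\|_G=1\}$. Define $k_n=\iint K_n^2(x,y)\mu_2(x)\mu_2(y)\,d(G\times G)(x,y)$, and write $(\mu_q\times\mu_q)(x,y)=\mu_q(x)\mu_q(y)$. (A) $\sup_n\|K_n\|<\infty$. (B) $k_n/n\to\infty$. (C1) $k_n^{-1}\sum_m\int_{\mathcal X_{n,m}}\int_{\mathcal X_{n,m}}K_n^2(\mu_2\times\mu_2)\,d(G\times G)\to1$. (C2) $k_n^{-1}\max_m\int_{\mathcal X_{n,m}}\int_{\mathcal X_{n,m}}K_n^2(\mu_2\times\mu_2)\,d(G\times G)\to0$. (C3) $\max_m G(\mathcal X_{n,m})\to0$. (C4) $\liminf_{n\to\infty}n\min_m G(\mathcal X_{n,m})>0$. (C5) For some $q>2$: $k_n^{-q/2}\max_m\big(G(\mathcal X_{n,m})/n\big)^{q/2-1}\sum_m\int_{\mathcal X_{n,m}}\int_{\mathcal X_{n,m}}|K_n|^q(\mu_q\times\mu_q)\,d(G\times G)\to0$. All limits are as $n\to\infty$. *)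

theory Defs
  imports "HOL-Probability.Probability"
begin

text \<open>Version of the conditional moment mu_q(x) = E(|Y|^q | X = x), where H is the joint law
  of (X,Y) on M x borel.  Values in [0,infinity] (nonnegative regression function).\<close>
definition cond_moment :: "('x \<times> real) measure \<Rightarrow> 'x measure \<Rightarrow> real \<Rightarrow> ('x \<Rightarrow> ennreal) \<Rightarrow> bool" where
  "cond_moment H M q f \<longleftrightarrow> f \<in> borel_measurable M \<and>
     (\<forall>A\<in>sets M. (\<integral>\<^sup>+x\<in>A. f x \<partial>(distr H M fst))
                 = (\<integral>\<^sup>+z. indicator A (fst z) * ennreal (\<bar>snd z\<bar> powr q) \<partial>H))"

definition L2_norm :: "'x measure \<Rightarrow> ('x \<Rightarrow> real) \<Rightarrow> real" where
  "L2_norm G f = sqrt (\<integral>x. (f x)\<^sup>2 \<partial>G)"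

definition kernel_op :: "'x measure \<Rightarrow> ('x \<Rightarrow> 'x \<Rightarrow> real) \<Rightarrow> ('x \<Rightarrow> real) \<Rightarrow> 'x \<Rightarrow> real" where
  "kernel_op G K f = (\<lambda>x. \<integral>v. f v * K x v \<partial>G)"

definition kernel_op_norm :: "'x measure \<Rightarrow> ('x \<Rightarrow> 'x \<Rightarrow> real) \<Rightarrow> ennreal" where
  "kernel_op_norm G K =
     (SUP f \<in> {f \<in> borel_measurable G. integrable G (\<lambda>x. (f x)\<^sup>2) \<and> L2_norm G f = 1}.
        ennreal (L2_norm G (kernel_op G K f)))"

definition bl_dist :: "real measure \<Rightarrow> real measure \<Rightarrow> real" where
  "bl_dist \<mu> \<nu> = (SUP f \<in> {f :: real \<Rightarrow> real. \<exists>a b. 0 \<le> a \<and> 0 \<le> b \<and> a + b \<le> 1 \<and>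
        (\<forall>x. \<bar>f x\<bar> \<le> a) \<and> (\<forall>x y. \<bar>f x - f y\<bar> \<le> b * \<bar>x - y\<bar>)}.
      \<bar>(\<integral>x. f x \<partial>\<mu>) - (\<integral>x. f x \<partial>\<nu>)\<bar>)"

definition cell :: "nat \<Rightarrow> (nat \<Rightarrow> 'x set) \<Rightarrow> 'x \<Rightarrow> nat" where
  "cell Mn Xp x = (THE m. m \<in> {1..Mn} \<and> x \<in> Xp m)"

end

theory Submission
  imports Defs
begin

text \<open>Write \<open>h(z,z') = K(x,x') y y'\<close>. Replace \<open>h\<close> by the kernel \<open>g\<close> obtained by cutting \<open>h\<close> off at
a level \<open>L\<close>, keeping only the diagonal blocks, and centring doubly within each cell.
The difference is negligible in mean square: the off-diagonal part by (C1), the part above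
\<open>L\<close> by (C5), and the linear (Hoeffding) part because its variance is controlled by the operator norm,
which is of smaller order than \<open>k/n\<close> by (B). Given the cell indices, the U-statistic of \<open>g\<close> is a sum of
independent centred block sums. Its conditional variance is a function of the indices that concentrates by (C2) and (C4).
The conditional Lyapunov sum is bounded in mean by counting the graphs
with four edges in which every vertex has degree at least two; this is small when
\<open>L\<close> is a multiple \<open>\<eta>\<close> of \<open>sqrt (k n / max G(X m))\<close> with \<open>\<eta> \<rightarrow> 0\<close>, and (C5) allows \<open>\<eta>\<close> to tend to zero slowly.\<close>

section \<open>Bounded Lipschitz distance and characteristic functions\<close>

text \<open>Centring is done cell by cell because, given the indices, the observations of a cell are
  i.i.d. from the law of (X,Y) conditioned on that cell. A kernel that is degenerate there has
  centred block sums with explicit conditional variances. The cut-off is forced by the lack of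
  fourth moments: only some q > 2 is available. Its level balances two errors. The part above L
  costs L powr (2 - q) times the q-th block moments, which for the chosen L is \<eta> powr (2 - q)
  times k times the quantity in (C5). The graphs on two or three vertices cost L^2 G(X m) / (k n),
  which is at most \<eta>^2. Taking \<eta> powr (q - 2) as the square root of the (C5) quantity,
  made positive by adding 1/n, sends both to zero. Centring inside cells also removes a part whose
  squared norm is bounded by a constant times the number of cells; (C4) makes that O(n), hence o(k)
  by (B). All estimates hold at fixed n, and limits are taken only at the end.\<close>

lemma bl_dist_distr_tendsto_0:
  fixes \<mu> :: "nat \<Rightarrow> real measure"
  assumes \<mu>: "\<And>n. real_distribution (\<mu> n)" and \<nu>: "real_distribution \<nu>"
    and conv: "weak_conv_m \<mu> \<nu>"
  shows "(\<lambda>n. bl_dist (\<mu> n) \<nu>) \<longlonglongrightarrow> 0"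
proof -
  \<comment> \<open>Skorohod's representation replaces weak convergence by a coupling that converges
    pointwise. The single number E min(2, |V n - W|) then controls all test functions at
    once.\<close>
  obtain \<Omega> :: "real measure" and V W where "prob_space \<Omega>"
    and V[measurable]: "\<And>n. V n \<in> measurable \<Omega> borel"
    and dV: "\<And>n. distr \<Omega> borel (V n) = \<mu> n"
    and W: "W \<in> measurable \<Omega> lborel" and dW: "distr \<Omega> borel W = \<nu>"
    and lim: "\<And>x. x \<in> space \<Omega> \<Longrightarrow> (\<lambda>n. V n x) \<longlonglongrightarrow> W x"
    using Skorohod[OF \<mu> \<nu> conv] by metis
  interpret prob_space \<Omega> by fact
  have [measurable]: "W \<in> borel_measurable \<Omega>" using W by simp
  let ?e = "\<lambda>n. \<integral>x. min 2 \<bar>V n x - W x\<bar> \<partial>\<Omega>"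
  have "?e \<longlonglongrightarrow> (\<integral>x. 0 \<partial>\<Omega>)"
  proof (rule integral_dominated_convergence[where w="\<lambda>_. 2"])
    show "AE x in \<Omega>. (\<lambda>n. min 2 \<bar>V n x - W x\<bar>) \<longlonglongrightarrow> 0"
    proof (rule AE_I2)
      fix x assume "x \<in> space \<Omega>"
      from lim[OF this] have "(\<lambda>n. \<bar>V n x - W x\<bar>) \<longlonglongrightarrow> 0"
        by (simp add: LIM_zero tendsto_rabs_zero)
      from tendsto_min[OF tendsto_const this, of 2] show "(\<lambda>n. min 2 \<bar>V n x - W x\<bar>) \<longlonglongrightarrow> 0"
        by simp
    qed
  qed auto
  then have e: "?e \<longlonglongrightarrow> 0" by simp
  let ?F = "{f :: real \<Rightarrow> real. \<exists>a b. 0 \<le> a \<and> 0 \<le> b \<and> a + b \<le> 1 \<and>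
        (\<forall>x. \<bar>f x\<bar> \<le> a) \<and> (\<forall>x y. \<bar>f x - f y\<bar> \<le> b * \<bar>x - y\<bar>)}"
  \<comment> \<open>The zero function shows that the test class is nonempty and that the supremum is
    nonnegative.\<close>
  have zero: "(\<lambda>_. 0) \<in> ?F" by (auto intro!: exI[of _ 0])
  have le: "\<bar>(\<integral>x. f x \<partial>\<mu> n) - (\<integral>x. f x \<partial>\<nu>)\<bar> \<le> ?e n" if "f \<in> ?F" for f n
  proof -
    from that obtain a b where ab: "0 \<le> a" "0 \<le> b" "a + b \<le> 1"
      and fa: "\<And>x. \<bar>f x\<bar> \<le> a" and fb: "\<And>x y. \<bar>f x - f y\<bar> \<le> b * \<bar>x - y\<bar>" by auto
    have "b-lipschitz_on UNIV f" using ab fb by (auto simp: lipschitz_on_def dist_real_def)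
    then have "continuous_on UNIV f" by (rule lipschitz_on_continuous_on)
    then have [measurable]: "f \<in> borel_measurable borel" by (rule borel_measurable_continuous_onI)
    have int: "integrable \<Omega> (\<lambda>x. f (V n x))" "integrable \<Omega> (\<lambda>x. f (W x))"
      using fa by (auto intro!: integrable_const_bound[where B=a])
    have "(\<integral>x. f x \<partial>\<mu> n) - (\<integral>x. f x \<partial>\<nu>) = (\<integral>x. f (V n x) - f (W x) \<partial>\<Omega>)"
      using int by (simp add: dV[symmetric] dW[symmetric] integral_distr)
    also have "\<bar>\<dots>\<bar> \<le> (\<integral>x. \<bar>f (V n x) - f (W x)\<bar> \<partial>\<Omega>)" by (rule integral_abs_bound)
    also have "\<dots> \<le> ?e n"
    proof (rule integral_mono)
      show "integrable \<Omega> (\<lambda>x. \<bar>f (V n x) - f (W x)\<bar>)" using int by auto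
      show "integrable \<Omega> (\<lambda>x. min 2 \<bar>V n x - W x\<bar>)"
        by (rule integrable_const_bound[where B=2]) auto
      fix x
      have "\<bar>f (V n x) - f (W x)\<bar> \<le> 2" using fa[of "V n x"] fa[of "W x"] ab by linarith
      moreover have "b * \<bar>V n x - W x\<bar> \<le> 1 * \<bar>V n x - W x\<bar>"
        using ab by (intro mult_right_mono) auto
      ultimately show "\<bar>f (V n x) - f (W x)\<bar> \<le> min 2 \<bar>V n x - W x\<bar>"
        using fb[of "V n x" "W x"] by simp
    qed
    finally show ?thesis .
  qed
  show ?thesis
  proof (rule tendsto_sandwich[OF _ _ tendsto_const e])
    have "bl_dist (\<mu> n) \<nu> \<le> ?e n" for n
      unfolding bl_dist_def
    proof (rule cSUP_least)
      show "?F \<noteq> {}" using zero by (metis empty_iff)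
    qed (fact le)
    then show "\<forall>\<^sub>F n in sequentially. bl_dist (\<mu> n) \<nu> \<le> ?e n" by simp
    show "\<forall>\<^sub>F n in sequentially. 0 \<le> bl_dist (\<mu> n) \<nu>"
    proof (intro always_eventually allI)
      fix n
      have "\<bar>(\<integral>x. (\<lambda>_. 0::real) x \<partial>\<mu> n) - (\<integral>x. (\<lambda>_. 0::real) x \<partial>\<nu>)\<bar> \<le> bl_dist (\<mu> n) \<nu>"
        unfolding bl_dist_def
        by (rule cSUP_upper[OF zero bdd_aboveI2[where M="?e n"]]) (fact le)
      then show "0 \<le> bl_dist (\<mu> n) \<nu>" by simp
    qed
  qed
qed

lemma abs_exp_minus_diff_le:
  fixes a :: real
  assumes a: "0 \<le> a"
  shows "\<bar>exp (- a) - (1 - a)\<bar> \<le> a\<^sup>2"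
proof -
  have "exp (- a) \<ge> 1 - a" using exp_ge_add_one_self[of "- a"] by simp
  moreover have "exp (- a) \<le> 1 - a + a\<^sup>2"
  proof -
    have "exp (- a) = 1 / exp a" by (simp add: exp_minus inverse_eq_divide)
    also have "\<dots> \<le> 1 / (1 + a)" using a exp_ge_add_one_self[of a] by (intro frac_le) auto
    also have "\<dots> \<le> 1 - a + a\<^sup>2"
    proof -
      have "(1 - a + a\<^sup>2) * (1 + a) = 1 + a ^ 3" by (simp add: algebra_simps power2_eq_square power3_eq_cube)
      then have "1 \<le> (1 - a + a\<^sup>2) * (1 + a)" using a by simp
      then show ?thesis using a by (subst pos_divide_le_eq) auto
    qed
    finally show ?thesis .
  qed
  ultimately show ?thesis by simp
qed

text \<open>Both sides are products of factors of modulus at most 1, so they differ by at most the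
  sum of the differences of the factors. The third absolute moments in the expansion are traded for
  second and fourth moments with weight \<open>sqrt \<delta>\<close>; after summation this produces
  \<open>sqrt \<delta> * (v + 1)\<close>.\<close>

lemma (in prob_space) char_sum_approx:
  fixes \<xi> :: "'i \<Rightarrow> 'a \<Rightarrow> real"
  assumes fin: "finite J" and ind: "indep_vars (\<lambda>_. borel) \<xi> J"
    and int4: "\<And>m. m \<in> J \<Longrightarrow> integrable M (\<lambda>x. \<xi> m x ^ 4)"
    and mean: "\<And>m. m \<in> J \<Longrightarrow> expectation (\<xi> m) = 0"
    and v: "(\<Sum>m\<in>J. expectation (\<lambda>x. (\<xi> m x)\<^sup>2)) = v"
    and F: "(\<Sum>m\<in>J. expectation (\<lambda>x. \<xi> m x ^ 4)) \<le> \<delta>"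
    and \<delta>: "0 < \<delta>" and small: "t\<^sup>2 * sqrt \<delta> \<le> 2"
  shows "cmod (char (distr M borel (\<lambda>x. \<Sum>m\<in>J. \<xi> m x)) t - exp (- (t\<^sup>2 * v / 2)))
           \<le> \<bar>t\<bar> ^ 3 * sqrt \<delta> * (v + 1) + t ^ 4 * \<delta>"
proof -
  have rv[measurable]: "random_variable borel (\<xi> m)" if "m \<in> J" for m
    using ind that unfolding indep_vars_def by auto
  let ?s = "\<lambda>m. expectation (\<lambda>x. (\<xi> m x)\<^sup>2)" and ?f = "\<lambda>m. expectation (\<lambda>x. \<xi> m x ^ 4)"
  let ?l = "sqrt \<delta>"
  have sq_le: "x\<^sup>2 \<le> 1 + x ^ 4" for x :: real
  proof -
    have "0 \<le> (x\<^sup>2 - 1)\<^sup>2" by simp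
    also have "\<dots> = x ^ 4 - 2 * x\<^sup>2 + 1" by (simp add: power2_eq_square power4_eq_xxxx algebra_simps)
    finally show ?thesis using zero_le_power2[of x] by linarith
  qed
  have int2: "integrable M (\<lambda>x. (\<xi> m x)\<^sup>2)" if "m \<in> J" for m
    by (rule Bochner_Integration.integrable_bound[where f="\<lambda>x. 1 + \<xi> m x ^ 4"])
       (use int4 that sq_le in auto)
  have int1: "integrable M (\<xi> m)" if "m \<in> J" for m
    using int2[OF that] rv[OF that] by (rule square_integrable_imp_integrable[rotated])
  \<comment> \<open>Jensen's inequality, in the form that the variance of the squared summand is
    nonnegative. It lets the fourth moments absorb the squares of the variances.\<close>
  have s4: "(?s m)\<^sup>2 \<le> ?f m" if m: "m \<in> J" for m
  proof -
    have "0 \<le> expectation (\<lambda>x. ((\<xi> m x)\<^sup>2 - ?s m)\<^sup>2)" by simp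
    also have "\<dots> = expectation (\<lambda>x. \<xi> m x ^ 4 - 2 * ?s m * (\<xi> m x)\<^sup>2 + (?s m)\<^sup>2)"
      by (simp add: power2_eq_square power4_eq_xxxx algebra_simps)
    also have "\<dots> = ?f m - 2 * ?s m * ?s m + (?s m)\<^sup>2"
      using int2[OF m] int4[OF m] by (simp add: prob_space)
    finally show ?thesis by (simp add: power2_eq_square)
  qed
  have fle: "?f m \<le> \<delta>" if "m \<in> J" for m
    using F member_le_sum[of m J ?f] that fin by (auto simp: zero_le_even_power intro!: Bochner_Integration.integral_nonneg)
  have sle: "0 \<le> ?s m" "?s m \<le> ?l" if "m \<in> J" for m
    using s4[OF that] fle[OF that] by (auto intro!: real_le_rsqrt)
  have bound: "norm (char (distr M borel (\<xi> m)) t - exp (- (t\<^sup>2 * ?s m / 2)))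
      \<le> \<bar>t\<bar>^3 * (?l * ?s m + ?f m / ?l) + t^4 * ?f m" if m: "m \<in> J" for m
  proof -
    let ?a = "t\<^sup>2 * ?s m / 2"
    have "cmod (char (distr M borel (\<xi> m)) t - (1 - t^2 * ?s m / 2)) \<le>
      (t^2 / 6) * expectation (\<lambda>x. min (6 * (\<xi> m x)^2) (\<bar>t\<bar> * \<bar>\<xi> m x\<bar>^3))"
      using m int1 int2 mean by (intro char_approx3') auto
    also have "\<dots> \<le> (t^2 / 6) * expectation (\<lambda>x. \<bar>t\<bar> * (?l * (\<xi> m x)\<^sup>2 + \<xi> m x ^ 4 / ?l))"
    proof (intro mult_left_mono integral_mono)
      show "integrable M (\<lambda>x. min (6 * (\<xi> m x)^2) (\<bar>t\<bar> * \<bar>\<xi> m x\<bar>^3))"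
        by (rule Bochner_Integration.integrable_bound[where f="\<lambda>x. 6 * (\<xi> m x)\<^sup>2"]) (use int2 m in auto)
      show "integrable M (\<lambda>x. \<bar>t\<bar> * (?l * (\<xi> m x)\<^sup>2 + \<xi> m x ^ 4 / ?l))" using int2 int4 m by auto
      fix x
      let ?y = "\<bar>\<xi> m x\<bar>"
      \<comment> \<open>Completing the square with weight \<open>?l\<close> bounds the cube by the
        square and the fourth power.\<close>
      have "0 \<le> ?y\<^sup>2 * (?l - ?y)\<^sup>2 / ?l" using \<delta> by auto
      also have "\<dots> = ?l * ?y\<^sup>2 - 2 * ?y ^ 3 + ?y ^ 4 / ?l"
        using \<delta> by (simp add: field_simps power2_eq_square power3_eq_cube power4_eq_xxxx)
      finally have "?y ^ 3 \<le> ?l * ?y\<^sup>2 + ?y ^ 4 / ?l"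
        using zero_le_power_abs[of "\<xi> m x" 3] by linarith
      then have "\<bar>t\<bar> * ?y ^ 3 \<le> \<bar>t\<bar> * (?l * (\<xi> m x)\<^sup>2 + \<xi> m x ^ 4 / ?l)"
        by (intro mult_left_mono) (auto simp: power_even_abs)
      then show "min (6 * (\<xi> m x)^2) (\<bar>t\<bar> * \<bar>\<xi> m x\<bar>^3) \<le> \<bar>t\<bar> * (?l * (\<xi> m x)\<^sup>2 + \<xi> m x ^ 4 / ?l)"
        by simp
    qed auto
    also have "\<dots> = (t^2 / 6) * (\<bar>t\<bar> * (?l * ?s m + ?f m / ?l))"
      using int2 int4 m by simp
    also have "\<dots> = (1/6) * (\<bar>t\<bar>^3 * (?l * ?s m + ?f m / ?l))"
      by (simp add: power2_eq_square power3_eq_cube)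
    also have "\<dots> \<le> 1 * (\<bar>t\<bar>^3 * (?l * ?s m + ?f m / ?l))"
      using sle[OF m] \<delta> by (intro mult_right_mono mult_nonneg_nonneg add_nonneg_nonneg divide_nonneg_nonneg) (auto intro!: Bochner_Integration.integral_nonneg)
    finally have 1: "cmod (char (distr M borel (\<xi> m)) t - (1 - t^2 * ?s m / 2)) \<le> \<bar>t\<bar>^3 * (?l * ?s m + ?f m / ?l)"
      by simp
    have a: "0 \<le> ?a" using sle[OF m] by auto
    have "?a \<le> 1"
    proof -
      have "t\<^sup>2 * ?s m \<le> t\<^sup>2 * ?l" using sle[OF m] by (intro mult_left_mono) auto
      then show ?thesis using small by simp
    qed
    have "\<bar>exp (- ?a) - (1 - ?a)\<bar> \<le> ?a\<^sup>2"
      using a by (rule abs_exp_minus_diff_le)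
    also have "?a\<^sup>2 = t^4 * (?s m)\<^sup>2 / 4" by (simp add: power2_eq_square power4_eq_xxxx)
    also have "\<dots> \<le> t^4 * ?f m"
    proof -
      have "t^4 * (?s m)\<^sup>2 \<le> t^4 * ?f m" using s4[OF m] by (intro mult_left_mono) auto
      moreover have "0 \<le> t^4 * (?s m)\<^sup>2" by auto
      ultimately show ?thesis by linarith
    qed
    finally have 2: "\<bar>exp (- ?a) - (1 - ?a)\<bar> \<le> t^4 * ?f m" .
    have "cmod (complex_of_real (1 - ?a) - complex_of_real (exp (- ?a))) \<le> t^4 * ?f m"
      using 2 unfolding of_real_diff[symmetric] norm_of_real by (simp add: abs_minus_commute)
    moreover have "cmod (char (distr M borel (\<xi> m)) t - complex_of_real (1 - ?a)) \<le> \<bar>t\<bar>^3 * (?l * ?s m + ?f m / ?l)"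
      using 1 by simp
    ultimately have "cmod (char (distr M borel (\<xi> m)) t - complex_of_real (exp (- ?a))) \<le> \<bar>t\<bar>^3 * (?l * ?s m + ?f m / ?l) + t^4 * ?f m"
      by (rule norm_diff_triangle_le[rotated])
    then show ?thesis by simp
  qed
  have "char (distr M borel (\<lambda>x. \<Sum>m\<in>J. \<xi> m x)) t = (\<Prod>m\<in>J. char (distr M borel (\<xi> m)) t)"
    by (rule char_distr_sum[OF ind])
  moreover have "exp (- (t\<^sup>2 * v / 2)) = (\<Prod>m\<in>J. exp (- (t\<^sup>2 * ?s m / 2)))"
    unfolding v[symmetric] sum_distrib_left sum_divide_distrib sum_negf[symmetric] using fin by (rule exp_sum)
  ultimately have "cmod (char (distr M borel (\<lambda>x. \<Sum>m\<in>J. \<xi> m x)) t - exp (- (t\<^sup>2 * v / 2)))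
     = cmod ((\<Prod>m\<in>J. char (distr M borel (\<xi> m)) t) - (\<Prod>m\<in>J. complex_of_real (exp (- (t\<^sup>2 * ?s m / 2)))))"
    by simp
  also have "\<dots> \<le> (\<Sum>m\<in>J. cmod (char (distr M borel (\<xi> m)) t - complex_of_real (exp (- (t\<^sup>2 * ?s m / 2)))))"
  proof (rule norm_prod_diff)
    fix m assume m: "m \<in> J"
    interpret d: real_distribution "distr M borel (\<xi> m)" using m by (intro real_distribution_distr) auto
    show "cmod (char (distr M borel (\<xi> m)) t) \<le> 1" by (rule d.cmod_char_le_1)
    show "cmod (complex_of_real (exp (- (t\<^sup>2 * ?s m / 2)))) \<le> 1"
      unfolding norm_of_real using sle[OF m] by auto
  qed
  also have "\<dots> \<le> (\<Sum>m\<in>J. \<bar>t\<bar>^3 * (?l * ?s m + ?f m / ?l) + t^4 * ?f m)"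
    by (intro sum_mono) (use bound in auto)
  also have "\<dots> = \<bar>t\<bar>^3 * (?l * v + (\<Sum>m\<in>J. ?f m) / ?l) + t^4 * (\<Sum>m\<in>J. ?f m)"
    unfolding v[symmetric] by (simp add: sum.distrib sum_divide_distrib flip: sum_distrib_left)
  also have "\<dots> \<le> \<bar>t\<bar>^3 * (?l * v + \<delta> / ?l) + t^4 * \<delta>"
    using F \<delta> by (intro add_mono mult_left_mono divide_right_mono) auto
  also have "\<dots> = \<bar>t\<bar> ^ 3 * ?l * (v + 1) + t ^ 4 * \<delta>"
    using \<delta> by (simp add: real_div_sqrt distrib_left)
  finally show ?thesis .
qed

text \<open>Multiplying by the unimodular factor of \<open>S\<close> leaves |exp(itR) - 1| <= |t|
  |R|, however \<open>R\<close> depends on \<open>S\<close>. The bound |R| <= sqrt \<delta> + R^2 /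
  sqrt \<delta> then uses the second moment only.\<close>

lemma (in prob_space) char_add_diff_le:
  fixes S R :: "'a \<Rightarrow> real"
  assumes [measurable]: "random_variable borel S" "random_variable borel R"
    and int: "integrable M (\<lambda>x. (R x)\<^sup>2)" and R: "expectation (\<lambda>x. (R x)\<^sup>2) \<le> \<delta>" and \<delta>: "0 < \<delta>"
  shows "cmod (char (distr M borel (\<lambda>x. S x + R x)) t - char (distr M borel S) t) \<le> 2 * \<bar>t\<bar> * sqrt \<delta>"
proof -
  have "char (distr M borel (\<lambda>x. S x + R x)) t - char (distr M borel S) t
      = (CLINT x|M. iexp (t * (S x + R x))) - (CLINT x|M. iexp (t * S x))"
    by (simp add: char_def integral_distr)
  also have "\<dots> = (CLINT x|M. iexp (t * (S x + R x)) - iexp (t * S x))"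
    by (rule Bochner_Integration.integral_diff[symmetric]) (auto intro!: integrable_iexp)
  also have "cmod \<dots> \<le> (LINT x|M. cmod (iexp (t * (S x + R x)) - iexp (t * S x)))"
    by (rule integral_norm_bound)
  also have "\<dots> \<le> (LINT x|M. \<bar>t\<bar> * (sqrt \<delta> + (R x)\<^sup>2 / sqrt \<delta>))"
  proof (rule integral_mono)
    show "integrable M (\<lambda>x. cmod (iexp (t * (S x + R x)) - iexp (t * S x)))"
      by (intro integrable_norm Bochner_Integration.integrable_diff integrable_iexp) auto
    show "integrable M (\<lambda>x. \<bar>t\<bar> * (sqrt \<delta> + (R x)\<^sup>2 / sqrt \<delta>))" using int by simp
    fix x
    have "iexp (t * (S x + R x)) - iexp (t * S x) = iexp (t * S x) * (iexp (t * R x) - 1)"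
      by (simp add: algebra_simps exp_add)
    then have "cmod (iexp (t * (S x + R x)) - iexp (t * S x)) = cmod (iexp (t * R x) - 1)"
      by (simp add: norm_mult)
    also have "\<dots> \<le> \<bar>t\<bar> * \<bar>R x\<bar>" using iexp_approx1[of "t * R x" 0] by (simp add: abs_mult)
    also have "\<dots> \<le> \<bar>t\<bar> * (sqrt \<delta> + (R x)\<^sup>2 / sqrt \<delta>)"
    proof (rule mult_left_mono)
      have "0 \<le> (sqrt \<delta> - \<bar>R x\<bar>)\<^sup>2 / sqrt \<delta>" using \<delta> by simp
      also have "\<dots> = sqrt \<delta> - 2 * \<bar>R x\<bar> + (R x)\<^sup>2 / sqrt \<delta>"
        using \<delta> by (simp add: field_simps power2_eq_square)
      finally show "\<bar>R x\<bar> \<le> sqrt \<delta> + (R x)\<^sup>2 / sqrt \<delta>" using abs_ge_zero[of "R x"] by linarith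
    qed auto
    finally show "cmod (iexp (t * (S x + R x)) - iexp (t * S x)) \<le> \<bar>t\<bar> * (sqrt \<delta> + (R x)\<^sup>2 / sqrt \<delta>)" .
  qed
  also have "\<dots> = \<bar>t\<bar> * (sqrt \<delta> + expectation (\<lambda>x. (R x)\<^sup>2) / sqrt \<delta>)" using int by (simp add: prob_space)
  also have "\<dots> \<le> \<bar>t\<bar> * (sqrt \<delta> + \<delta> / sqrt \<delta>)"
    using R \<delta> by (intro mult_left_mono add_left_mono divide_right_mono) auto
  also have "\<dots> = 2 * \<bar>t\<bar> * sqrt \<delta>" using \<delta> by (simp add: real_div_sqrt)
  finally show ?thesis .
qed

text \<open>A single smallness parameter replaces triangular arrays: the conditional laws to which this is
  applied depend on the random conditioning event.\<close>

lemma bl_dist_independent_sum_le: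
  fixes \<epsilon> :: real
  assumes "\<epsilon> > 0"
  obtains \<delta> where "\<delta> > 0"
    and "\<And>(Q :: 'w measure) (J :: 'i set) \<xi> R. prob_space Q \<Longrightarrow> finite J \<Longrightarrow>
      prob_space.indep_vars Q (\<lambda>_. borel) \<xi> J \<Longrightarrow>
      (\<And>m. m \<in> J \<Longrightarrow> integrable Q (\<lambda>x. \<xi> m x ^ 4)) \<Longrightarrow>
      (\<And>m. m \<in> J \<Longrightarrow> (\<integral>x. \<xi> m x \<partial>Q) = 0) \<Longrightarrow>
      \<bar>(\<Sum>m\<in>J. \<integral>x. (\<xi> m x)\<^sup>2 \<partial>Q) - 1\<bar> \<le> \<delta> \<Longrightarrow>
      (\<Sum>m\<in>J. \<integral>x. \<xi> m x ^ 4 \<partial>Q) \<le> \<delta> \<Longrightarrow>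
      R \<in> borel_measurable Q \<Longrightarrow> integrable Q (\<lambda>x. (R x)\<^sup>2) \<Longrightarrow> (\<integral>x. (R x)\<^sup>2 \<partial>Q) \<le> \<delta> \<Longrightarrow>
      bl_dist (distr Q borel (\<lambda>x. (\<Sum>m\<in>J. \<xi> m x) + R x)) std_normal_distribution \<le> \<epsilon>"
proof (rule ccontr)
  note goal = that
  define good :: "real \<Rightarrow> 'w measure \<Rightarrow> 'i set \<Rightarrow> ('i \<Rightarrow> 'w \<Rightarrow> real) \<Rightarrow> ('w \<Rightarrow> real) \<Rightarrow> bool"
    where "good \<delta> Q J \<xi> R \<longleftrightarrow> prob_space Q \<and> finite J \<and>
      prob_space.indep_vars Q (\<lambda>_. borel) \<xi> J \<and>
      (\<forall>m\<in>J. integrable Q (\<lambda>x. \<xi> m x ^ 4)) \<and>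
      (\<forall>m\<in>J. (\<integral>x. \<xi> m x \<partial>Q) = 0) \<and>
      \<bar>(\<Sum>m\<in>J. \<integral>x. (\<xi> m x)\<^sup>2 \<partial>Q) - 1\<bar> \<le> \<delta> \<and>
      (\<Sum>m\<in>J. \<integral>x. \<xi> m x ^ 4 \<partial>Q) \<le> \<delta> \<and>
      R \<in> borel_measurable Q \<and> integrable Q (\<lambda>x. (R x)\<^sup>2) \<and> (\<integral>x. (R x)\<^sup>2 \<partial>Q) \<le> \<delta>" for \<delta> Q J \<xi> R
  assume not: "\<not> thesis"
  have ex: "\<exists>Q J \<xi> R. good \<delta> Q J \<xi> R \<and> bl_dist (distr Q borel (\<lambda>x. (\<Sum>m\<in>J. \<xi> m x) + R x)) std_normal_distribution > \<epsilon>"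
    if "\<delta> > 0" for \<delta>
  proof (rule ccontr)
    assume neg: "\<not> ?thesis"
    have thesis
    proof (rule goal[OF \<open>\<delta> > 0\<close>], goal_cases)
      case (1 Q J \<xi> R)
      then have "good \<delta> Q J \<xi> R" unfolding good_def by simp
      then show ?case using neg by (meson not_le)
    qed
    then show False using not by simp
  qed
  \<comment> \<open>If no threshold worked, counterexamples at the levels 1/(k+1) would form a
    triangular array whose characteristic functions converge to the normal one. Levy's theorem and
    \<open>bl_dist_distr_tendsto_0\<close> then contradict the distance staying above
    \<epsilon>.\<close>
  have "\<forall>k. \<exists>Q J \<xi> R. good (1 / Suc k) Q J \<xi> R \<and> bl_dist (distr Q borel (\<lambda>x. (\<Sum>m\<in>J. \<xi> m x) + R x)) std_normal_distribution > \<epsilon>"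
    by (intro allI ex) simp
  from choice[OF this] obtain Q where "\<forall>k. \<exists>J \<xi> R. good (1 / Suc k) (Q k) J \<xi> R \<and> bl_dist (distr (Q k) borel (\<lambda>x. (\<Sum>m\<in>J. \<xi> m x) + R x)) std_normal_distribution > \<epsilon>" ..
  from choice[OF this] obtain J where "\<forall>k. \<exists>\<xi> R. good (1 / Suc k) (Q k) (J k) \<xi> R \<and> bl_dist (distr (Q k) borel (\<lambda>x. (\<Sum>m\<in>J k. \<xi> m x) + R x)) std_normal_distribution > \<epsilon>" ..
  from choice[OF this] obtain \<xi> where "\<forall>k. \<exists>R. good (1 / Suc k) (Q k) (J k) (\<xi> k) R \<and> bl_dist (distr (Q k) borel (\<lambda>x. (\<Sum>m\<in>J k. \<xi> k m x) + R x)) std_normal_distribution > \<epsilon>" ..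
  from choice[OF this] obtain R where "\<forall>k. good (1 / Suc k) (Q k) (J k) (\<xi> k) (R k) \<and> bl_dist (distr (Q k) borel (\<lambda>x. (\<Sum>m\<in>J k. \<xi> k m x) + R k x)) std_normal_distribution > \<epsilon>" ..
  then have good: "\<And>k. good (1 / Suc k) (Q k) (J k) (\<xi> k) (R k)"
    and far: "\<And>k. bl_dist (distr (Q k) borel (\<lambda>x. (\<Sum>m\<in>J k. \<xi> k m x) + R k x)) std_normal_distribution > \<epsilon>"
    by auto
  define \<mu> where "\<mu> k = distr (Q k) borel (\<lambda>x. (\<Sum>m\<in>J k. \<xi> k m x) + R k x)" for k
  define v where "v k = (\<Sum>m\<in>J k. \<integral>x. (\<xi> k m x)\<^sup>2 \<partial>Q k)" for k
  have pQ: "prob_space (Q k)" for k using good[of k] by (simp add: good_def)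
  have rv: "\<xi> k m \<in> borel_measurable (Q k)" if "m \<in> J k" for k m
    using good[of k] that unfolding good_def by (auto simp: prob_space.indep_vars_def[OF pQ])
  have rvS: "(\<lambda>x. \<Sum>m\<in>J k. \<xi> k m x) \<in> borel_measurable (Q k)" for k using rv by (intro borel_measurable_sum)
  have rvR: "R k \<in> borel_measurable (Q k)" for k using good[of k] by (simp add: good_def)
  have rd: "real_distribution (\<mu> k)" for k
    unfolding \<mu>_def using rvS rvR by (intro prob_space.real_distribution_distr pQ borel_measurable_add)
  have d0: "(\<lambda>k. 1 / real (Suc k)) \<longlonglongrightarrow> 0" using LIMSEQ_inverse_real_of_nat by (simp add: inverse_eq_divide)
  have sd0: "(\<lambda>k. sqrt (1 / real (Suc k))) \<longlonglongrightarrow> 0" using tendsto_real_sqrt[OF d0] by simp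
  have "\<forall>k. \<bar>v k - 1\<bar> \<le> 1 / Suc k" using good by (simp add: good_def v_def)
  then have "(\<lambda>k. v k - 1) \<longlonglongrightarrow> 0" by (intro Lim_null_comparison[OF _ d0]) auto
  then have v1: "v \<longlonglongrightarrow> 1" by (simp add: LIM_zero_iff)
  have "weak_conv_m \<mu> std_normal_distribution"
  proof (rule levy_continuity[OF rd real_dist_normal_dist])
    fix t
    define b where "b k = (\<bar>t\<bar> ^ 3 * sqrt (1 / Suc k) * (v k + 1) + t ^ 4 * (1 / Suc k))
       + 2 * \<bar>t\<bar> * sqrt (1 / Suc k)" for k
    have "b \<longlonglongrightarrow> (\<bar>t\<bar> ^ 3 * 0 * (1 + 1) + t ^ 4 * 0) + 2 * \<bar>t\<bar> * 0"
      unfolding b_def by (intro tendsto_intros d0 sd0 v1)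
    then have b: "b \<longlonglongrightarrow> 0" by simp
    have "(\<lambda>k. t\<^sup>2 * sqrt (1 / Suc k)) \<longlonglongrightarrow> t\<^sup>2 * 0" by (intro tendsto_intros sd0)
    then have "eventually (\<lambda>k. t\<^sup>2 * sqrt (1 / Suc k) < 2) sequentially" by (rule order_tendstoD) simp
    then have "eventually (\<lambda>k. norm (char (\<mu> k) t - exp (- (t\<^sup>2 * v k / 2))) \<le> b k) sequentially"
    proof eventually_elim
      case (elim k)
      interpret prob_space "Q k" by (rule pQ)
      have "norm (char (\<mu> k) t - char (distr (Q k) borel (\<lambda>x. \<Sum>m\<in>J k. \<xi> k m x)) t) \<le> 2 * \<bar>t\<bar> * sqrt (1 / Suc k)"
        unfolding \<mu>_def by (rule char_add_diff_le[OF rvS rvR]) (use good[of k] in \<open>auto simp: good_def\<close>)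
      moreover have "norm (char (distr (Q k) borel (\<lambda>x. \<Sum>m\<in>J k. \<xi> k m x)) t - exp (- (t\<^sup>2 * v k / 2)))
           \<le> \<bar>t\<bar> ^ 3 * sqrt (1 / Suc k) * (v k + 1) + t ^ 4 * (1 / Suc k)"
        by (rule char_sum_approx) (use good[of k] elim in \<open>auto simp: good_def v_def\<close>)
      ultimately show ?case unfolding b_def by (metis add.commute norm_diff_triangle_le)
    qed
    then have "(\<lambda>k. char (\<mu> k) t - complex_of_real (exp (- (t\<^sup>2 * v k / 2)))) \<longlonglongrightarrow> 0"
      by (rule Lim_null_comparison[OF _ b])
    moreover have "(\<lambda>k. complex_of_real (exp (- (t\<^sup>2 * v k / 2)))) \<longlonglongrightarrow> complex_of_real (exp (- (t\<^sup>2 * 1 / 2)))"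
      by (intro tendsto_intros v1) auto
    ultimately have "(\<lambda>k. char (\<mu> k) t - complex_of_real (exp (- (t\<^sup>2 * v k / 2))) + complex_of_real (exp (- (t\<^sup>2 * v k / 2))))
        \<longlonglongrightarrow> 0 + complex_of_real (exp (- (t\<^sup>2 * 1 / 2)))" by (rule tendsto_add)
    then show "(\<lambda>k. char (\<mu> k) t) \<longlonglongrightarrow> char std_normal_distribution t"
      by (simp add: char_std_normal_distribution)
  qed
  from bl_dist_distr_tendsto_0[OF rd real_dist_normal_dist this]
  have "eventually (\<lambda>k. bl_dist (\<mu> k) std_normal_distribution < \<epsilon>) sequentially"
    using \<open>\<epsilon> > 0\<close> by (rule order_tendstoD)
  then obtain k where "bl_dist (\<mu> k) std_normal_distribution < \<epsilon>"
    by (metis eventually_sequentially order_refl)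
  then show False using far[of k] by (simp add: \<mu>_def)
qed

text \<open>Packs the many premises of \<open>bl_dist_independent_sum_le\<close> into one predicate
  that later statements can assume. The type argument fixes the sample space, which would otherwise
  not be determined by \<epsilon> and \<delta>.\<close>

definition clt_threshold :: "'w itself \<Rightarrow> real \<Rightarrow> real \<Rightarrow> bool" where
  "clt_threshold _ \<epsilon> \<delta> \<longleftrightarrow> (\<forall>(Q :: 'w measure) (J :: nat set) \<xi> R. prob_space Q \<longrightarrow> finite J \<longrightarrow>
      prob_space.indep_vars Q (\<lambda>_. borel) \<xi> J \<longrightarrow>
      (\<forall>m\<in>J. integrable Q (\<lambda>x. \<xi> m x ^ 4)) \<longrightarrow>
      (\<forall>m\<in>J. (\<integral>x. \<xi> m x \<partial>Q) = 0) \<longrightarrow>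
      \<bar>(\<Sum>m\<in>J. \<integral>x. (\<xi> m x)\<^sup>2 \<partial>Q) - 1\<bar> \<le> \<delta> \<longrightarrow>
      (\<Sum>m\<in>J. \<integral>x. \<xi> m x ^ 4 \<partial>Q) \<le> \<delta> \<longrightarrow>
      R \<in> borel_measurable Q \<longrightarrow> integrable Q (\<lambda>x. (R x)\<^sup>2) \<longrightarrow> (\<integral>x. (R x)\<^sup>2 \<partial>Q) \<le> \<delta> \<longrightarrow>
      bl_dist (distr Q borel (\<lambda>x. (\<Sum>m\<in>J. \<xi> m x) + R x)) std_normal_distribution \<le> \<epsilon>)"

lemma clt_threshold_exists:
  assumes "0 < \<epsilon>" obtains \<delta> where "0 < \<delta>" "clt_threshold TYPE('w) \<epsilon> \<delta>"
proof (rule bl_dist_independent_sum_le[OF assms, where 'w='w and 'i=nat], goal_cases)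
  case (1 \<delta>)
  show ?case by (rule 1(1)[OF 1(2)]) (unfold clt_threshold_def, use 1(3) in blast)
qed

lemma clt_thresholdD:
  fixes Q :: "'w measure" and J :: "nat set"
  assumes "clt_threshold TYPE('w) \<epsilon> \<delta>" "prob_space Q" "finite J" "prob_space.indep_vars Q (\<lambda>_. borel) \<xi> J"
    "\<And>m. m \<in> J \<Longrightarrow> integrable Q (\<lambda>x. \<xi> m x ^ 4)" "\<And>m. m \<in> J \<Longrightarrow> (\<integral>x. \<xi> m x \<partial>Q) = 0"
    "\<bar>(\<Sum>m\<in>J. \<integral>x. (\<xi> m x)\<^sup>2 \<partial>Q) - 1\<bar> \<le> \<delta>" "(\<Sum>m\<in>J. \<integral>x. \<xi> m x ^ 4 \<partial>Q) \<le> \<delta>"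
    "R \<in> borel_measurable Q" "integrable Q (\<lambda>x. (R x)\<^sup>2)" "(\<integral>x. (R x)\<^sup>2 \<partial>Q) \<le> \<delta>"
  shows "bl_dist (distr Q borel (\<lambda>x. (\<Sum>m\<in>J. \<xi> m x) + R x)) std_normal_distribution \<le> \<epsilon>"
  using assms unfolding clt_threshold_def by blast

section \<open>Graphs with four edges\<close>

text \<open>Handshake lemma: count incidences of vertices and edges in both orders.\<close>

lemma sum_degree:
  fixes E :: "nat \<Rightarrow> 'v set"
  assumes "finite V" "finite A" "\<And>i. i \<in> A \<Longrightarrow> E i \<subseteq> V"
  shows "(\<Sum>v\<in>V. card {i \<in> A. v \<in> E i}) = (\<Sum>i\<in>A. card (E i))"
proof -
  have "(\<Sum>v\<in>V. card {i \<in> A. v \<in> E i}) = (\<Sum>v\<in>V. \<Sum>i\<in>A. of_bool (v \<in> E i))"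
    using assms by (simp add: of_bool_def sum.If_cases Int_def)
  also have "\<dots> = (\<Sum>i\<in>A. \<Sum>v\<in>V. of_bool (v \<in> E i))" by (rule sum.swap)
  also have "\<dots> = (\<Sum>i\<in>A. card (E i))"
  proof (rule sum.cong)
    fix i assume "i \<in> A"
    then have "E i = {v \<in> V. v \<in> E i}" using assms by auto
    then show "(\<Sum>v\<in>V. of_bool (v \<in> E i)) = card (E i)"
      using assms by (simp add: of_bool_def sum.If_cases Int_def)
  qed simp
  finally show ?thesis .
qed

text \<open>Edges form a family indexed by \<open>i < 4\<close>, so repeated edges count with
  multiplicity. The condition \<open>deg\<close> singles out the graphs that survive: a vertex on
  only one edge makes the expectation of the product of a degenerate kernel vanish.\<close>

context
  fixes E :: "nat \<Rightarrow> 'v set" and V :: "'v set"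
  assumes two: "\<And>i. i < 4 \<Longrightarrow> card (E i) = 2"
    and V: "V = (\<Union>i<4. E i)"
    and deg: "\<And>i v. i < 4 \<Longrightarrow> v \<in> E i \<Longrightarrow> \<exists>j<4. j \<noteq> i \<and> v \<in> E j"
begin

lemma finite_four_edges: "finite V"
proof -
  have "finite (E i)" if "i < 4" for i using two[OF that] by (metis card.infinite zero_neq_numeral)
  then show ?thesis unfolding V by auto
qed

lemma four_edges_degree_ge: "v \<in> V \<Longrightarrow> 2 \<le> card {i. i < 4 \<and> v \<in> E i}"
proof -
  assume "v \<in> V"
  then obtain i where i: "i < 4" "v \<in> E i" unfolding V by auto
  from deg[OF this] obtain j where j: "j < 4" "j \<noteq> i" "v \<in> E j" by auto
  have "card {i, j} \<le> card {i. i < 4 \<and> v \<in> E i}" using i j by (intro card_mono) auto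
  then show ?thesis using j by simp
qed

lemma four_edges_degree_sum: "(\<Sum>v\<in>V. card {i. i < 4 \<and> v \<in> E i}) = 8"
proof -
  have "(\<Sum>v\<in>V. card {i \<in> {..<4}. v \<in> E i}) = (\<Sum>i<4. card (E i))"
    by (rule sum_degree[OF finite_four_edges]) (auto simp: V)
  also have "\<dots> = 8" using two by simp
  finally show ?thesis by simp
qed

lemma four_edges_card_le: "card V \<le> 4"
proof -
  have "(\<Sum>v\<in>V. 2) \<le> (\<Sum>v\<in>V. card {i. i < 4 \<and> v \<in> E i})"
    by (rule sum_mono) (rule four_edges_degree_ge)
  then show ?thesis by (simp add: four_edges_degree_sum)
qed

lemma four_edges_card_ge: "2 \<le> card V"
proof -
  have "E 0 \<subseteq> V" unfolding V by (rule UN_upper) simp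
  from card_mono[OF finite_four_edges this] show ?thesis using two[of 0] by simp
qed

lemma four_edges_card2:
  assumes "card V = 2" "i < 4" shows "E i = V"
  using assms two finite_four_edges by (intro card_subset_eq) (auto simp: V)

text \<open>Three vertices have only three two-element subsets, so by pigeonhole two of the four
  edges coincide. The vertex they miss lies on some further edge \<open>k\<close>.\<close>

lemma four_edges_card3:
  assumes c: "card V = 3"
  obtains i j k v where "i < 4" "j < 4" "k < 4" "i \<noteq> j" "k \<noteq> i" "k \<noteq> j" "E i = E j" "v \<in> E k" "v \<notin> E i"
proof -
  have "E ` {..<4} \<subseteq> {A. A \<subseteq> V \<and> card A = 2}" using two by (auto simp: V)
  then have "card (E ` {..<4}) \<le> card {A. A \<subseteq> V \<and> card A = 2}"
    using finite_four_edges by (intro card_mono) auto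
  also have "\<dots> = 3" using n_subsets[OF finite_four_edges, of 2] c by (simp add: numeral_eq_Suc)
  finally have "\<not> inj_on E {..<4}" using card_image[of E "{..<4}"] by auto
  then obtain i j where ij: "i < 4" "j < 4" "i \<noteq> j" "E i = E j" by (auto simp: inj_on_def)
  have "E i \<noteq> V" using c two[of i] ij by auto
  then obtain v where v: "v \<in> V" "v \<notin> E i" using ij unfolding V by blast
  then obtain k where "k < 4" "v \<in> E k" unfolding V by auto
  then show thesis using that[of i j k v] ij v by metis
qed

text \<open>The degree sum 8 with all degrees at least 2 forces every degree to be exactly 2. The
  edges then split into two pairs of disjoint edges, each pair covering all vertices; the graph is a
  4-cycle or two doubled edges.\<close>

lemma four_edges_card4:
  assumes c: "card V = 4"
  obtains j k l where "{0, j, k, l} = {..<4}" "distinct [0, j, k, l]" "E 0 \<inter> E j = {}" "E k \<inter> E l = {}"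
proof -
  have d2: "card {i. i < 4 \<and> v \<in> E i} = 2" if v: "v \<in> V" for v
  proof (rule ccontr)
    assume "\<not> ?thesis"
    then have "2 < card {i. i < 4 \<and> v \<in> E i}" using four_edges_degree_ge[OF v] by simp
    then have "(\<Sum>v\<in>V. 2) < (\<Sum>v\<in>V. card {i. i < 4 \<and> v \<in> E i})"
      using v four_edges_degree_ge finite_four_edges by (intro sum_strict_mono_ex1) auto
    then show False using c four_edges_degree_sum by simp
  qed
  have no3: False if "v \<in> E a" "v \<in> E b" "v \<in> E d" "a < 4" "b < 4" "d < 4" "distinct [a, b, d]" for v a b d
  proof -
    have "card {a, b, d} \<le> card {i. i < 4 \<and> v \<in> E i}" using that by (intro card_mono) auto
    moreover have "v \<in> V" using that V by auto
    ultimately show False using d2 that by simp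
  qed
  have fin: "finite (E i)" if "i < 4" for i using finite_four_edges that V by (auto intro: finite_subset)
  have "\<exists>j\<in>{1,2,3}. E 0 \<inter> E j = {}"
  proof (rule ccontr)
    assume "\<not> ?thesis"
    then have ne: "E 0 \<inter> E j \<noteq> {}" if "j \<in> {1,2,3}" for j using that by blast
    have ge: "1 \<le> card (E 0 \<inter> E j)" if "j \<in> {1,2,3}" for j
      using ne[OF that] fin[of 0] by (simp add: Suc_le_eq card_gt_0_iff)
    \<comment> \<open>The degrees of the two ends of \<open>E 0\<close> add up to 4. But
      \<open>E 0\<close> itself contributes 2, and each of the other three edges would contribute at
      least 1.\<close>
    have "(\<Sum>v\<in>E 0. card {i \<in> {..<4}. v \<in> E 0 \<inter> E i}) = (\<Sum>i<4. card (E 0 \<inter> E i))"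
      by (rule sum_degree) (auto simp: fin)
    moreover have "(\<Sum>v\<in>E 0. card {i \<in> {..<4}. v \<in> E 0 \<inter> E i}) = (\<Sum>v\<in>E 0. 2)"
    proof (rule sum.cong)
      fix v assume "v \<in> E 0"
      then have "v \<in> V" "{i \<in> {..<4}. v \<in> E 0 \<inter> E i} = {i. i < 4 \<and> v \<in> E i}" by (auto simp: V)
      then show "card {i \<in> {..<4}. v \<in> E 0 \<inter> E i} = 2" using d2 by simp
    qed simp
    moreover have "(\<Sum>i<4. card (E 0 \<inter> E i)) = card (E 0) + card (E 0 \<inter> E 1) + card (E 0 \<inter> E 2) + card (E 0 \<inter> E 3)"
      by (simp add: numeral_eq_Suc)
    ultimately show False using ge[of 1] ge[of 2] ge[of 3] two[of 0] by simp
  qed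
  then obtain j where j: "j \<in> {1,2,3}" "E 0 \<inter> E j = {}" by auto
  then obtain k l where kl: "{0, j, k, l} = {..<4}" "distinct [0, j, k, l]"
  proof -
    have e: "{..<4::nat} = {0,1,2,3}" by auto
    consider "j = 1" | "j = 2" | "j = 3" using j by auto
    then show thesis
    proof cases
      case 1 then show thesis by (intro that[of 2 3]) (auto simp: e)
    next
      case 2 then show thesis by (intro that[of 1 3]) (auto simp: e)
    next
      case 3 then show thesis by (intro that[of 1 2]) (auto simp: e)
    qed
  qed
  have "j \<in> {..<4}" "k \<in> {..<4}" "l \<in> {..<4}" unfolding kl(1)[symmetric] by simp_all
  then have lt: "j < 4" "k < 4" "l < 4" by simp_all
  have "card (E 0 \<union> E j) = 4" using j two[of 0] two[of j] lt fin by (subst card_Un_disjoint) auto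
  moreover have "E 0 \<union> E j \<subseteq> V" using lt(1) unfolding V by (intro Un_least UN_upper) auto
  ultimately have "E 0 \<union> E j = V" using c finite_four_edges by (intro card_subset_eq) auto
  have "E k \<inter> E l = {}"
  proof (rule ccontr)
    assume "E k \<inter> E l \<noteq> {}"
    then obtain v where v: "v \<in> E k" "v \<in> E l" by auto
    have "v \<in> V" using v(1) lt(2) unfolding V by blast
    then have "v \<in> E 0 \<or> v \<in> E j" using \<open>E 0 \<union> E j = V\<close> by blast
    then show False
    proof
      assume "v \<in> E 0"
      from no3[OF this v] lt kl(2) show False by simp
    next
      assume "v \<in> E j"
      from no3[OF this v] lt kl(2) show False by simp
    qed
  qed
  then show thesis using that[OF kl j(2)] by simp
qed

end

definition pairs :: "'i set \<Rightarrow> ('i \<times> 'i) set" where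
  "pairs J = Sigma J (\<lambda>r. J - {r})"

lemma finite_pairs[simp]: "finite J \<Longrightarrow> finite (pairs J)" by (simp add: pairs_def)

lemma mem_pairs: "e \<in> pairs J \<longleftrightarrow> fst e \<in> J \<and> snd e \<in> J \<and> fst e \<noteq> snd e"
  by (cases e) (auto simp: pairs_def)

lemma sum_pairs: "finite J \<Longrightarrow> sum f (pairs J) = (\<Sum>r\<in>J. \<Sum>s\<in>J - {r}. f (r, s))"
  unfolding pairs_def by (simp add: sum.Sigma)

lemma card_pairs: "finite J \<Longrightarrow> card (pairs J) = card J * (card J - 1)"
  unfolding pairs_def by (subst card_SigmaI) auto

text \<open>A tuple on \<open>j\<close> vertices is recovered from an enumeration of its vertex set,
  at most \<open>card J ^ j\<close> choices, and from the labels below \<open>j\<close> of the two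
  ends of its four edges, \<open>(j * j) ^ 4\<close> choices.\<close>

lemma card_pair_tuples_le:
  assumes J: "finite J"
  shows "card {e \<in> PiE {..<4::nat} (\<lambda>_. pairs J). card (\<Union>i<4. {fst (e i), snd (e i)}) = j}
           \<le> (j * j) ^ 4 * card J ^ j"
proof -
  let ?S = "{e \<in> PiE {..<4::nat} (\<lambda>_. pairs J). card (\<Union>i<4. {fst (e i), snd (e i)}) = j}"
  let ?A = "PiE {..<j} (\<lambda>_. J)" and ?B = "PiE {..<4::nat} (\<lambda>_. {..<j} \<times> {..<j})"
  let ?f = "\<lambda>(v :: nat \<Rightarrow> 'a, \<phi> :: nat \<Rightarrow> nat \<times> nat). \<lambda>i\<in>{..<4}. (v (fst (\<phi> i)), v (snd (\<phi> i)))"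
  have fin: "finite (?A \<times> ?B)" using J by (intro finite_cartesian_product finite_PiE) auto
  have "?S \<subseteq> ?f ` (?A \<times> ?B)"
  proof
    fix e assume e: "e \<in> ?S"
    let ?V = "\<Union>i<4. {fst (e i), snd (e i)}"
    have "finite ?V" by auto
    then obtain h where h: "bij_betw h {..<j} ?V"
      using ex_bij_betw_nat_finite[of ?V] e by (auto simp: atLeast0LessThan)
    have VJ: "?V \<subseteq> J" using e by (force simp: PiE_def Pi_def mem_pairs)
    define v where "v = restrict h {..<j}"
    define p where "p x = the_inv_into {..<j} h x" for x
    have p: "p x < j" "h (p x) = x" if "x \<in> ?V" for x
      using that h f_the_inv_into_f_bij_betw[OF h, of x] the_inv_into_into[of h "{..<j}" x "{..<j}"]
      by (auto simp: p_def bij_betw_def)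
    define \<phi> where "\<phi> = (\<lambda>i\<in>{..<4::nat}. (p (fst (e i)), p (snd (e i))))"
    have in_V: "fst (e i) \<in> ?V" "snd (e i) \<in> ?V" if "i < 4" for i using that by blast+
    have "h i \<in> J" if "i < j" for i using bij_betwE[OF h] VJ that by blast
    then have "v \<in> ?A" by (simp add: v_def)
    moreover have "\<phi> \<in> ?B" using p(1)[OF in_V(1)] p(1)[OF in_V(2)] by (simp add: \<phi>_def)
    moreover have "e = ?f (v, \<phi>)"
    proof
      fix i show "e i = ?f (v, \<phi>) i"
      proof (cases "i < 4")
        case True
        then show ?thesis using p[OF in_V(1)[OF True]] p[OF in_V(2)[OF True]] by (simp add: v_def \<phi>_def)
      next
        case False
        then show ?thesis using e by (auto simp: PiE_def extensional_def)
      qed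
    qed
    ultimately show "e \<in> ?f ` (?A \<times> ?B)" by blast
  qed
  then have "card ?S \<le> card (?f ` (?A \<times> ?B))" using fin by (intro card_mono finite_imageI)
  also have "\<dots> \<le> card (?A \<times> ?B)" by (rule card_image_le[OF fin])
  also have "\<dots> = (j * j) ^ 4 * card J ^ j" using J by (simp add: card_cartesian_product card_PiE)
  finally show ?thesis .
qed

section \<open>Moments of U-statistics\<close>

abbreviation iid :: "'a measure \<Rightarrow> 'i set \<Rightarrow> ('i \<Rightarrow> 'a) measure" where
  "iid M J \<equiv> PiM J (\<lambda>_. M)"

context prob_space
begin

lemma product_prob: "product_prob_space (\<lambda>_. M)"
  by unfold_locales

lemma prob_space_PiM: "prob_space (iid M J)"
  by (rule prob_space_PiM) unfold_locales

text \<open>Splits one coordinate off an i.i.d. sample: it is independent of every statistic that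
  ignores it, which \<open>dep\<close> expresses by invariance under updating \<open>a\<close>.
  Iterating gives the joint laws of two, three and four coordinates as right-nested
  products.\<close>

lemma distr_PiM_pick:
  assumes J: "finite J" "a \<in> J"
    and V[measurable]: "V \<in> measurable (iid M J) N" "V \<in> measurable (iid M (J - {a})) N"
    and dep: "\<And>w z. V (w(a := z)) = V w"
  shows "distr (iid M J) (M \<Otimes>\<^sub>M N) (\<lambda>w. (w a, V w)) = M \<Otimes>\<^sub>M distr (iid M (J - {a})) N V"
proof (rule measure_eqI)
  interpret P: product_prob_space "\<lambda>_. M" by (rule product_prob)
  interpret V: prob_space "distr (iid M (J - {a})) N V"
    by (rule prob_space.prob_space_distr[OF prob_space_PiM V(2)])
  interpret pair_prob_space M "distr (iid M (J - {a})) N V" ..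
  have [measurable]: "(\<lambda>w. w a) \<in> measurable (iid M J) M" using J by measurable
  fix A assume "A \<in> sets (distr (iid M J) (M \<Otimes>\<^sub>M N) (\<lambda>w. (w a, V w)))"
  then have A[measurable]: "A \<in> sets (M \<Otimes>\<^sub>M N)" by simp
  then have A'[measurable]: "A \<in> sets (M \<Otimes>\<^sub>M distr (iid M (J - {a})) N V)" by simp
  have ins: "insert a (J - {a}) = J" using J by auto
  have m: "(\<lambda>w. indicator A (w a, V w) :: ennreal) \<in> borel_measurable (iid M J)" by measurable
  have "emeasure (distr (iid M J) (M \<Otimes>\<^sub>M N) (\<lambda>w. (w a, V w))) A
      = (\<integral>\<^sup>+x. indicator A x \<partial>distr (iid M J) (M \<Otimes>\<^sub>M N) (\<lambda>w. (w a, V w)))"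
    by (rule nn_integral_indicator[symmetric]) (simp add: A)
  also have "\<dots> = (\<integral>\<^sup>+w. indicator A (w a, V w) \<partial>iid M J)"
    by (rule nn_integral_distr) measurable
  also have "\<dots> = (\<integral>\<^sup>+w. \<integral>\<^sup>+z. indicator A (z, V w) \<partial>M \<partial>iid M (J - {a}))"
    using P.product_nn_integral_insert[of "J - {a}" a "\<lambda>w. indicator A (w a, V w)", unfolded ins, OF _ _ m] J
    by (simp add: dep)
  also have "\<dots> = (\<integral>\<^sup>+v. \<integral>\<^sup>+z. indicator A (z, v) \<partial>M \<partial>distr (iid M (J - {a})) N V)"
    by (subst nn_integral_distr) auto
  also have "\<dots> = emeasure (M \<Otimes>\<^sub>M distr (iid M (J - {a})) N V) A"
    by (subst nn_integral_snd) (auto intro: A')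
  finally show "emeasure (distr (iid M J) (M \<Otimes>\<^sub>M N) (\<lambda>w. (w a, V w))) A = emeasure (M \<Otimes>\<^sub>M distr (iid M (J - {a})) N V) A" .
qed simp

lemma distr_PiM_1: "finite J \<Longrightarrow> a \<in> J \<Longrightarrow> distr (iid M J) M (\<lambda>w. w a) = M"
  using product_prob_space.PiM_component[OF product_prob] .

lemma distr_PiM_2:
  assumes "finite J" "a \<in> J" "b \<in> J" "a \<noteq> b"
  shows "distr (iid M J) (M \<Otimes>\<^sub>M M) (\<lambda>w. (w a, w b)) = M \<Otimes>\<^sub>M M"
  using assms by (subst distr_PiM_pick) (auto simp: distr_PiM_1)

lemma distr_PiM_3:
  assumes "finite J" "a \<in> J" "b \<in> J" "c \<in> J" "distinct [a, b, c]"
  shows "distr (iid M J) (M \<Otimes>\<^sub>M (M \<Otimes>\<^sub>M M)) (\<lambda>w. (w a, w b, w c)) = M \<Otimes>\<^sub>M (M \<Otimes>\<^sub>M M)"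
  using assms by (subst distr_PiM_pick) (auto simp: distr_PiM_2)

lemma distr_PiM_4:
  assumes "finite J" "a \<in> J" "b \<in> J" "c \<in> J" "d \<in> J" "distinct [a, b, c, d]"
  shows "distr (iid M J) (M \<Otimes>\<^sub>M (M \<Otimes>\<^sub>M (M \<Otimes>\<^sub>M M))) (\<lambda>w. (w a, w b, w c, w d)) = M \<Otimes>\<^sub>M (M \<Otimes>\<^sub>M (M \<Otimes>\<^sub>M M))"
  using assms by (subst distr_PiM_pick) (auto simp: distr_PiM_3)

text \<open>Fubini with the coordinate \<open>s\<close> integrated first.\<close>

lemma integral_PiM_vertex_0:
  fixes F :: "('i \<Rightarrow> 'a) \<Rightarrow> real"
  assumes J: "finite J" "s \<in> J" and F: "integrable (iid M J) F"
    and 0: "\<And>w. w \<in> space (iid M (J - {s})) \<Longrightarrow> (\<integral>z. F (w(s := z)) \<partial>M) = 0"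
  shows "(\<integral>w. F w \<partial>iid M J) = 0"
proof -
  interpret P: product_prob_space "\<lambda>_. M" by (rule product_prob)
  have ins: "insert s (J - {s}) = J" using J by auto
  have "(\<integral>w. F w \<partial>iid M J) = (\<integral>w. \<integral>z. F (w(s := z)) \<partial>M \<partial>iid M (J - {s}))"
    using P.product_integral_insert[of "J - {s}" s F, unfolded ins, OF _ _ F] J by simp
  also have "\<dots> = (\<integral>w. 0 \<partial>iid M (J - {s}))" using 0 by (intro Bochner_Integration.integral_cong) auto
  finally show ?thesis by simp
qed

end

lemma integrable_mult_L2:
  fixes u v :: "'a \<Rightarrow> real"
  assumes [measurable]: "u \<in> borel_measurable N" "v \<in> borel_measurable N"
    and "integrable N (\<lambda>x. (u x)\<^sup>2)" "integrable N (\<lambda>x. (v x)\<^sup>2)"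
  shows "integrable N (\<lambda>x. u x * v x)"
proof (rule Bochner_Integration.integrable_bound)
  show "integrable N (\<lambda>x. (u x)\<^sup>2 + (v x)\<^sup>2)" using assms by simp
  show "AE x in N. norm (u x * v x) \<le> norm ((u x)\<^sup>2 + (v x)\<^sup>2)"
  proof (rule AE_I2)
    fix x
    have "0 \<le> (\<bar>u x\<bar> - \<bar>v x\<bar>)\<^sup>2" by simp
    then have "2 * (\<bar>u x\<bar> * \<bar>v x\<bar>) \<le> (u x)\<^sup>2 + (v x)\<^sup>2" by (simp add: power2_diff)
    moreover have "0 \<le> \<bar>u x\<bar> * \<bar>v x\<bar>" by simp
    ultimately show "norm (u x * v x) \<le> norm ((u x)\<^sup>2 + (v x)\<^sup>2)"
      unfolding real_norm_def abs_mult by linarith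
  qed
qed measurable

section \<open>Variance of U-statistics of order two\<close>

locale kernel = prob_space M for M :: "'a measure" +
  fixes f :: "'a \<Rightarrow> 'a \<Rightarrow> real"
  assumes f_meas: "(\<lambda>z. f (fst z) (snd z)) \<in> borel_measurable (M \<Otimes>\<^sub>M M)"
    and f_sym: "\<And>x y. x \<in> space M \<Longrightarrow> y \<in> space M \<Longrightarrow> f x y = f y x"
    and f_L2: "integrable (M \<Otimes>\<^sub>M M) (\<lambda>z. (f (fst z) (snd z))\<^sup>2)"
begin

interpretation PP: pair_prob_space M M ..

lemma f_comp[measurable (raw)]:
  "u \<in> measurable N M \<Longrightarrow> v \<in> measurable N M \<Longrightarrow> (\<lambda>x. f (u x) (v x)) \<in> borel_measurable N"
  using measurable_compose[OF measurable_Pair f_meas, of u N v] by simp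

lemma f_int: "integrable (M \<Otimes>\<^sub>M M) (\<lambda>z. f (fst z) (snd z))"
  by (rule PP.P.square_integrable_imp_integrable[OF f_meas f_L2])

text \<open>The uncentred first Hoeffding projection. Its second moment \<beta> measures the linear
  part of the U-statistic, \<kappa> is the squared norm of the kernel and \<theta> its mean.\<close>

definition "f1 x = (\<integral>y. f x y \<partial>M)"
definition "\<kappa> = (\<integral>z. (f (fst z) (snd z))\<^sup>2 \<partial>(M \<Otimes>\<^sub>M M))"
definition "\<theta> = (\<integral>z. f (fst z) (snd z) \<partial>(M \<Otimes>\<^sub>M M))"
definition "\<beta> = (\<integral>x. (f1 x)\<^sup>2 \<partial>M)"

lemma f1_meas[measurable]: "f1 \<in> borel_measurable M"
  unfolding f1_def by measurable

lemma \<kappa>_nonneg: "0 \<le> \<kappa>" and \<beta>_nonneg: "0 \<le> \<beta>" unfolding \<kappa>_def \<beta>_def by auto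

lemma edge_L2:
  assumes J: "finite J" and e: "e \<in> pairs J"
  shows "integrable (iid M J) (\<lambda>w. (f (w (fst e)) (w (snd e)))\<^sup>2)"
    "(\<integral>w. (f (w (fst e)) (w (snd e)))\<^sup>2 \<partial>iid M J) = \<kappa>"
    "(\<integral>w. f (w (fst e)) (w (snd e)) \<partial>iid M J) = \<theta>"
    "(\<lambda>w. f (w (fst e)) (w (snd e))) \<in> borel_measurable (iid M J)"
proof -
  have e': "fst e \<in> J" "snd e \<in> J" "fst e \<noteq> snd e" using e by (auto simp: mem_pairs)
  note [measurable] = f_meas
  have [measurable]: "(\<lambda>w. w (fst e)) \<in> measurable (iid M J) M" "(\<lambda>w. w (snd e)) \<in> measurable (iid M J) M"
    using e' by measurable
  note d = distr_PiM_2[OF J e', symmetric]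
  have m: "(\<lambda>w. (w (fst e), w (snd e))) \<in> measurable (iid M J) (M \<Otimes>\<^sub>M M)" by measurable
  show "(\<lambda>w. f (w (fst e)) (w (snd e))) \<in> borel_measurable (iid M J)" by measurable
  show "integrable (iid M J) (\<lambda>w. (f (w (fst e)) (w (snd e)))\<^sup>2)"
    using f_L2 by (subst (asm) d) (simp add: integrable_distr_eq m)
  show "(\<integral>w. (f (w (fst e)) (w (snd e)))\<^sup>2 \<partial>iid M J) = \<kappa>"
    unfolding \<kappa>_def by (subst d) (simp add: integral_distr m)
  show "(\<integral>w. f (w (fst e)) (w (snd e)) \<partial>iid M J) = \<theta>"
    unfolding \<theta>_def by (subst d) (simp add: integral_distr m)
qed

lemma edge_int:
  assumes J: "finite J" and e: "e \<in> pairs J"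
  shows "integrable (iid M J) (\<lambda>w. f (w (fst e)) (w (snd e)))"
  by (rule finite_measure.square_integrable_imp_integrable[OF prob_space.finite_measure[OF prob_space_PiM] edge_L2(4,1)[OF assms]])

lemma edge_mult_int:
  assumes "finite J" "e \<in> pairs J" "e' \<in> pairs J"
  shows "integrable (iid M J) (\<lambda>w. f (w (fst e)) (w (snd e)) * f (w (fst e')) (w (snd e')))"
  using assms by (intro integrable_mult_L2 edge_L2)

lemma edges_disjoint:
  assumes J: "finite J" and abcd: "a \<in> J" "b \<in> J" "c \<in> J" "d \<in> J" "distinct [a, b, c, d]"
  shows "(\<integral>w. f (w a) (w b) * f (w c) (w d) \<partial>iid M J) = \<theta>\<^sup>2"
proof -
  interpret Q: pair_prob_space M "M \<Otimes>\<^sub>M M" ..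
  interpret Q': pair_prob_space M "M \<Otimes>\<^sub>M (M \<Otimes>\<^sub>M M)" ..
  note d = distr_PiM_4[OF J abcd]
  have [measurable]: "(\<lambda>w. (w a, w b, w c, w d)) \<in> measurable (iid M J) (M \<Otimes>\<^sub>M (M \<Otimes>\<^sub>M (M \<Otimes>\<^sub>M M)))"
    using abcd by (intro measurable_Pair measurable_component_singleton)
  have m: "(\<lambda>z. f (fst z) (fst (snd z)) * f (fst (snd (snd z))) (snd (snd (snd z)))) \<in> borel_measurable (M \<Otimes>\<^sub>M (M \<Otimes>\<^sub>M (M \<Otimes>\<^sub>M M)))"
    by (intro borel_measurable_times f_comp) simp_all
  have ab: "(a, b) \<in> pairs J" "(c, d) \<in> pairs J" using abcd by (auto simp: mem_pairs)
  have int: "integrable (M \<Otimes>\<^sub>M (M \<Otimes>\<^sub>M (M \<Otimes>\<^sub>M M))) (\<lambda>z. f (fst z) (fst (snd z)) * f (fst (snd (snd z))) (snd (snd (snd z))))"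
    using edge_mult_int[OF J ab] m by (subst d[symmetric]) (simp add: integrable_distr_eq)
  have "(\<integral>w. f (w a) (w b) * f (w c) (w d) \<partial>iid M J)
    = (\<integral>z. f (fst z) (fst (snd z)) * f (fst (snd (snd z))) (snd (snd (snd z))) \<partial>(M \<Otimes>\<^sub>M (M \<Otimes>\<^sub>M (M \<Otimes>\<^sub>M M))))"
    using m by (subst d[symmetric]) (simp add: integral_distr)
  also have "\<dots> = (\<integral>x. \<integral>z. f x (fst z) * f (fst (snd z)) (snd (snd z)) \<partial>(M \<Otimes>\<^sub>M (M \<Otimes>\<^sub>M M)) \<partial>M)"
    by (subst Q'.integral_fst'[symmetric, OF int]) simp
  also have "\<dots> = (\<integral>x. f1 x * \<theta> \<partial>M)"
  proof (rule integral_cong_AE)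
    show "(\<lambda>x. \<integral>z. f x (fst z) * f (fst (snd z)) (snd (snd z)) \<partial>(M \<Otimes>\<^sub>M (M \<Otimes>\<^sub>M M))) \<in> borel_measurable M"
      using m by measurable
    have "AE x in M. integrable (M \<Otimes>\<^sub>M (M \<Otimes>\<^sub>M M)) (\<lambda>z. f x (fst z) * f (fst (snd z)) (snd (snd z)))"
      using Q'.AE_integrable_fst'[OF int] by simp
    then show "AE x in M. (\<integral>z. f x (fst z) * f (fst (snd z)) (snd (snd z)) \<partial>(M \<Otimes>\<^sub>M (M \<Otimes>\<^sub>M M))) = f1 x * \<theta>"
    proof eventually_elim
      case (elim x)
      show ?case
        by (subst Q.integral_fst'[symmetric, OF elim]) (simp add: f1_def \<theta>_def)
    qed
  qed measurable
  also have "\<dots> = \<theta>\<^sup>2"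
    using PP.integral_fst'[OF f_int] by (simp add: f1_def[abs_def] \<theta>_def power2_eq_square)
  finally show ?thesis .
qed

text \<open>Given the common vertex the two free ends are independent, so the inner integral is the
  square of \<open>f1\<close>. Sections are integrable only almost everywhere, whence the comparison
  of integrands up to null sets.\<close>

lemma edges_share:
  assumes J: "finite J" and abc: "a \<in> J" "b \<in> J" "c \<in> J" "distinct [a, b, c]"
  shows "(\<integral>w. f (w a) (w b) * f (w a) (w c) \<partial>iid M J) = \<beta>"
proof -
  interpret Q: pair_prob_space M "M \<Otimes>\<^sub>M M" ..
  note d = distr_PiM_3[OF J abc]
  have [measurable]: "(\<lambda>w. (w a, w b, w c)) \<in> measurable (iid M J) (M \<Otimes>\<^sub>M (M \<Otimes>\<^sub>M M))"
    using abc by (intro measurable_Pair measurable_component_singleton)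
  have m: "(\<lambda>z. f (fst z) (fst (snd z)) * f (fst z) (snd (snd z))) \<in> borel_measurable (M \<Otimes>\<^sub>M (M \<Otimes>\<^sub>M M))"
    by (intro borel_measurable_times f_comp) simp_all
  have ab: "(a, b) \<in> pairs J" "(a, c) \<in> pairs J" using abc by (auto simp: mem_pairs)
  have int: "integrable (M \<Otimes>\<^sub>M (M \<Otimes>\<^sub>M M)) (\<lambda>z. f (fst z) (fst (snd z)) * f (fst z) (snd (snd z)))"
    using edge_mult_int[OF J ab] m by (subst d[symmetric]) (simp add: integrable_distr_eq)
  have "(\<integral>w. f (w a) (w b) * f (w a) (w c) \<partial>iid M J)
    = (\<integral>z. f (fst z) (fst (snd z)) * f (fst z) (snd (snd z)) \<partial>(M \<Otimes>\<^sub>M (M \<Otimes>\<^sub>M M)))"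
    using m by (subst d[symmetric]) (simp add: integral_distr)
  also have "\<dots> = (\<integral>x. \<integral>z. f x (fst z) * f x (snd z) \<partial>(M \<Otimes>\<^sub>M M) \<partial>M)"
    by (subst Q.integral_fst'[symmetric, OF int]) simp
  also have "\<dots> = (\<integral>x. (f1 x)\<^sup>2 \<partial>M)"
  proof (rule integral_cong_AE)
    show "(\<lambda>x. \<integral>z. f x (fst z) * f x (snd z) \<partial>(M \<Otimes>\<^sub>M M)) \<in> borel_measurable M"
      using m by measurable
    have "AE x in M. integrable (M \<Otimes>\<^sub>M M) (\<lambda>z. f x (fst z) * f x (snd z))"
      using Q.AE_integrable_fst'[OF int] by simp
    then show "AE x in M. (\<integral>z. f x (fst z) * f x (snd z) \<partial>(M \<Otimes>\<^sub>M M)) = (f1 x)\<^sup>2"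
    proof eventually_elim
      case (elim x)
      show ?case
        by (subst PP.integral_fst'[symmetric, OF elim]) (simp add: f1_def power2_eq_square)
    qed
  qed measurable
  finally show ?thesis unfolding \<beta>_def .
qed

end

context kernel
begin

text \<open>The covariance vanishes for disjoint pairs, is at most \<beta> if one vertex is shared
  and at most \<kappa> if both are; subtracting the square of \<theta> only helps. Writing the bound
  with indicators, four for the positions of a shared vertex and two for the orientations of a
  repeated edge, turns the later summation into counting.\<close>

lemma edge_cov_le:
  assumes J: "finite J" and e: "e \<in> pairs J" "e' \<in> pairs J"
  shows "(\<integral>w. (f (w (fst e)) (w (snd e)) - \<theta>) * (f (w (fst e')) (w (snd e')) - \<theta>) \<partial>iid M J)
    \<le> (of_bool (fst e' = fst e) + of_bool (fst e' = snd e) + of_bool (snd e' = fst e) + of_bool (snd e' = snd e)) * \<beta>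
      + (of_bool (fst e' = fst e \<and> snd e' = snd e) + of_bool (fst e' = snd e \<and> snd e' = fst e)) * \<kappa>"
    (is "?l \<le> ?r")
proof -
  interpret P: prob_space "iid M J" by (rule prob_space_PiM)
  obtain a b c d where ed: "e = (a, b)" "e' = (c, d)" by (metis surj_pair)
  have J': "a \<in> J" "b \<in> J" "c \<in> J" "d \<in> J" "a \<noteq> b" "c \<noteq> d" using e by (auto simp: ed mem_pairs)
  let ?F = "\<lambda>p q. \<integral>w. f (w a) (w b) * f (w p) (w q) \<partial>iid M J"
  have "?l = (\<integral>w. f (w a) (w b) * f (w c) (w d) - \<theta> * f (w a) (w b) - \<theta> * f (w c) (w d) + \<theta>\<^sup>2 \<partial>iid M J)"
    by (simp add: ed algebra_simps power2_eq_square)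
  also have "\<dots> = ?F c d - \<theta>\<^sup>2"
    using edge_int[OF J e(1)] edge_int[OF J e(2)] edge_mult_int[OF J e] edge_L2(3)[OF J e(1)] edge_L2(3)[OF J e(2)]
    by (simp add: ed P.prob_space power2_eq_square)
  finally have l: "?l = ?F c d - \<theta>\<^sup>2" .
  have sp: "w \<in> space (iid M J) \<Longrightarrow> r \<in> J \<Longrightarrow> w r \<in> space M" for w r by (auto simp: space_PiM)
  have sw: "?F p q = ?F q p" if "p \<in> J" "q \<in> J" for p q
    using f_sym sp that by (intro Bochner_Integration.integral_cong) auto
  have sw': "?F p q = (\<integral>w. f (w b) (w a) * f (w p) (w q) \<partial>iid M J)" for p q
    using f_sym sp J' by (intro Bochner_Integration.integral_cong) auto
  have pos: "0 \<le> \<theta>\<^sup>2" by simp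
  note nn = \<kappa>_nonneg \<beta>_nonneg
  have k1: "?F a b = \<kappa>" using edge_L2(2)[OF J e(1)] by (simp add: ed power2_eq_square)
  have s1: "?F a q = \<beta>" if "q \<in> J" "q \<noteq> a" "q \<noteq> b" for q
    using edges_share[OF J, of a b q] J' that by auto
  have s2: "?F b q = \<beta>" if "q \<in> J" "q \<noteq> a" "q \<noteq> b" for q
    unfolding sw' using edges_share[OF J, of b a q] J' that by auto
  show ?thesis
  proof (cases "c = a \<or> c = b \<or> d = a \<or> d = b")
    case False
    then have "?F c d = \<theta>\<^sup>2" using edges_disjoint[OF J, of a b c d] J' by auto
    then show ?thesis using False l by (simp add: ed)
  next
    case True
    have "?F c d \<le> ?r"
    proof (cases "{c, d} = {a, b}")
      case True
      then have cd: "c = a \<and> d = b \<or> c = b \<and> d = a" by (auto simp: doubleton_eq_iff)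
      have "?F b a = ?F a b" using J' by (intro sw) auto
      then have k2: "?F b a = \<kappa>" using k1 by (rule trans)
      from cd have "?F c d = \<kappa>"
      proof
        assume "c = a \<and> d = b" then show ?thesis using k1 by blast
      next
        assume "c = b \<and> d = a" then show ?thesis using k2 by blast
      qed
      moreover have "\<kappa> \<le> ?r"
      proof -
        have "1 * \<kappa> \<le> (of_bool (c = a \<and> d = b) + of_bool (c = b \<and> d = a)) * \<kappa>"
          using cd nn(1) by (intro mult_right_mono) auto
        moreover have "0 \<le> (of_bool (c = a) + of_bool (c = b) + of_bool (d = a) + of_bool (d = b)) * \<beta>"
          using nn(2) by (intro mult_nonneg_nonneg) auto
        ultimately show ?thesis unfolding ed fst_conv snd_conv mult_1 by (rule add_increasing[rotated])
      qed
      ultimately show ?thesis by linarith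
    next
      case False
      have "?F c d = \<beta>"
      proof -
        consider "c = a" "d \<noteq> b" | "c = b" "d \<noteq> a" | "d = a" "c \<noteq> b" | "d = b" "c \<noteq> a"
          using True False by (auto simp: doubleton_eq_iff)
        then show ?thesis
        proof cases
          case 1
          have "?F a d = \<beta>" using 1 J' by (intro s1) auto
          then show ?thesis using 1 by blast
        next
          case 2
          have "?F b d = \<beta>" using 2 J' by (intro s2) auto
          then show ?thesis using 2 by blast
        next
          case 3
          have "?F c a = ?F a c" using J' by (intro sw) auto
          also have "\<dots> = \<beta>" using 3 J' by (intro s1) auto
          finally show ?thesis using 3 by blast
        next
          case 4
          have "?F c b = ?F b c" using J' by (intro sw) auto
          also have "\<dots> = \<beta>" using 4 J' by (intro s2) auto
          finally show ?thesis using 4 by blast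
        qed
      qed
      moreover have "\<beta> \<le> ?r"
      proof -
        have "1 * \<beta> \<le> (of_bool (c = a) + of_bool (c = b) + of_bool (d = a) + of_bool (d = b)) * \<beta>"
          using True nn(2) by (intro mult_right_mono) auto
        moreover have "0 \<le> (of_bool (c = a \<and> d = b) + of_bool (c = b \<and> d = a)) * \<kappa>"
          using nn(1) by (intro mult_nonneg_nonneg) auto
        ultimately show ?thesis unfolding ed fst_conv snd_conv mult_1 by (rule add_increasing2[rotated])
      qed
      ultimately show ?thesis by linarith
    qed
    then show ?thesis using l pos by linarith
  qed
qed

lemma sum_pairs_le:
  fixes h :: "'i \<times> 'i \<Rightarrow> real"
  assumes "finite J" "\<And>r s. r \<in> J \<Longrightarrow> s \<in> J \<Longrightarrow> 0 \<le> h (r, s)"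
  shows "sum h (pairs J) \<le> (\<Sum>r\<in>J. \<Sum>s\<in>J. h (r, s))"
proof -
  have "sum h (pairs J) \<le> sum h (J \<times> J)" using assms by (intro sum_mono2) (auto simp: mem_pairs)
  also have "\<dots> = (\<Sum>r\<in>J. \<Sum>s\<in>J. h (r, s))" by (simp add: sum.cartesian_product)
  finally show ?thesis .
qed

text \<open>For each of at most \<open>card J\<close> squared pairs, a second pair can share a
  vertex in four positions with \<open>card J\<close> choices of the other end, and can repeat the
  edge in two orientations. Hence the constants 4 and 2.\<close>

theorem variance_le:
  assumes J: "finite J"
  shows "integrable (iid M J) (\<lambda>w. (\<Sum>e\<in>pairs J. f (w (fst e)) (w (snd e)) - \<theta>)\<^sup>2)" (is "integrable _ (\<lambda>w. (?S w)\<^sup>2)")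
    and "(\<integral>w. (\<Sum>e\<in>pairs J. f (w (fst e)) (w (snd e)) - \<theta>)\<^sup>2 \<partial>iid M J)
       \<le> 4 * real (card J) ^ 3 * \<beta> + 2 * (real (card J))\<^sup>2 * \<kappa>"
proof -
  interpret P: prob_space "iid M J" by (rule prob_space_PiM)
  let ?X = "\<lambda>w e. f (w (fst e)) (w (snd e)) - \<theta>"
  have sq: "(?S w)\<^sup>2 = (\<Sum>e\<in>pairs J. \<Sum>e'\<in>pairs J. ?X w e * ?X w e')" for w
    by (simp add: power2_eq_square sum_product)
  have int: "integrable (iid M J) (\<lambda>w. ?X w e * ?X w e')" if e: "e \<in> pairs J" "e' \<in> pairs J" for e e'
  proof -
    have "integrable (iid M J) (\<lambda>w. f (w (fst e)) (w (snd e)) * f (w (fst e')) (w (snd e'))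
       - \<theta> * f (w (fst e)) (w (snd e)) - \<theta> * f (w (fst e')) (w (snd e')) + \<theta> * \<theta>)"
      using edge_int[OF J e(1)] edge_int[OF J e(2)] edge_mult_int[OF J e] by simp
    then show ?thesis by (simp add: algebra_simps)
  qed
  show "integrable (iid M J) (\<lambda>w. (?S w)\<^sup>2)" unfolding sq by (intro Bochner_Integration.integrable_sum int)
  let ?b = "\<lambda>e e'. (of_bool (fst e' = fst e) + of_bool (fst e' = snd e) + of_bool (snd e' = fst e) + of_bool (snd e' = snd e)) * \<beta>
      + (of_bool (fst e' = fst e \<and> snd e' = snd e) + of_bool (fst e' = snd e \<and> snd e' = fst e)) * \<kappa>"
  have nn: "0 \<le> ?b e e'" for e e' using \<kappa>_nonneg \<beta>_nonneg by (intro add_nonneg_nonneg mult_nonneg_nonneg) auto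
  have "(\<integral>w. (?S w)\<^sup>2 \<partial>iid M J) = (\<Sum>e\<in>pairs J. \<Sum>e'\<in>pairs J. \<integral>w. ?X w e * ?X w e' \<partial>iid M J)"
    unfolding sq by (simp add: int)
  also have "\<dots> \<le> (\<Sum>e\<in>pairs J. \<Sum>e'\<in>pairs J. ?b e e')"
    by (intro sum_mono edge_cov_le[OF J])
  also have "\<dots> \<le> (\<Sum>e\<in>pairs J. \<Sum>c\<in>J. \<Sum>d\<in>J. ?b e (c, d))"
    by (intro sum_mono sum_pairs_le[OF J] nn)
  also have "\<dots> \<le> (\<Sum>a\<in>J. \<Sum>b\<in>J. \<Sum>c\<in>J. \<Sum>d\<in>J. ?b (a, b) (c, d))"
    by (intro sum_pairs_le[OF J] sum_nonneg nn)
  also have "\<dots> = (\<Sum>a\<in>J. \<Sum>b\<in>J. 4 * real (card J) * \<beta> + 2 * \<kappa>)"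
  proof (intro sum.cong refl)
    fix a b assume ab: "a \<in> J" "b \<in> J"
    have 1: "(\<Sum>c\<in>J. \<Sum>d\<in>J. of_bool (c = x) :: real) = card J" "(\<Sum>c\<in>J. \<Sum>d\<in>J. of_bool (d = x) :: real) = card J" if "x \<in> J" for x
      using J that by (simp_all add: of_bool_def sum.delta flip: sum_distrib_left)
    have 2: "(\<Sum>c\<in>J. \<Sum>d\<in>J. of_bool (c = x \<and> d = y) :: real) = 1" if "x \<in> J" "y \<in> J" for x y
      using J that by (simp add: of_bool_conj flip: sum_distrib_left)
    show "(\<Sum>c\<in>J. \<Sum>d\<in>J. ?b (a, b) (c, d)) = 4 * real (card J) * \<beta> + 2 * \<kappa>"
      by (simp only: sum.distrib fst_conv snd_conv 1[OF ab(1)] 1[OF ab(2)] 2[OF ab] 2[OF ab(2,1)] flip: sum_distrib_right) simp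
  qed
  also have "\<dots> = 4 * real (card J) ^ 3 * \<beta> + 2 * (real (card J))\<^sup>2 * \<kappa>"
    by (simp add: power2_eq_square power3_eq_cube algebra_simps)
  finally show "(\<integral>w. (?S w)\<^sup>2 \<partial>iid M J) \<le> 4 * real (card J) ^ 3 * \<beta> + 2 * (real (card J))\<^sup>2 * \<kappa>" .
qed

end

section \<open>Bounded degenerate kernels and their second moments\<close>

locale degenerate_kernel = kernel +
  fixes L :: real
  assumes f_bdd: "\<And>x y. x \<in> space M \<Longrightarrow> y \<in> space M \<Longrightarrow> \<bar>f x y\<bar> \<le> L"
    and f_degen: "\<And>x. x \<in> space M \<Longrightarrow> (\<integral>y. f x y \<partial>M) = 0"
begin

lemma L_nonneg: "0 \<le> L"
proof -
  obtain x where "x \<in> space M" using not_empty by auto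
  then show ?thesis using f_bdd[of x x] by linarith
qed

abbreviation edge :: "('i \<Rightarrow> 'a) \<Rightarrow> 'i \<times> 'i \<Rightarrow> real" where
  "edge w e \<equiv> f (w (fst e)) (w (snd e))"

lemma edge_bdd: "w \<in> space (iid M J) \<Longrightarrow> e \<in> pairs J \<Longrightarrow> \<bar>edge w e\<bar> \<le> L"
  by (intro f_bdd) (auto simp: mem_pairs space_PiM)

lemma edge_prod_int:
  assumes J: "finite J" and e: "\<And>i. i \<in> A \<Longrightarrow> e i \<in> pairs J"
  shows "integrable (iid M J) (\<lambda>w. \<Prod>i\<in>A. edge w (e i))"
proof (rule finite_measure.integrable_const_bound[OF prob_space.finite_measure[OF prob_space_PiM], where B="L ^ card A"])
  show "AE w in iid M J. norm (\<Prod>i\<in>A. edge w (e i)) \<le> L ^ card A"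
  proof (rule AE_I2)
    fix w assume w: "w \<in> space (iid M J)"
    have "norm (\<Prod>i\<in>A. edge w (e i)) = (\<Prod>i\<in>A. \<bar>edge w (e i)\<bar>)" by (simp add: abs_prod)
    also have "\<dots> \<le> (\<Prod>i\<in>A. L)" using edge_bdd[OF w e] by (intro prod_mono) auto
    finally show "norm (\<Prod>i\<in>A. edge w (e i)) \<le> L ^ card A" by simp
  qed
  show "(\<lambda>w. \<Prod>i\<in>A. edge w (e i)) \<in> borel_measurable (iid M J)"
    using edge_L2(4)[OF J e] by (intro borel_measurable_prod)
qed

text \<open>The vertex \<open>s\<close> lies on the edge \<open>k\<close> only. Integrating it out
  first leaves the other factors constant and replaces the factor of \<open>k\<close> by 0 through
  degeneracy; symmetry of the kernel covers both orientations of the edge.\<close>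

lemma edge_prod_0:
  assumes J: "finite J" and A: "finite A" and e: "\<And>i. i \<in> A \<Longrightarrow> e i \<in> pairs J"
    and k: "k \<in> A" "s \<in> {fst (e k), snd (e k)}"
    and other: "\<And>i. i \<in> A \<Longrightarrow> i \<noteq> k \<Longrightarrow> s \<notin> {fst (e i), snd (e i)}"
  shows "(\<integral>w. (\<Prod>i\<in>A. edge w (e i)) \<partial>iid M J) = 0"
proof (rule integral_PiM_vertex_0[OF J, of s])
  have ek: "fst (e k) \<in> J" "snd (e k) \<in> J" "fst (e k) \<noteq> snd (e k)" using e[OF k(1)] by (auto simp: mem_pairs)
  then show "s \<in> J" using k by auto
  show "integrable (iid M J) (\<lambda>w. \<Prod>i\<in>A. edge w (e i))" by (rule edge_prod_int[OF J e])
  fix w assume w: "w \<in> space (iid M (J - {s}))"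
  define t where "t = (if s = fst (e k) then snd (e k) else fst (e k))"
  have t: "t \<noteq> s" "t \<in> J" "e k = (s, t) \<or> e k = (t, s)" using k ek by (auto simp: t_def prod_eq_iff)
  have wt: "w t \<in> space M" using w t by (auto simp: space_PiM)
  have "(\<integral>z. (\<Prod>i\<in>A. edge (w(s := z)) (e i)) \<partial>M) = (\<integral>z. f (w t) z * (\<Prod>i\<in>A - {k}. edge w (e i)) \<partial>M)"
  proof (rule Bochner_Integration.integral_cong[OF refl])
    fix z assume z: "z \<in> space M"
    have "(\<Prod>i\<in>A. edge (w(s := z)) (e i)) = edge (w(s := z)) (e k) * (\<Prod>i\<in>A - {k}. edge (w(s := z)) (e i))"
      by (rule prod.remove[OF A k(1)])
    also have "edge (w(s := z)) (e k) = f (w t) z"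
      using t(3)
    proof
      assume "e k = (s, t)" then show ?thesis using t(1) f_sym[OF z wt] by simp
    next
      assume "e k = (t, s)" then show ?thesis using t(1) by simp
    qed
    also have "(\<Prod>i\<in>A - {k}. edge (w(s := z)) (e i)) = (\<Prod>i\<in>A - {k}. edge w (e i))"
      using other by (intro prod.cong) auto
    finally show "(\<Prod>i\<in>A. edge (w(s := z)) (e i)) = f (w t) z * (\<Prod>i\<in>A - {k}. edge w (e i))" .
  qed
  also have "\<dots> = 0" using f_degen[OF wt] by simp
  finally show "(\<integral>z. (\<Prod>i\<in>A. edge (w(s := z)) (e i)) \<partial>M) = 0" .
qed

lemma \<theta>_0: "\<theta> = 0"
proof -
  interpret PP: pair_prob_space M M ..
  have "\<theta> = (\<integral>x. \<integral>y. f x y \<partial>M \<partial>M)" unfolding \<theta>_def using PP.integral_fst'[OF f_int] by simp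
  also have "\<dots> = (\<integral>x. 0 \<partial>M)" using f_degen by (intro Bochner_Integration.integral_cong) auto
  finally show ?thesis by simp
qed

text \<open>Pairs are ordered, so each one correlates with itself and with its reversal: this is the
  factor 2. Every other pair has a vertex off the first edge and contributes nothing.\<close>

theorem second_moment:
  fixes J :: "'i set"
  assumes J: "finite J"
  shows "(\<integral>w. (\<Sum>e\<in>pairs J. edge w e)\<^sup>2 \<partial>iid M J) = 2 * real (card (pairs J)) * \<kappa>"
proof -
  have sq: "(\<Sum>e\<in>pairs J. edge w e)\<^sup>2 = (\<Sum>e\<in>pairs J. \<Sum>e'\<in>pairs J. edge w e * edge w e')" for w
    by (simp add: power2_eq_square sum_product)
  have "(\<integral>w. (\<Sum>e\<in>pairs J. edge w e)\<^sup>2 \<partial>iid M J) = (\<Sum>e\<in>pairs J. \<Sum>e'\<in>pairs J. \<integral>w. edge w e * edge w e' \<partial>iid M J)"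
    unfolding sq using edge_mult_int[OF J] by simp
  also have "\<dots> = (\<Sum>e\<in>pairs J. 2 * \<kappa>)"
  proof (rule sum.cong[OF refl])
    fix e assume e: "e \<in> pairs J"
    let ?s = "(snd e, fst e)"
    have sw: "?s \<in> pairs J" "?s \<noteq> e" using e by (auto simp: mem_pairs prod_eq_iff)
    have "(\<Sum>e'\<in>pairs J. \<integral>w. edge w e * edge w e' \<partial>iid M J) = (\<Sum>e'\<in>{e, ?s}. \<integral>w. edge w e * edge w e' \<partial>iid M J)"
    proof (rule sum.mono_neutral_right)
      show "\<forall>e'\<in>pairs J - {e, ?s}. (\<integral>w. edge w e * edge w e' \<partial>iid M J) = 0"
      proof
        fix e' assume e': "e' \<in> pairs J - {e, ?s}"
        have "\<exists>s. s \<in> {fst e', snd e'} \<and> s \<notin> {fst e, snd e}"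
          using e' e by (cases e; cases e') (auto simp: mem_pairs)
        then obtain s where s: "s \<in> {fst e', snd e'}" "s \<notin> {fst e, snd e}" by auto
        let ?e = "\<lambda>i::nat. if i = 0 then e else e'"
        have "(\<integral>w. (\<Prod>i\<in>{0,1}. edge w (?e i)) \<partial>iid M J) = 0"
          by (rule edge_prod_0[OF J, where k=1 and s=s]) (use e e' s in auto)
        then show "(\<integral>w. edge w e * edge w e' \<partial>iid M J) = 0" by simp
      qed
    qed (use J e sw in auto)
    also have "\<dots> = (\<integral>w. edge w e * edge w e \<partial>iid M J) + (\<integral>w. edge w e * edge w ?s \<partial>iid M J)"
      using sw by simp
    also have "(\<integral>w. edge w e * edge w ?s \<partial>iid M J) = (\<integral>w. edge w e * edge w e \<partial>iid M J)"
    proof (rule Bochner_Integration.integral_cong[OF refl])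
      fix w assume "w \<in> space (iid M J)"
      then have "edge w ?s = edge w e" using e f_sym by (auto simp: mem_pairs space_PiM)
      then show "edge w e * edge w ?s = edge w e * edge w e" by simp
    qed
    also have "(\<integral>w. edge w e * edge w e \<partial>iid M J) = \<kappa>" using edge_L2(2)[OF J e] by (simp add: power2_eq_square)
    finally show "(\<Sum>e'\<in>pairs J. \<integral>w. edge w e * edge w e' \<partial>iid M J) = 2 * \<kappa>" by simp
  qed
  finally show ?thesis by simp
qed

end

section \<open>Fourth moments of degenerate U-statistics\<close>

context degenerate_kernel
begin

lemma edge_cong:
  assumes "w \<in> space (iid M J)" "e \<in> pairs J" "e' \<in> pairs J" "{fst e, snd e} = {fst e', snd e'}"
  shows "edge w e = edge w e'"
proof -
  have sp: "w r \<in> space M" if "r \<in> J" for r using assms(1) that by (auto simp: space_PiM)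
  show ?thesis using assms(2-4) f_sym[OF sp sp] by (auto simp: doubleton_eq_iff mem_pairs)
qed

lemma abs_integral_edge_prod_le:
  assumes J: "finite J" and e: "\<And>i. i \<in> A \<Longrightarrow> e i \<in> pairs J"
    and G: "integrable (iid M J) G"
    and le: "\<And>w. w \<in> space (iid M J) \<Longrightarrow> (\<Prod>i\<in>A. \<bar>edge w (e i)\<bar>) \<le> G w"
  shows "\<bar>\<integral>w. (\<Prod>i\<in>A. edge w (e i)) \<partial>iid M J\<bar> \<le> (\<integral>w. G w \<partial>iid M J)"
proof -
  have "\<bar>\<integral>w. (\<Prod>i\<in>A. edge w (e i)) \<partial>iid M J\<bar> \<le> (\<integral>w. \<bar>\<Prod>i\<in>A. edge w (e i)\<bar> \<partial>iid M J)"
    by (rule integral_abs_bound)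
  also have "\<dots> \<le> (\<integral>w. G w \<partial>iid M J)"
  proof (rule integral_mono[OF _ G])
    show "integrable (iid M J) (\<lambda>w. \<bar>\<Prod>i\<in>A. edge w (e i)\<bar>)"
      by (intro integrable_abs edge_prod_int J e)
  qed (simp add: abs_prod le)
  finally show ?thesis .
qed

text \<open>Independence of disjoint edges, read off from \<open>edges_disjoint\<close> for the
  squared kernel; boundedness makes that kernel square integrable.\<close>

lemma edge_sq_disjoint:
  assumes J: "finite J" and e: "e \<in> pairs J" "e' \<in> pairs J" "{fst e, snd e} \<inter> {fst e', snd e'} = {}"
  shows "(\<integral>w. (edge w e)\<^sup>2 * (edge w e')\<^sup>2 \<partial>iid M J) = \<kappa>\<^sup>2"
    "integrable (iid M J) (\<lambda>w. (edge w e)\<^sup>2 * (edge w e')\<^sup>2)"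
proof -
  interpret PP: pair_prob_space M M ..
  interpret sq: kernel M "\<lambda>x y. (f x y)\<^sup>2"
  proof
    show m: "(\<lambda>z. (f (fst z) (snd z))\<^sup>2) \<in> borel_measurable (M \<Otimes>\<^sub>M M)" using f_meas by measurable
    show "integrable (M \<Otimes>\<^sub>M M) (\<lambda>z. ((f (fst z) (snd z))\<^sup>2)\<^sup>2)"
    proof (rule PP.P.integrable_const_bound[where B="(L\<^sup>2)\<^sup>2"])
      show "AE z in M \<Otimes>\<^sub>M M. norm (((f (fst z) (snd z))\<^sup>2)\<^sup>2) \<le> (L\<^sup>2)\<^sup>2"
      proof (rule AE_I2)
        fix z assume "z \<in> space (M \<Otimes>\<^sub>M M)"
        then have "\<bar>f (fst z) (snd z)\<bar>\<^sup>2 \<le> L\<^sup>2" by (intro power_mono f_bdd) (auto simp: space_pair_measure)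
        then have "(\<bar>f (fst z) (snd z)\<bar>\<^sup>2)\<^sup>2 \<le> (L\<^sup>2)\<^sup>2" by (rule power_mono) (rule zero_le_power2)
        then have "((f (fst z) (snd z))\<^sup>2)\<^sup>2 \<le> (L\<^sup>2)\<^sup>2" unfolding power2_abs .
        then show "norm (((f (fst z) (snd z))\<^sup>2)\<^sup>2) \<le> (L\<^sup>2)\<^sup>2"
          by (simp only: real_norm_def abs_of_nonneg[OF zero_le_power2])
      qed
      show "(\<lambda>z. ((f (fst z) (snd z))\<^sup>2)\<^sup>2) \<in> borel_measurable (M \<Otimes>\<^sub>M M)" using m by measurable
    qed
  qed (simp add: f_sym)
  have d: "fst e \<in> J" "snd e \<in> J" "fst e' \<in> J" "snd e' \<in> J" "distinct [fst e, snd e, fst e', snd e']"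
    using e by (auto simp: mem_pairs)
  show "(\<integral>w. (edge w e)\<^sup>2 * (edge w e')\<^sup>2 \<partial>iid M J) = \<kappa>\<^sup>2"
    using sq.edges_disjoint[OF J d] by (simp add: sq.\<theta>_def \<kappa>_def)
  show "integrable (iid M J) (\<lambda>w. (edge w e)\<^sup>2 * (edge w e')\<^sup>2)"
    using sq.edge_mult_int[OF J e(1,2)] by simp
qed

text \<open>Needed for graphs on three vertices, where the vertex off the doubled edge contributes
  only the probability that it falls into the support.\<close>

lemma edge_sq_indicator:
  assumes J: "finite J" and e: "e \<in> pairs J" and c: "c \<in> J" "c \<notin> {fst e, snd e}" and B: "B \<in> sets M"
  shows "(\<integral>w. indicator B (w c) * (edge w e)\<^sup>2 \<partial>iid M J) = prob B * \<kappa>"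
    "integrable (iid M J) (\<lambda>w. indicator B (w c) * (edge w e)\<^sup>2)"
proof -
  interpret PP: pair_prob_space M M ..
  interpret Q: pair_prob_space M "M \<Otimes>\<^sub>M M" ..
  have abc: "c \<in> J" "fst e \<in> J" "snd e \<in> J" "distinct [c, fst e, snd e]"
    using e c by (auto simp: mem_pairs)
  note d = distr_PiM_3[OF J abc]
  note [measurable] = B
  have mc: "(\<lambda>w. w c) \<in> measurable (iid M J) M" by (rule measurable_component_singleton[OF c(1)])
  have m2: "(\<lambda>w. edge w e) \<in> borel_measurable (iid M J)" by (rule edge_L2(4)[OF J e])
  show int0: "integrable (iid M J) (\<lambda>w. indicator B (w c) * (edge w e)\<^sup>2)"
  proof (rule Bochner_Integration.integrable_bound[OF edge_L2(1)[OF J e]])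
    show "(\<lambda>w. indicator B (w c) * (edge w e)\<^sup>2) \<in> borel_measurable (iid M J)" using mc m2 by measurable
  qed (auto simp: indicator_def)
  have t: "(\<lambda>w. (w c, w (fst e), w (snd e))) \<in> measurable (iid M J) (M \<Otimes>\<^sub>M (M \<Otimes>\<^sub>M M))"
    using abc by (intro measurable_Pair measurable_component_singleton)
  have m: "(\<lambda>z. indicator B (fst z) * (f (fst (snd z)) (snd (snd z)))\<^sup>2) \<in> borel_measurable (M \<Otimes>\<^sub>M (M \<Otimes>\<^sub>M M))"
    by measurable
  have int: "integrable (M \<Otimes>\<^sub>M (M \<Otimes>\<^sub>M M)) (\<lambda>z. indicator B (fst z) * (f (fst (snd z)) (snd (snd z)))\<^sup>2)"
    using int0 m t by (subst d[symmetric]) (simp add: integrable_distr_eq)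
  have "(\<integral>w. indicator B (w c) * (edge w e)\<^sup>2 \<partial>iid M J)
     = (\<integral>z. indicator B (fst z) * (f (fst (snd z)) (snd (snd z)))\<^sup>2 \<partial>(M \<Otimes>\<^sub>M (M \<Otimes>\<^sub>M M)))"
    using m t by (subst d[symmetric]) (simp add: integral_distr)
  also have "\<dots> = (\<integral>x. \<integral>z. indicator B x * (f (fst z) (snd z))\<^sup>2 \<partial>(M \<Otimes>\<^sub>M M) \<partial>M)"
    by (subst Q.integral_fst'[symmetric, OF int]) simp
  also have "\<dots> = (\<integral>x. indicator B x * \<kappa> \<partial>M)" by (simp add: \<kappa>_def)
  also have "\<dots> = prob B * \<kappa>" by simp
  finally show "(\<integral>w. indicator B (w c) * (edge w e)\<^sup>2 \<partial>iid M J) = prob B * \<kappa>" .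
qed

context
  fixes J :: "'i set" and e :: "nat \<Rightarrow> 'i \<times> 'i" and V :: "'i set"
  assumes J: "finite J" and e: "\<And>i. i < 4 \<Longrightarrow> e i \<in> pairs J"
    and V: "V = (\<Union>i<4. {fst (e i), snd (e i)})"
begin

lemma abs_edge_prod:
  assumes "i < 4" "j < 4" "k < 4" "l < 4" "distinct [i, j, k, l]"
  shows "(\<Prod>i<4. \<bar>edge w (e i)\<bar>) = \<bar>edge w (e i)\<bar> * \<bar>edge w (e j)\<bar> * (\<bar>edge w (e k)\<bar> * \<bar>edge w (e l)\<bar>)"
proof -
  have "{i, j, k, l} \<subseteq> {..<4}" "card {i, j, k, l} = 4" using assms by auto
  then have s: "{..<4} = {i, j, k, l}" by (metis card_lessThan card_subset_eq finite_lessThan)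
  have "(\<Prod>i\<in>{i, j, k, l}. \<bar>edge w (e i)\<bar>) = \<bar>edge w (e i)\<bar> * (\<bar>edge w (e j)\<bar> * (\<bar>edge w (e k)\<bar> * \<bar>edge w (e l)\<bar>))"
    using assms(5) by simp
  then show ?thesis unfolding s by simp
qed

text \<open>Graphs with a vertex on one edge only vanish. With two vertices all edges coincide: two
  factors give \<kappa> and the other two are bounded by \<open>L\<close>. With three, the doubled
  edge gives \<kappa>, and the edge reaching the remaining vertex is at most \<open>L\<close> times
  the indicator of \<open>B\<close> there. With four, 2xy <= x^2 + y^2 applied to two pairs of
  disjoint edges reduces to products of independent squares.\<close>

lemma four_edges_integral_le:
  assumes B: "B \<in> sets M" "\<And>x y. x \<in> space M \<Longrightarrow> y \<in> space M \<Longrightarrow> f x y \<noteq> 0 \<Longrightarrow> x \<in> B \<and> y \<in> B"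
  shows "\<bar>\<integral>w. (\<Prod>i<4. edge w (e i)) \<partial>iid M J\<bar>
    \<le> (if card V = 2 then L\<^sup>2 * \<kappa> else if card V = 3 then L\<^sup>2 * prob B * \<kappa> else if card V = 4 then \<kappa>\<^sup>2 else 0)"
    (is "_ \<le> ?b")
proof (cases "\<exists>k<4. \<exists>s\<in>{fst (e k), snd (e k)}. \<forall>i<4. i \<noteq> k \<longrightarrow> s \<notin> {fst (e i), snd (e i)}")
  case True
  then obtain k s where ks: "k < 4" "s \<in> {fst (e k), snd (e k)}"
    and o: "\<And>i. i < 4 \<Longrightarrow> i \<noteq> k \<Longrightarrow> s \<notin> {fst (e i), snd (e i)}" by blast
  have "(\<integral>w. (\<Prod>i<4. edge w (e i)) \<partial>iid M J) = 0"
    by (rule edge_prod_0[OF J, where k=k and s=s]) (use e ks o in auto)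
  moreover have "0 \<le> ?b" using \<kappa>_nonneg by simp
  ultimately show ?thesis by simp
next
  case False
  define E where "E i = {fst (e i), snd (e i)}" for i
  have two: "card (E i) = 2" if "i < 4" for i using e[OF that] by (auto simp: E_def mem_pairs)
  have VE: "V = (\<Union>i<4. E i)" by (simp add: V E_def)
  have deg: "\<exists>j<4. j \<noteq> i \<and> v \<in> E j" if "i < 4" "v \<in> E i" for i v
    using False that unfolding E_def by blast
  note four = two VE deg
  have le4: "card V \<le> 4" by (rule four_edges_card_le[OF four])
  moreover have "2 \<le> card V" by (rule four_edges_card_ge[OF four])
  ultimately consider "card V = 2" | "card V = 3" | "card V = 4" by linarith
  then show ?thesis
  proof cases
    case 1
    have "E 1 = V" "E 0 = V" by (rule four_edges_card2[OF four 1]; simp)+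
    then have E10: "{fst (e 1), snd (e 1)} = {fst (e 0), snd (e 0)}" unfolding E_def by metis
    have same: "edge w (e 1) = edge w (e 0)" if "w \<in> space (iid M J)" for w
      by (rule edge_cong[OF that e e E10]) auto
    have "\<bar>\<integral>w. (\<Prod>i<4. edge w (e i)) \<partial>iid M J\<bar> \<le> (\<integral>w. L\<^sup>2 * (edge w (e 0))\<^sup>2 \<partial>iid M J)"
    proof (rule abs_integral_edge_prod_le[OF J])
      fix w assume w: "w \<in> space (iid M J)"
      have "(\<Prod>i<4. \<bar>edge w (e i)\<bar>) = \<bar>edge w (e 0)\<bar> * \<bar>edge w (e 1)\<bar> * (\<bar>edge w (e 2)\<bar> * \<bar>edge w (e 3)\<bar>)"
        by (rule abs_edge_prod) auto
      also have "\<dots> \<le> \<bar>edge w (e 0)\<bar> * \<bar>edge w (e 1)\<bar> * (L * L)"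
        using edge_bdd[OF w e] L_nonneg by (intro mult_left_mono mult_mono) auto
      finally show "(\<Prod>i<4. \<bar>edge w (e i)\<bar>) \<le> L\<^sup>2 * (edge w (e 0))\<^sup>2"
        unfolding same[OF w] by (simp add: power2_eq_square mult.commute)
    next
      show "integrable (iid M J) (\<lambda>w. L\<^sup>2 * (edge w (e 0))\<^sup>2)"
        by (intro integrable_mult_right edge_L2(1)[OF J e]) simp
    qed (simp add: e)
    also have "\<dots> = L\<^sup>2 * \<kappa>" unfolding integral_mult_right_zero by (subst edge_L2(2)[OF J e]) simp_all
    finally show ?thesis unfolding 1 by simp
  next
    case 2
    obtain i j k v
      where ijk: "i < 4" "j < 4" "k < 4" "i \<noteq> j" "k \<noteq> i" "k \<noteq> j" "E i = E j" "v \<in> E k" "v \<notin> E i"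
      by (rule four_edges_card3[OF four 2])
    have "card ({..<4} - {i, j, k}) = 1" using ijk by (subst card_Diff_subset) auto
    then obtain l where "{..<4} - {i, j, k} = {l}" by (metis card_1_singletonE)
    then have l: "l < 4" "l \<noteq> i" "l \<noteq> j" "l \<noteq> k" by auto
    have vJ: "v \<in> J" using e[OF ijk(3)] ijk(8) by (auto simp: E_def mem_pairs)
    have vi: "v \<notin> {fst (e i), snd (e i)}" using ijk by (simp add: E_def)
    have same: "edge w (e j) = edge w (e i)" if "w \<in> space (iid M J)" for w
      using ijk by (intro edge_cong[OF that] e) (auto simp: E_def)
    have "\<bar>\<integral>w. (\<Prod>i<4. edge w (e i)) \<partial>iid M J\<bar> \<le> (\<integral>w. L\<^sup>2 * (indicator B (w v) * (edge w (e i))\<^sup>2) \<partial>iid M J)"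
    proof (rule abs_integral_edge_prod_le[OF J])
      fix w assume w: "w \<in> space (iid M J)"
      \<comment> \<open>The support condition confines \<open>v\<close> to \<open>B\<close> wherever
        this edge is nonzero; that is the origin of the factor \<open>prob B\<close>.\<close>
      have k: "\<bar>edge w (e k)\<bar> \<le> L * indicator B (w v)"
      proof (cases "edge w (e k) = 0")
        case True then show ?thesis using L_nonneg by (simp add: indicator_def)
      next
        case False
        then have "w v \<in> B"
          using B(2)[of "w (fst (e k))" "w (snd (e k))"] e[OF ijk(3)] w ijk(8)
          by (auto simp: E_def mem_pairs space_PiM)
        then show ?thesis using edge_bdd[OF w e[OF ijk(3)]] by simp
      qed
      have "(\<Prod>i<4. \<bar>edge w (e i)\<bar>) = \<bar>edge w (e i)\<bar> * \<bar>edge w (e j)\<bar> * (\<bar>edge w (e k)\<bar> * \<bar>edge w (e l)\<bar>)"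
        using ijk l by (intro abs_edge_prod) auto
      also have "\<dots> \<le> \<bar>edge w (e i)\<bar> * \<bar>edge w (e j)\<bar> * ((L * indicator B (w v)) * L)"
        using k edge_bdd[OF w e[OF l(1)]] L_nonneg by (intro mult_left_mono mult_mono) auto
      finally show "(\<Prod>i<4. \<bar>edge w (e i)\<bar>) \<le> L\<^sup>2 * (indicator B (w v) * (edge w (e i))\<^sup>2)"
        unfolding same[OF w] by (simp add: power2_eq_square algebra_simps)
    next
      show "integrable (iid M J) (\<lambda>w. L\<^sup>2 * (indicator B (w v) * (edge w (e i))\<^sup>2))"
        by (intro integrable_mult_right edge_sq_indicator(2)[OF J e[OF ijk(1)] vJ vi B(1)])
    qed (simp add: e)
    also have "\<dots> = L\<^sup>2 * prob B * \<kappa>"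
      unfolding integral_mult_right_zero edge_sq_indicator(1)[OF J e[OF ijk(1)] vJ vi B(1)] by simp
    finally show ?thesis unfolding 2 by simp
  next
    case 3
    obtain j k l
      where jkl: "{0, j, k, l} = {..<4}" "distinct [0, j, k, l]" "E 0 \<inter> E j = {}" "E k \<inter> E l = {}"
      by (rule four_edges_card4[OF four 3])
    have "j \<in> {..<4}" "k \<in> {..<4}" "l \<in> {..<4}" unfolding jkl(1)[symmetric] by simp_all
    then have lt: "j < 4" "k < 4" "l < 4" by simp_all
    let ?a = "\<lambda>w. (edge w (e 0))\<^sup>2 * (edge w (e j))\<^sup>2" and ?c = "\<lambda>w. (edge w (e k))\<^sup>2 * (edge w (e l))\<^sup>2"
    have a: "(\<integral>w. ?a w \<partial>iid M J) = \<kappa>\<^sup>2" "integrable (iid M J) ?a"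
      using edge_sq_disjoint[OF J e[of 0] e[OF lt(1)]] jkl(3) by (auto simp: E_def)
    have c: "(\<integral>w. ?c w \<partial>iid M J) = \<kappa>\<^sup>2" "integrable (iid M J) ?c"
      using edge_sq_disjoint[OF J e[OF lt(2)] e[OF lt(3)]] jkl(4) by (auto simp: E_def)
    have "\<bar>\<integral>w. (\<Prod>i<4. edge w (e i)) \<partial>iid M J\<bar> \<le> (\<integral>w. (?a w + ?c w) / 2 \<partial>iid M J)"
    proof (rule abs_integral_edge_prod_le[OF J])
      fix w
      have "(\<Prod>i<4. \<bar>edge w (e i)\<bar>) = \<bar>edge w (e 0)\<bar> * \<bar>edge w (e j)\<bar> * (\<bar>edge w (e k)\<bar> * \<bar>edge w (e l)\<bar>)"
        using lt jkl(2) by (intro abs_edge_prod) auto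
      also have "\<dots> \<le> (?a w + ?c w) / 2"
        using zero_le_power2[of "\<bar>edge w (e 0)\<bar> * \<bar>edge w (e j)\<bar> - \<bar>edge w (e k)\<bar> * \<bar>edge w (e l)\<bar>"]
        by (simp add: power2_diff power_mult_distrib)
      finally show "(\<Prod>i<4. \<bar>edge w (e i)\<bar>) \<le> (?a w + ?c w) / 2" .
    next
      show "integrable (iid M J) (\<lambda>w. (?a w + ?c w) / 2)"
        by (intro integrable_divide Bochner_Integration.integrable_add a(2) c(2))
    qed (simp add: e)
    also have "\<dots> = \<kappa>\<^sup>2" using a c by simp
    finally show ?thesis unfolding 3 by simp
  qed
qed

end

text \<open>The fourth power is expanded over 4-tuples of pairs, sorted by the number of vertices.
  The constants are \<open>(j * j) ^ 4\<close> from \<open>card_pair_tuples_le\<close> for j = 2, 3,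
  4.\<close>

theorem fourth_moment_le:
  fixes J :: "'i set"
  assumes J: "finite J"
    and B: "B \<in> sets M" "\<And>x y. x \<in> space M \<Longrightarrow> y \<in> space M \<Longrightarrow> f x y \<noteq> 0 \<Longrightarrow> x \<in> B \<and> y \<in> B"
  shows "integrable (iid M J) (\<lambda>w. (\<Sum>e\<in>pairs J. edge w e) ^ 4)"
    "(\<integral>w. (\<Sum>e\<in>pairs J. edge w e) ^ 4 \<partial>iid M J)
      \<le> 4 ^ 4 * real (card J) ^ 2 * (L\<^sup>2 * \<kappa>) + 9 ^ 4 * real (card J) ^ 3 * (L\<^sup>2 * prob B * \<kappa>)
        + 16 ^ 4 * real (card J) ^ 4 * \<kappa>\<^sup>2"
proof -
  let ?S = "PiE {..<4::nat} (\<lambda>_. pairs J)" and ?V = "\<lambda>e::nat \<Rightarrow> 'i \<times> 'i. card (\<Union>i<4. {fst (e i), snd (e i)})"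
  have fin: "finite ?S" using J by (intro finite_PiE) auto
  have p4: "(\<Sum>e\<in>pairs J. edge w e) ^ 4 = (\<Sum>e\<in>?S. \<Prod>i<4. edge w (e i))" for w
    using prod_sum_PiE[of "{..<4::nat}" "\<lambda>_. pairs J" "\<lambda>_. edge w"] J by simp
  have int: "integrable (iid M J) (\<lambda>w. \<Prod>i<4. edge w (e i))" if "e \<in> ?S" for e
    using that by (intro edge_prod_int[OF J]) auto
  show "integrable (iid M J) (\<lambda>w. (\<Sum>e\<in>pairs J. edge w e) ^ 4)" unfolding p4 by (intro Bochner_Integration.integrable_sum int)
  let ?b = "\<lambda>c::nat. if c = 2 then L\<^sup>2 * \<kappa> else if c = 3 then L\<^sup>2 * prob B * \<kappa> else if c = 4 then \<kappa>\<^sup>2 else 0"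
  have count: "real (card {e \<in> ?S. ?V e = c}) * x \<le> real ((c * c) ^ 4 * card J ^ c) * x" if "0 \<le> x" for c x
    using card_pair_tuples_le[OF J, of c] that by (intro mult_right_mono) (auto simp del: of_nat_mult of_nat_power)
  have "(\<integral>w. (\<Sum>e\<in>pairs J. edge w e) ^ 4 \<partial>iid M J) = (\<Sum>e\<in>?S. \<integral>w. (\<Prod>i<4. edge w (e i)) \<partial>iid M J)"
    unfolding p4 by (simp add: int)
  also have "\<dots> \<le> (\<Sum>e\<in>?S. ?b (?V e))"
  proof (rule sum_mono)
    fix e assume "e \<in> ?S"
    then have "\<bar>\<integral>w. (\<Prod>i<4. edge w (e i)) \<partial>iid M J\<bar> \<le> ?b (?V e)"
      by (intro four_edges_integral_le[OF J _ refl B]) auto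
    then show "(\<integral>w. (\<Prod>i<4. edge w (e i)) \<partial>iid M J) \<le> ?b (?V e)" by linarith
  qed
  also have "\<dots> = (\<Sum>e\<in>?S. (if ?V e = 2 then L\<^sup>2 * \<kappa> else 0) + (if ?V e = 3 then L\<^sup>2 * prob B * \<kappa> else 0) + (if ?V e = 4 then \<kappa>\<^sup>2 else 0))"
    by (intro sum.cong refl) simp
  also have "\<dots> = real (card {e \<in> ?S. ?V e = 2}) * (L\<^sup>2 * \<kappa>) + real (card {e \<in> ?S. ?V e = 3}) * (L\<^sup>2 * prob B * \<kappa>)
      + real (card {e \<in> ?S. ?V e = 4}) * \<kappa>\<^sup>2"
    using fin by (simp add: sum.distrib sum.inter_filter[symmetric])
  also have "\<dots> \<le> real ((2 * 2) ^ 4 * card J ^ 2) * (L\<^sup>2 * \<kappa>) + real ((3 * 3) ^ 4 * card J ^ 3) * (L\<^sup>2 * prob B * \<kappa>)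
      + real ((4 * 4) ^ 4 * card J ^ 4) * \<kappa>\<^sup>2"
    by (intro add_mono count mult_nonneg_nonneg \<kappa>_nonneg) auto
  finally show "(\<integral>w. (\<Sum>e\<in>pairs J. edge w e) ^ 4 \<partial>iid M J)
      \<le> 4 ^ 4 * real (card J) ^ 2 * (L\<^sup>2 * \<kappa>) + 9 ^ 4 * real (card J) ^ 3 * (L\<^sup>2 * prob B * \<kappa>)
        + 16 ^ 4 * real (card J) ^ 4 * \<kappa>\<^sup>2" by simp
qed

end

section \<open>Conditioning on a finite partition\<close>

context prob_space
begin

lemma uniform_measure_eq_density:
  assumes A: "A \<in> events" "prob A \<noteq> 0"
  shows "uniform_measure M A = density M (\<lambda>x. ennreal (indicator A x / prob A))"
proof -
  have "indicator A x / emeasure M A = ennreal (indicator A x / prob A)" for x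
    using A by (simp add: emeasure_eq_measure divide_ennreal zero_less_measure_iff flip: ennreal_indicator)
  then show ?thesis by (simp add: uniform_measure_def)
qed

lemma
  fixes F :: "'a \<Rightarrow> real"
  assumes A: "A \<in> events" "prob A \<noteq> 0" and F[measurable]: "F \<in> borel_measurable M"
  shows integral_uniform_measure: "(\<integral>x. F x \<partial>uniform_measure M A) = (\<integral>x. indicator A x * F x \<partial>M) / prob A"
    and integrable_uniform_measure: "integrable M F \<Longrightarrow> integrable (uniform_measure M A) F"
proof -
  have m: "(\<lambda>x. indicator A x / prob A) \<in> borel_measurable M" using A by measurable
  show "(\<integral>x. F x \<partial>uniform_measure M A) = (\<integral>x. indicator A x * F x \<partial>M) / prob A"
    unfolding uniform_measure_eq_density[OF A]
    by (subst integral_density) (use m in auto)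
  assume "integrable M F"
  then have "integrable M (\<lambda>x. indicator A x * F x / prob A)"
    using integrable_mult_indicator[OF A(1), of F] by simp
  then show "integrable (uniform_measure M A) F"
    unfolding uniform_measure_eq_density[OF A]
    by (subst integrable_density) (use m in auto)
qed

text \<open>Markov's inequality for the conditional expectation given a variable with finitely many
  values: apply it on each bad atom and add over the disjoint atoms.\<close>

lemma prob_conditional_expectation_gt_le:
  fixes I :: "'a \<Rightarrow> 'b" and F :: "'a \<Rightarrow> real"
  assumes fin: "finite (I ` space M)" and meas: "\<And>i. {\<omega> \<in> space M. I \<omega> = i} \<in> events"
    and F: "integrable M F" "\<And>x. 0 \<le> F x" and \<delta>: "0 < \<delta>"
  shows "prob {\<omega> \<in> space M. (\<integral>x. F x \<partial>uniform_measure M {x \<in> space M. I x = I \<omega>}) > \<delta>} \<le> expectation F / \<delta>"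
proof -
  let ?A = "\<lambda>i. {\<omega> \<in> space M. I \<omega> = i}"
  define Bad where "Bad = {i \<in> I ` space M. (\<integral>x. F x \<partial>uniform_measure M (?A i)) > \<delta>}"
  have finB: "finite Bad" using fin by (simp add: Bad_def)
  have eq: "{\<omega> \<in> space M. (\<integral>x. F x \<partial>uniform_measure M (?A (I \<omega>))) > \<delta>} = (\<Union>i\<in>Bad. ?A i)"
    by (auto simp: Bad_def)
  have "prob (\<Union>i\<in>Bad. ?A i) = (\<Sum>i\<in>Bad. prob (?A i))"
    using finB meas by (intro finite_measure_finite_Union) (auto simp: disjoint_family_on_def)
  also have "\<delta> * \<dots> \<le> (\<Sum>i\<in>Bad. \<integral>x. indicator (?A i) x * F x \<partial>M)"
    unfolding sum_distrib_left
  proof (rule sum_mono)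
    fix i assume i: "i \<in> Bad"
    show "\<delta> * prob (?A i) \<le> (\<integral>x. indicator (?A i) x * F x \<partial>M)"
    \<comment> \<open>On a null atom the left side is 0 whatever \<open>uniform_measure\<close>
      yields there.\<close>
    proof (cases "prob (?A i) = 0")
      case True
      then show ?thesis using F by (simp add: Bochner_Integration.integral_nonneg)
    next
      case False
      then have pos: "0 < prob (?A i)" by (simp add: less_le)
      have "\<delta> < (\<integral>x. indicator (?A i) x * F x \<partial>M) / prob (?A i)"
        using i False meas F(1) by (simp add: Bad_def integral_uniform_measure borel_measurable_integrable)
      then show ?thesis using pos by (simp add: pos_less_divide_eq)
    qed
  qed
  also have "\<dots> = (\<integral>x. (\<Sum>i\<in>Bad. indicator (?A i) x) * F x \<partial>M)"
    unfolding sum_distrib_right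
    using F(1) meas by (subst Bochner_Integration.integral_sum) (auto intro: integrable_real_mult_indicator integrable_mult_indicator[of _ _ F, simplified])
  also have "\<dots> \<le> expectation F"
  proof (rule integral_mono_AE'[OF F(1)])
    show "AE x in M. (\<Sum>i\<in>Bad. indicator (?A i) x) * F x \<le> F x"
    proof (rule AE_I2)
      fix x assume "x \<in> space M"
      have "(\<Sum>i\<in>Bad. indicator (?A i) x) = (\<Sum>i\<in>Bad. if i = I x then 1 else (0::real))"
        using \<open>x \<in> space M\<close> by (intro sum.cong) (auto simp: indicator_def)
      also have "\<dots> \<le> 1" using finB by simp
      finally have "(\<Sum>i\<in>Bad. indicator (?A i) x) * F x \<le> 1 * F x" using F(2) by (rule mult_right_mono)
      then show "(\<Sum>i\<in>Bad. indicator (?A i) x) * F x \<le> F x" by simp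
    qed
    show "AE x in M. 0 \<le> F x" using F(2) by simp
  qed
  finally show ?thesis unfolding eq using \<delta> by (simp add: pos_le_divide_eq mult.commute)
qed

text \<open>Conditioning on a rectangle multiplies the product law by a product of indicators, so
  the normalisation factors too. Independence survives, and each coordinate is conditioned on its
  own side only.\<close>

lemma indep_vars_uniform_measure:
  fixes Z :: "'i \<Rightarrow> 'a \<Rightarrow> 's"
  assumes ind: "indep_vars (\<lambda>_. S) Z I" and I: "finite I" "I \<noteq> {}"
    and B: "\<And>i. i \<in> I \<Longrightarrow> B i \<in> sets S"
    and E: "E = {\<omega> \<in> space M. \<forall>i\<in>I. Z i \<omega> \<in> B i}" "prob E \<noteq> 0"
  shows "prob_space (uniform_measure M E)"
    and "prob_space.indep_vars (uniform_measure M E) (\<lambda>_. S) Z I"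
    and "\<And>i. i \<in> I \<Longrightarrow> distr (uniform_measure M E) S (Z i) = uniform_measure (distr M S (Z i)) (B i)"
    and "E \<in> events"
proof -
  have rv[measurable]: "Z i \<in> measurable M S" if "i \<in> I" for i
    using ind that by (auto simp: indep_vars_def)
  have EI: "E = (\<Inter>i\<in>I. Z i -` B i \<inter> space M)" using I by (auto simp: E)
  show Ee: "E \<in> events" unfolding EI using I B rv by (intro sets.finite_INT) auto
  let ?Q = "uniform_measure M E"
  have e0: "emeasure M E \<noteq> 0" using E(2) by (simp add: emeasure_eq_measure measure_le_0_iff)
  show Q: "prob_space ?Q" by (rule prob_space_uniform_measure) (use e0 in auto)
  interpret Q: prob_space ?Q by (rule Q)
  let ?b = "\<lambda>i. prob (Z i -` B i \<inter> space M)"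
  have pE: "prob E = (\<Prod>i\<in>I. ?b i)" unfolding EI by (rule indep_varsD_finite[OF ind I(2,1) B])
  have b0: "?b i \<noteq> 0" if "i \<in> I" for i using E(2) pE I that by auto
  have meas: "measure ?Q (\<Inter>i\<in>I. Z i -` A i \<inter> space M) = (\<Prod>i\<in>I. prob (Z i -` (A i \<inter> B i) \<inter> space M) / ?b i)"
    if A: "\<And>i. i \<in> I \<Longrightarrow> A i \<in> sets S" for A
  proof -
    have "(\<Inter>i\<in>I. Z i -` A i \<inter> space M) \<in> events" using I A rv by (intro sets.finite_INT) auto
    then have "measure ?Q (\<Inter>i\<in>I. Z i -` A i \<inter> space M) = prob (E \<inter> (\<Inter>i\<in>I. Z i -` A i \<inter> space M)) / prob E"
      using e0 by simp
    also have "E \<inter> (\<Inter>i\<in>I. Z i -` A i \<inter> space M) = (\<Inter>i\<in>I. Z i -` (A i \<inter> B i) \<inter> space M)"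
      unfolding EI using I by auto
    also have "prob \<dots> = (\<Prod>i\<in>I. prob (Z i -` (A i \<inter> B i) \<inter> space M))"
      by (rule indep_varsD_finite[OF ind I(2,1)]) (use A B in auto)
    finally show ?thesis by (simp add: pE prod_dividef)
  qed
  have marg: "measure ?Q (Z j -` A \<inter> space M) = prob (Z j -` (A \<inter> B j) \<inter> space M) / ?b j"
    if j: "j \<in> I" and A: "A \<in> sets S" for j A
  proof -
    let ?A = "\<lambda>i. if i = j then A else space S"
    have sp: "Z i \<omega> \<in> space S" if "i \<in> I" "\<omega> \<in> space M" for i \<omega> using measurable_space[OF rv] that by auto
    have "(\<Inter>i\<in>I. Z i -` ?A i \<inter> space M) = Z j -` A \<inter> space M" using j sp by (auto split: if_splits)
    then have "measure ?Q (Z j -` A \<inter> space M) = (\<Prod>i\<in>I. prob (Z i -` (?A i \<inter> B i) \<inter> space M) / ?b i)"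
      using meas[of ?A] A by simp
    also have "\<dots> = (prob (Z j -` (A \<inter> B j) \<inter> space M) / ?b j) * (\<Prod>i\<in>I - {j}. prob (Z i -` (?A i \<inter> B i) \<inter> space M) / ?b i)"
      using prod.remove[OF I(1) j, of "\<lambda>i. prob (Z i -` (?A i \<inter> B i) \<inter> space M) / ?b i"] by simp
    also have "(\<Prod>i\<in>I - {j}. prob (Z i -` (?A i \<inter> B i) \<inter> space M) / ?b i) = 1"
    proof (rule prod.neutral, rule)
      fix i assume i: "i \<in> I - {j}"
      then have "space S \<inter> B i = B i" using sets.sets_into_space[OF B[of i]] by auto
      then show "prob (Z i -` (?A i \<inter> B i) \<inter> space M) / ?b i = 1" using i b0[of i] by simp
    qed
    finally show ?thesis by simp
  qed
  show "Q.indep_vars (\<lambda>_. S) Z I"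
  proof (subst Q.indep_vars_finite[where E="\<lambda>_. sets S"])
    show "\<forall>A\<in>I \<rightarrow> sets S. Q.prob (\<Inter>j\<in>I. Z j -` A j \<inter> space ?Q) = (\<Prod>j\<in>I. Q.prob (Z j -` A j \<inter> space ?Q))"
    proof
      fix A assume A: "A \<in> I \<rightarrow> sets S"
      then have A': "A i \<in> sets S" if "i \<in> I" for i using that by auto
      have "Q.prob (\<Inter>j\<in>I. Z j -` A j \<inter> space M) = (\<Prod>i\<in>I. prob (Z i -` (A i \<inter> B i) \<inter> space M) / ?b i)"
        by (rule meas) (rule A')
      also have "\<dots> = (\<Prod>j\<in>I. Q.prob (Z j -` A j \<inter> space M))"
        by (intro prod.cong refl marg[symmetric] A')
      finally show "Q.prob (\<Inter>j\<in>I. Z j -` A j \<inter> space ?Q) = (\<Prod>j\<in>I. Q.prob (Z j -` A j \<inter> space ?Q))" by simp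
    qed
  qed (use I rv in \<open>auto simp: sets.sigma_sets_eq sets.Int_stable sets.space_closed\<close>)
  fix i assume i: "i \<in> I"
  show "distr ?Q S (Z i) = uniform_measure (distr M S (Z i)) (B i)"
  proof (rule measure_eqI)
    fix A assume "A \<in> sets (distr ?Q S (Z i))"
    then have A: "A \<in> sets S" by simp
    interpret D: prob_space "distr M S (Z i)" using i by (intro prob_space_distr rv)
    have d0: "emeasure (distr M S (Z i)) (B i) \<noteq> 0"
      using b0[OF i] i B by (simp add: emeasure_distr emeasure_eq_measure measure_le_0_iff)
    interpret U: prob_space "uniform_measure (distr M S (Z i)) (B i)"
      using d0 by (intro prob_space_uniform_measure) auto
    have "measure (uniform_measure (distr M S (Z i)) (B i)) A
        = measure (distr M S (Z i)) (B i \<inter> A) / measure (distr M S (Z i)) (B i)"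
      using d0 A by (subst measure_uniform_measure) auto
    also have "\<dots> = prob (Z i -` (A \<inter> B i) \<inter> space M) / ?b i"
      using i A B by (simp add: measure_distr Int_commute)
    also have "\<dots> = measure ?Q (Z i -` A \<inter> space M)" by (rule marg[OF i A, symmetric])
    finally have "measure ?Q (Z i -` A \<inter> space M) = measure (uniform_measure (distr M S (Z i)) (B i)) A" ..
    moreover have "Z i \<in> measurable ?Q S" using rv[OF i] by simp
    ultimately show "emeasure (distr ?Q S (Z i)) A = emeasure (uniform_measure (distr M S (Z i)) (B i)) A"
      using A by (simp add: emeasure_distr Q.emeasure_eq_measure U.emeasure_eq_measure del: measure_uniform_measure emeasure_uniform_measure)
  qed simp
qed

lemma distr_restrict_iid:
  fixes Z :: "'i \<Rightarrow> 'a \<Rightarrow> 's"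
  assumes ind: "indep_vars (\<lambda>_. S) Z J" and J: "J \<noteq> {}"
    and D: "\<And>r. r \<in> J \<Longrightarrow> distr M S (Z r) = D"
  shows "distr M (PiM J (\<lambda>_. S)) (\<lambda>\<omega>. \<lambda>r\<in>J. Z r \<omega>) = iid D J"
proof -
  have rv: "Z i \<in> measurable M S" if "i \<in> J" for i using ind that by (auto simp: indep_vars_def)
  have "distr M (PiM J (\<lambda>_. S)) (\<lambda>\<omega>. \<lambda>r\<in>J. Z r \<omega>) = PiM J (\<lambda>i. distr M S (Z i))"
    using ind indep_vars_iff_distr_eq_PiM'[OF J rv] by simp
  also have "\<dots> = iid D J" using D by (intro PiM_cong) auto
  finally show ?thesis .
qed

lemma
  fixes Z :: "'i \<Rightarrow> 'a \<Rightarrow> 's" and F :: "('i \<Rightarrow> 's) \<Rightarrow> real"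
  assumes ind: "indep_vars (\<lambda>_. S) Z J" and J: "J \<noteq> {}"
    and D: "\<And>r. r \<in> J \<Longrightarrow> distr M S (Z r) = D"
    and F: "F \<in> borel_measurable (PiM J (\<lambda>_. S))"
  shows integral_iid: "(\<integral>\<omega>. F (\<lambda>r\<in>J. Z r \<omega>) \<partial>M) = (\<integral>w. F w \<partial>iid D J)"
    and integrable_iid: "integrable (iid D J) F \<Longrightarrow> integrable M (\<lambda>\<omega>. F (\<lambda>r\<in>J. Z r \<omega>))"
proof -
  have rv: "Z i \<in> measurable M S" if "i \<in> J" for i using ind that by (auto simp: indep_vars_def)
  then have m: "(\<lambda>\<omega>. \<lambda>r\<in>J. Z r \<omega>) \<in> measurable M (PiM J (\<lambda>_. S))" by (intro measurable_restrict)
  note d = distr_restrict_iid[OF ind J D, symmetric]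
  show "(\<integral>\<omega>. F (\<lambda>r\<in>J. Z r \<omega>) \<partial>M) = (\<integral>w. F w \<partial>iid D J)"
    by (subst d) (simp_all add: integral_distr[OF m F])
  show "integrable M (\<lambda>\<omega>. F (\<lambda>r\<in>J. Z r \<omega>))" if "integrable (iid D J) F"
    using that by (subst (asm) d) (simp_all add: integrable_distr_eq[OF m F])
qed

end

section \<open>Blockwise projection of a kernel\<close>

locale block_kernel = kernel M f for M :: "'a measure" and f +
  fixes c :: "'a \<Rightarrow> nat" and N :: nat and L :: real
  assumes c_meas[measurable]: "c \<in> measurable M (count_space UNIV)"
    and c_in: "\<And>x. x \<in> space M \<Longrightarrow> c x \<in> {1..N}"
    and p_pos: "\<And>m. m \<in> {1..N} \<Longrightarrow> 0 < prob {x \<in> space M. c x = m}"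
    and L_pos: "0 \<le> L"
begin

sublocale PP: pair_prob_space M M ..

definition "B m = {x \<in> space M. c x = m}"
definition "p m = prob (B m)"
definition "low x y = (if c x = c y \<and> \<bar>f x y\<bar> \<le> L then f x y else 0)"
definition "high x y = (if c x = c y \<and> \<not> \<bar>f x y\<bar> \<le> L then f x y else 0)"
definition "diag x y = (if c x = c y then f x y else 0)"
text \<open>For a kernel that vanishes across cells, such as \<open>low\<close>, \<open>high\<close>
  and \<open>diag\<close>, this is the conditional mean of \<open>u x\<close> over the cell of
  \<open>x\<close>, since dividing by \<open>p (c x)\<close> normalises the integral over the whole
  space. \<open>mean\<close> averages it once more over a cell, and \<open>g\<close> is the double
  centring of \<open>low\<close> within cells.\<close>

definition "proj u x = (\<integral>y. u x y \<partial>M) / p (c x)" for u :: "'a \<Rightarrow> 'a \<Rightarrow> real"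
definition "mean u m = (\<integral>x. indicator (B m) x * proj u x \<partial>M) / p m" for u
definition "g x y = (if c x = c y then low x y - proj low x - proj low y + mean low (c x) else 0)"
definition "gm m x y = (if c x = m then g x y else 0)"

lemma B_meas[measurable]: "B m \<in> events" unfolding B_def by measurable

lemma p_pos_m: "m \<in> {1..N} \<Longrightarrow> 0 < p m" using p_pos by (simp add: p_def B_def)

lemma p_pos': "x \<in> space M \<Longrightarrow> 0 < p (c x)" using p_pos c_in by (auto simp: p_def B_def)

lemma c_comp[measurable (raw)]: "u \<in> measurable K M \<Longrightarrow> (\<lambda>x. c (u x)) \<in> measurable K (count_space UNIV)"
  by (rule measurable_compose[OF _ c_meas])

lemma c_eq_comp[measurable (raw)]:
  assumes [measurable]: "u \<in> measurable K M" "v \<in> measurable K M"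
  shows "Measurable.pred K (\<lambda>x. c (u x) = c (v x))"
proof -
  have "(\<lambda>x. c (u x) = c (v x)) = (\<lambda>x. \<exists>m. c (u x) = m \<and> c (v x) = m)" by auto
  also have "Measurable.pred K \<dots>" by measurable
  finally show ?thesis .
qed

lemma integrable_B[simp]: "integrable M (indicator (B m) :: 'a \<Rightarrow> real)"
  by (rule integrable_real_indicator) (auto simp: emeasure_eq_measure)

lemma p_comp[measurable (raw)]: "u \<in> measurable K M \<Longrightarrow> (\<lambda>x. p (c (u x))) \<in> borel_measurable K"
  by (rule measurable_compose[OF c_comp]) auto

definition "meas2 u \<longleftrightarrow> (\<lambda>z. u (fst z) (snd z)) \<in> borel_measurable (M \<Otimes>\<^sub>M M)" for u :: "'a \<Rightarrow> 'a \<Rightarrow> real"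

lemma meas2D:
  assumes "meas2 u" "v \<in> measurable K M" "w \<in> measurable K M"
  shows "(\<lambda>x. u (v x) (w x)) \<in> borel_measurable K"
  using measurable_compose[OF measurable_Pair[OF assms(2,3)] assms(1)[unfolded meas2_def]] by simp

lemma meas2_kernels: "meas2 f" "meas2 low" "meas2 high" "meas2 diag"
  unfolding meas2_def low_def high_def diag_def by measurable

lemma low_comp[measurable (raw)]: "v \<in> measurable K M \<Longrightarrow> w \<in> measurable K M \<Longrightarrow> (\<lambda>x. low (v x) (w x)) \<in> borel_measurable K"
  by (rule meas2D[OF meas2_kernels(2)])

lemma proj_meas: "meas2 u \<Longrightarrow> proj u \<in> borel_measurable M"
proof -
  assume u: "meas2 u"
  have "(\<lambda>x. \<integral>y. u x y \<partial>M) \<in> borel_measurable M"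
    by (rule borel_measurable_lebesgue_integral) (use u in \<open>simp add: meas2_def split_beta'\<close>)
  then show "proj u \<in> borel_measurable M" unfolding proj_def[abs_def] by measurable
qed

lemma proj_low_comp[measurable (raw)]: "v \<in> measurable K M \<Longrightarrow> (\<lambda>x. proj low (v x)) \<in> borel_measurable K"
  by (rule measurable_compose[OF _ proj_meas[OF meas2_kernels(2)]])

lemma mean_comp[measurable (raw)]: "v \<in> measurable K M \<Longrightarrow> (\<lambda>x. mean u (c (v x))) \<in> borel_measurable K"
  by (rule measurable_compose[OF c_comp]) auto

lemma g_meas2: "meas2 g" "meas2 (gm m)"
  unfolding meas2_def gm_def g_def by measurable

lemma low_bdd: "\<bar>low x y\<bar> \<le> L" using L_pos by (simp add: low_def)

lemma low_sym: "x \<in> space M \<Longrightarrow> y \<in> space M \<Longrightarrow> low x y = low y x"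
  using f_sym by (auto simp: low_def)

lemma low_int: "x \<in> space M \<Longrightarrow> integrable M (\<lambda>y. low x y)"
  using low_bdd by (intro integrable_const_bound[where B=L]) auto

lemma integral_B_const: "(\<integral>y. indicator (B m) y * (k::real) \<partial>M) = p m * k"
  by (simp add: p_def)

lemma proj_low_bdd:
  assumes x: "x \<in> space M" shows "\<bar>proj low x\<bar> \<le> L"
proof -
  have "\<bar>\<integral>y. low x y \<partial>M\<bar> \<le> (\<integral>y. \<bar>low x y\<bar> \<partial>M)" by (rule integral_abs_bound)
  also have "\<dots> \<le> (\<integral>y. indicator (B (c x)) y * L \<partial>M)"
  proof (rule integral_mono)
    show "integrable M (\<lambda>y. \<bar>low x y\<bar>)" using low_int[OF x] by simp
    fix y assume "y \<in> space M"
    then show "\<bar>low x y\<bar> \<le> indicator (B (c x)) y * L" using L_pos by (auto simp: low_def B_def indicator_def)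
  qed simp
  also have "\<dots> = p (c x) * L" by (rule integral_B_const)
  finally have "\<bar>\<integral>y. low x y \<partial>M\<bar> / p (c x) \<le> L"
    using p_pos'[OF x] by (simp add: pos_divide_le_eq mult.commute)
  then show ?thesis using p_pos'[OF x] by (simp add: proj_def)
qed

lemma proj_low_int: "integrable M (\<lambda>x. indicator (B m) x * proj low x)"
proof (rule integrable_const_bound[where B=L])
  show "AE x in M. norm (indicator (B m) x * proj low x) \<le> L"
    using proj_low_bdd L_pos by (intro AE_I2) (auto simp: indicator_def)
qed measurable

lemma mean_low_bdd:
  assumes m: "m \<in> {1..N}" shows "\<bar>mean low m\<bar> \<le> L"
proof -
  have "\<bar>\<integral>x. indicator (B m) x * proj low x \<partial>M\<bar> \<le> (\<integral>x. \<bar>indicator (B m) x * proj low x\<bar> \<partial>M)" by (rule integral_abs_bound)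
  also have "\<dots> \<le> (\<integral>x. indicator (B m) x * L \<partial>M)"
  proof (rule integral_mono)
    show "integrable M (\<lambda>x. \<bar>indicator (B m) x * proj low x\<bar>)" using proj_low_int by simp
    fix x assume "x \<in> space M"
    then show "\<bar>indicator (B m) x * proj low x\<bar> \<le> indicator (B m) x * L"
      using proj_low_bdd by (auto simp: indicator_def)
  qed simp
  also have "\<dots> = p m * L" by (rule integral_B_const)
  finally have "\<bar>\<integral>x. indicator (B m) x * proj low x \<partial>M\<bar> / p m \<le> L"
    using p_pos_m[OF m] by (simp add: pos_divide_le_eq mult.commute)
  then show ?thesis using p_pos_m[OF m] by (simp add: mean_def)
qed

text \<open>Each of the four terms of \<open>g\<close> is an average of values bounded by
  \<open>L\<close>; hence the bound \<open>4 * L\<close> in both interpretations below.\<close>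

lemma g_bdd: "x \<in> space M \<Longrightarrow> y \<in> space M \<Longrightarrow> \<bar>g x y\<bar> \<le> 4 * L"
  using low_bdd[of x y] proj_low_bdd[of x] proj_low_bdd[of y] mean_low_bdd[OF c_in[of x]] L_pos
  by (auto simp: g_def)

lemma g_sym: "x \<in> space M \<Longrightarrow> y \<in> space M \<Longrightarrow> g x y = g y x"
  using low_sym by (auto simp: g_def)

lemma integral_low: "x \<in> space M \<Longrightarrow> (\<integral>y. low x y \<partial>M) = p (c x) * proj low x"
  using p_pos' by (simp add: proj_def less_imp_neq[symmetric])

lemma integral_proj_low: "m \<in> {1..N} \<Longrightarrow> (\<integral>x. indicator (B m) x * proj low x \<partial>M) = p m * mean low m"
  using p_pos by (simp add: mean_def p_def B_def less_imp_neq[symmetric])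

text \<open>The integral is over the whole space, but \<open>g x\<close> lives on the cell of
  \<open>x\<close>; there the four terms cancel in two pairs.\<close>

lemma g_degen:
  assumes x: "x \<in> space M" shows "(\<integral>y. g x y \<partial>M) = 0"
proof -
  have "(\<integral>y. g x y \<partial>M) = (\<integral>y. low x y - indicator (B (c x)) y * proj low x
     - indicator (B (c x)) y * proj low y + indicator (B (c x)) y * mean low (c x) \<partial>M)"
    by (rule Bochner_Integration.integral_cong) (auto simp: g_def low_def B_def indicator_def)
  also have "\<dots> = p (c x) * proj low x - p (c x) * proj low x - p (c x) * mean low (c x) + p (c x) * mean low (c x)"
    using low_int[OF x] proj_low_int
    by (simp add: integral_low[OF x] integral_proj_low[OF c_in[OF x]] integral_B_const p_def[symmetric])
  finally show ?thesis by simp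
qed

lemma bounded_L2:
  assumes "meas2 u" "\<And>x y. x \<in> space M \<Longrightarrow> y \<in> space M \<Longrightarrow> \<bar>u x y\<bar> \<le> b"
  shows "integrable (M \<Otimes>\<^sub>M M) (\<lambda>z. (u (fst z) (snd z))\<^sup>2)"
proof (rule PP.P.integrable_const_bound[where B="b\<^sup>2"])
  show "AE z in M \<Otimes>\<^sub>M M. norm ((u (fst z) (snd z))\<^sup>2) \<le> b\<^sup>2"
  proof (rule AE_I2)
    fix z assume "z \<in> space (M \<Otimes>\<^sub>M M)"
    then have "\<bar>u (fst z) (snd z)\<bar>\<^sup>2 \<le> b\<^sup>2" by (intro power_mono assms) (auto simp: space_pair_measure)
    then show "norm ((u (fst z) (snd z))\<^sup>2) \<le> b\<^sup>2" by simp
  qed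
  show "(\<lambda>z. (u (fst z) (snd z))\<^sup>2) \<in> borel_measurable (M \<Otimes>\<^sub>M M)" using assms(1) by (auto simp: meas2_def)
qed

sublocale g: degenerate_kernel M g "4 * L"
proof
  show "(\<lambda>z. g (fst z) (snd z)) \<in> borel_measurable (M \<Otimes>\<^sub>M M)" using g_meas2 by (simp add: meas2_def)
  show "integrable (M \<Otimes>\<^sub>M M) (\<lambda>z. (g (fst z) (snd z))\<^sup>2)" by (rule bounded_L2[OF g_meas2(1) g_bdd])
qed (use g_sym g_bdd g_degen in auto)

lemma gm_eq: "gm m x y = (if c x = m \<and> c y = m then g x y else 0)"
  by (auto simp: gm_def g_def)

sublocale gm: degenerate_kernel M "gm m" "4 * L" for m
proof
  show "(\<lambda>z. gm m (fst z) (snd z)) \<in> borel_measurable (M \<Otimes>\<^sub>M M)" using g_meas2 by (simp add: meas2_def)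
  have b: "\<bar>gm m x y\<bar> \<le> 4 * L" if "x \<in> space M" "y \<in> space M" for x y
    using g_bdd[OF that] L_pos by (simp add: gm_def)
  show "integrable (M \<Otimes>\<^sub>M M) (\<lambda>z. (gm m (fst z) (snd z))\<^sup>2)" by (rule bounded_L2[OF g_meas2(2) b])
  show "\<bar>gm m x y\<bar> \<le> 4 * L" if "x \<in> space M" "y \<in> space M" for x y by (rule b[OF that])
  show "gm m x y = gm m y x" if "x \<in> space M" "y \<in> space M" for x y
    using g_sym[OF that] by (auto simp: gm_eq)
  show "(\<integral>y. gm m x y \<partial>M) = 0" if "x \<in> space M" for x
    using g_degen[OF that] by (cases "c x = m") (simp_all add: gm_def)
qed

lemma gm_supp: "x \<in> space M \<Longrightarrow> y \<in> space M \<Longrightarrow> gm m x y \<noteq> 0 \<Longrightarrow> x \<in> B m \<and> y \<in> B m"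
  by (auto simp: gm_eq B_def split: if_splits)

text \<open>The second moment of the block kernel under the law conditioned on cell
  \<open>m\<close>, as \<open>gm_uniform\<close> shows.\<close>

definition "\<rho> m = gm.\<kappa> m / (p m)\<^sup>2"

text \<open>The block kernel is supported in one cell, so conditioning on that cell only multiplies
  its integral in each variable by 1 / p m. Degeneracy persists, and the second moment is divided by
  the square of \<open>p m\<close>.\<close>

lemma gm_uniform:
  assumes m: "m \<in> {1..N}"
  shows "degenerate_kernel (uniform_measure M (B m)) (gm m) (4 * L)"
    and "kernel.\<kappa> (uniform_measure M (B m)) (gm m) = \<rho> m"
proof -
  have pB: "prob (B m) \<noteq> 0" using p_pos[OF m] by (simp add: B_def)
  let ?U = "uniform_measure M (B m)"
  interpret U: prob_space ?U
    using pB by (intro prob_space_uniform_measure) (auto simp: emeasure_eq_measure measure_le_0_iff)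
  interpret UU: pair_prob_space ?U ?U ..
  note [measurable_cong] = sets_uniform_measure
  have sets: "sets (?U \<Otimes>\<^sub>M ?U) = sets (M \<Otimes>\<^sub>M M)" by (intro sets_pair_measure_cong) auto
  have gmm: "(\<lambda>z. gm m (fst z) (snd z)) \<in> borel_measurable (?U \<Otimes>\<^sub>M ?U)"
    using gm.f_meas by (simp add: measurable_cong_sets[OF sets refl])
  have b: "\<bar>gm m x y\<bar> \<le> 4 * L" if "x \<in> space M" "y \<in> space M" for x y by (rule gm.f_bdd[OF that])
  have int: "integrable (?U \<Otimes>\<^sub>M ?U) (\<lambda>z. (gm m (fst z) (snd z))\<^sup>2)"
  proof (rule UU.P.integrable_const_bound[where B="(4 * L)\<^sup>2"])
    show "AE z in ?U \<Otimes>\<^sub>M ?U. norm ((gm m (fst z) (snd z))\<^sup>2) \<le> (4 * L)\<^sup>2"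
    proof (rule AE_I2)
      fix z assume "z \<in> space (?U \<Otimes>\<^sub>M ?U)"
      then have "\<bar>gm m (fst z) (snd z)\<bar>\<^sup>2 \<le> (4 * L)\<^sup>2" by (intro power_mono b) (auto simp: space_pair_measure)
      then show "norm ((gm m (fst z) (snd z))\<^sup>2) \<le> (4 * L)\<^sup>2" by simp
    qed
    show "(\<lambda>z. (gm m (fst z) (snd z))\<^sup>2) \<in> borel_measurable (?U \<Otimes>\<^sub>M ?U)" using gmm by measurable
  qed
  have ind: "indicator (B m) y * gm m x y = gm m x y" if "x \<in> space M" "y \<in> space M" for x y
    using gm_supp[OF that] by (auto simp: indicator_def)
  show d: "degenerate_kernel ?U (gm m) (4 * L)"
  proof (intro degenerate_kernel.intro kernel.intro kernel_axioms.intro degenerate_kernel_axioms.intro)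
    show "prob_space ?U" by (rule U.prob_space_axioms)
    fix x assume x: "x \<in> space ?U"
    show "(\<integral>y. gm m x y \<partial>?U) = 0"
    proof -
      have "(\<integral>y. gm m x y \<partial>?U) = (\<integral>y. indicator (B m) y * gm m x y \<partial>M) / prob (B m)"
        using x by (intro integral_uniform_measure B_meas pB gm.f_comp) auto
      also have "(\<integral>y. indicator (B m) y * gm m x y \<partial>M) = (\<integral>y. gm m x y \<partial>M)"
        using x ind by (intro Bochner_Integration.integral_cong) auto
      finally show ?thesis using gm.f_degen x by simp
    qed
  qed (use gmm int b gm.f_sym in auto)
  interpret gU: degenerate_kernel ?U "gm m" "4 * L" by (rule d)
  have sqm: "meas2 (\<lambda>x y. (gm m x y)\<^sup>2)" using gm.f_meas unfolding meas2_def by measurable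
  have "gU.\<kappa> = (\<integral>x. \<integral>y. (gm m x y)\<^sup>2 \<partial>?U \<partial>?U)"
    unfolding gU.\<kappa>_def using UU.integral_fst'[OF int] by simp
  also have "\<dots> = (\<integral>x. (\<integral>y. (gm m x y)\<^sup>2 \<partial>M) / p m \<partial>?U)"
  proof (rule Bochner_Integration.integral_cong[OF refl])
    fix x assume x: "x \<in> space ?U"
    have "(\<integral>y. (gm m x y)\<^sup>2 \<partial>?U) = (\<integral>y. indicator (B m) y * (gm m x y)\<^sup>2 \<partial>M) / prob (B m)"
      using x by (intro integral_uniform_measure B_meas pB meas2D[OF sqm]) auto
    also have "(\<integral>y. indicator (B m) y * (gm m x y)\<^sup>2 \<partial>M) = (\<integral>y. (gm m x y)\<^sup>2 \<partial>M)"
      using x gm_supp by (intro Bochner_Integration.integral_cong) (auto simp: indicator_def)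
    finally show "(\<integral>y. (gm m x y)\<^sup>2 \<partial>?U) = (\<integral>y. (gm m x y)\<^sup>2 \<partial>M) / p m" by (simp add: p_def)
  qed
  also have "\<dots> = (\<integral>x. indicator (B m) x * ((\<integral>y. (gm m x y)\<^sup>2 \<partial>M) / p m) \<partial>M) / prob (B m)"
  proof (intro integral_uniform_measure B_meas pB)
    have "(\<lambda>x. \<integral>y. (gm m x y)\<^sup>2 \<partial>M) \<in> borel_measurable M"
      by (rule borel_measurable_lebesgue_integral) (use sqm in \<open>simp add: meas2_def split_beta'\<close>)
    then show "(\<lambda>x. (\<integral>y. (gm m x y)\<^sup>2 \<partial>M) / p m) \<in> borel_measurable M" by measurable
  qed
  also have "(\<integral>x. indicator (B m) x * ((\<integral>y. (gm m x y)\<^sup>2 \<partial>M) / p m) \<partial>M) = (\<integral>x. (\<integral>y. (gm m x y)\<^sup>2 \<partial>M) / p m \<partial>M)"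
  proof (rule Bochner_Integration.integral_cong[OF refl])
    fix x assume x: "x \<in> space M"
    show "indicator (B m) x * ((\<integral>y. (gm m x y)\<^sup>2 \<partial>M) / p m) = (\<integral>y. (gm m x y)\<^sup>2 \<partial>M) / p m"
      using x by (cases "x \<in> B m") (auto simp: B_def gm_def)
  qed
  also have "\<dots> = gm.\<kappa> m / p m"
    unfolding gm.\<kappa>_def using PP.integral_fst'[OF gm.f_L2[of m]] by simp
  finally have "gU.\<kappa> = gm.\<kappa> m / p m / prob (B m)" .
  then show "gU.\<kappa> = \<rho> m" unfolding \<rho>_def p_def[symmetric] power2_eq_square divide_divide_eq_left .
qed

end

lemma (in prob_space) indicator_Cauchy_Schwarz:
  fixes \<phi> :: "'a \<Rightarrow> real"
  assumes A: "A \<in> events" "0 < prob A" and \<phi>[measurable]: "\<phi> \<in> borel_measurable M"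
    and int: "integrable M (\<lambda>x. indicator A x * (\<phi> x)\<^sup>2)"
  shows "(\<integral>x. indicator A x * \<phi> x \<partial>M)\<^sup>2 / prob A \<le> (\<integral>x. indicator A x * (\<phi> x)\<^sup>2 \<partial>M)"
proof -
  have ind: "integrable M (\<lambda>x. indicator A x :: real)" using A by (intro integrable_real_indicator) (auto simp: emeasure_eq_measure)
  have sq: "(\<lambda>x. (indicator A x * \<phi> x)\<^sup>2) = (\<lambda>x. indicator A x * (\<phi> x)\<^sup>2)"
    by (auto simp: indicator_def fun_eq_iff)
  have "integrable M (\<lambda>x. (indicator A x * \<phi> x)\<^sup>2)" unfolding sq by (rule int)
  then have int1: "integrable M (\<lambda>x. indicator A x * \<phi> x)"
    by (rule square_integrable_imp_integrable[rotated]) (use A(1) in measurable)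
  \<comment> \<open>The mean of \<phi> over \<open>A\<close>; nonnegativity of the integral of
    (\<phi> - t)^2 over \<open>A\<close> is the claim.\<close>
  define t where "t = (\<integral>x. indicator A x * \<phi> x \<partial>M) / prob A"
  have "0 \<le> (\<integral>x. indicator A x * (\<phi> x - t)\<^sup>2 \<partial>M)" by (intro Bochner_Integration.integral_nonneg) auto
  also have "\<dots> = (\<integral>x. indicator A x * (\<phi> x)\<^sup>2 - 2 * t * (indicator A x * \<phi> x) + t\<^sup>2 * indicator A x \<partial>M)"
    by (simp add: power2_diff algebra_simps)
  also have "\<dots> = (\<integral>x. indicator A x * (\<phi> x)\<^sup>2 \<partial>M) - 2 * t * (\<integral>x. indicator A x * \<phi> x \<partial>M) + t\<^sup>2 * prob A"
    using int int1 ind A by simp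
  finally have "0 \<le> (\<integral>x. indicator A x * (\<phi> x)\<^sup>2 \<partial>M) - 2 * t * (\<integral>x. indicator A x * \<phi> x \<partial>M) + t\<^sup>2 * prob A" .
  moreover have "2 * t * (\<integral>x. indicator A x * \<phi> x \<partial>M) - t\<^sup>2 * prob A = (\<integral>x. indicator A x * \<phi> x \<partial>M)\<^sup>2 / prob A"
    using A(2) by (simp add: t_def power2_eq_square)
  ultimately show ?thesis by linarith
qed

lemma sq_sum5: "(r + s + t + u + v)\<^sup>2 \<le> 5 * (r\<^sup>2 + s\<^sup>2 + t\<^sup>2 + u\<^sup>2 + (v::real)\<^sup>2)"
proof -
  have "0 \<le> (r-s)\<^sup>2 + (r-t)\<^sup>2 + (r-u)\<^sup>2 + (r-v)\<^sup>2 + (s-t)\<^sup>2 + (s-u)\<^sup>2 + (s-v)\<^sup>2 + (t-u)\<^sup>2 + (t-v)\<^sup>2 + (u-v)\<^sup>2"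
    by simp
  also have "\<dots> = 5 * (r\<^sup>2 + s\<^sup>2 + t\<^sup>2 + u\<^sup>2 + v\<^sup>2) - (r + s + t + u + v)\<^sup>2"
    by (simp add: power2_eq_square algebra_simps)
  finally show ?thesis by simp
qed

section \<open>Mean-square distance between the kernel and its blockwise projection\<close>

context block_kernel
begin

lemma f_meas2_sq: "meas2 u \<Longrightarrow> meas2 (\<lambda>x y. (u x y)\<^sup>2)" unfolding meas2_def by (rule borel_measurable_power)

lemma meas2_section: "meas2 u \<Longrightarrow> x \<in> space M \<Longrightarrow> u x \<in> borel_measurable M"
  by (rule meas2D[of u "\<lambda>_. x" M "\<lambda>y. y"]) (auto intro: measurable_ident_sets)

definition "L2 u \<longleftrightarrow> meas2 u \<and> integrable (M \<Otimes>\<^sub>M M) (\<lambda>z. (u (fst z) (snd z))\<^sup>2)" for u :: "'a \<Rightarrow> 'a \<Rightarrow> real"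
definition "sq u = (\<integral>z. (u (fst z) (snd z))\<^sup>2 \<partial>(M \<Otimes>\<^sub>M M))" for u :: "'a \<Rightarrow> 'a \<Rightarrow> real"
text \<open>The weight \<open>p (c x)\<close> makes this the squared norm, on the product space, of
  the function equal to \<open>proj u x\<close> when \<open>x\<close> and \<open>y\<close> share a
  cell and 0 otherwise.\<close>

definition "psq u = (\<integral>x. p (c x) * (proj u x)\<^sup>2 \<partial>M)" for u

lemma sq_nonneg: "0 \<le> sq u" by (simp add: sq_def)

lemma psq_nonneg: "0 \<le> psq u" unfolding psq_def p_def by (intro Bochner_Integration.integral_nonneg) auto

lemma L2_dominated:
  assumes "L2 v" "meas2 u" "\<And>x y. x \<in> space M \<Longrightarrow> y \<in> space M \<Longrightarrow> \<bar>u x y\<bar> \<le> \<bar>v x y\<bar>"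
  shows "L2 u" "sq u \<le> sq v"
proof -
  have le: "(u (fst z) (snd z))\<^sup>2 \<le> (v (fst z) (snd z))\<^sup>2" if "z \<in> space (M \<Otimes>\<^sub>M M)" for z
    using assms(3)[of "fst z" "snd z"] that by (auto simp: space_pair_measure abs_le_square_iff)
  have m: "(\<lambda>z. (u (fst z) (snd z))\<^sup>2) \<in> borel_measurable (M \<Otimes>\<^sub>M M)" using f_meas2_sq[OF assms(2)] by (simp add: meas2_def)
  have "integrable (M \<Otimes>\<^sub>M M) (\<lambda>z. (u (fst z) (snd z))\<^sup>2)"
    by (rule Bochner_Integration.integrable_bound[OF _ m]) (use assms(1) le in \<open>auto simp: L2_def\<close>)
  then show "L2 u" using assms(2) by (simp add: L2_def)
  then show "sq u \<le> sq v" unfolding sq_def using assms(1) le by (intro integral_mono) (auto simp: L2_def)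
qed

lemma L2_f: "L2 f" using f_L2 meas2_kernels by (simp add: L2_def)
lemma L2_parts: "L2 low" "L2 high" "L2 diag" "sq low \<le> sq f" "sq high \<le> sq f"
  using L2_dominated[OF L2_f] meas2_kernels by (auto simp: low_def high_def diag_def)

lemma L2_section:
  assumes "L2 u"
  shows "AE x in M. integrable M (u x) \<and> integrable M (\<lambda>y. (u x y)\<^sup>2)"
proof -
  have "integrable (M \<Otimes>\<^sub>M M) (\<lambda>z. u (fst z) (snd z))"
    by (rule PP.P.square_integrable_imp_integrable) (use assms in \<open>auto simp: L2_def meas2_def\<close>)
  from PP.AE_integrable_fst'[OF this] have "AE x in M. integrable M (u x)" by simp
  moreover have "AE x in M. integrable M (\<lambda>y. (u x y)\<^sup>2)"
    using PP.AE_integrable_fst'[of "\<lambda>z. (u (fst z) (snd z))\<^sup>2"] assms by (simp add: L2_def)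
  ultimately show ?thesis by (rule AE_conjI)
qed

text \<open>Cauchy-Schwarz on a section supported in a cell of mass \<open>p (c x)\<close>.\<close>

lemma p_proj_sq_le:
  assumes x: "x \<in> space M" and u: "meas2 u" "\<And>y. y \<in> space M \<Longrightarrow> u x y \<noteq> 0 \<Longrightarrow> c y = c x"
    and int: "integrable M (\<lambda>y. (u x y)\<^sup>2)"
  shows "p (c x) * (proj u x)\<^sup>2 \<le> (\<integral>y. (u x y)\<^sup>2 \<partial>M)"
proof -
  have ind: "indicator (B (c x)) y * u x y = u x y" "indicator (B (c x)) y * (u x y)\<^sup>2 = (u x y)\<^sup>2" if "y \<in> space M" for y
    using u(2)[OF that] that by (auto simp: B_def indicator_def)
  have "integrable M (\<lambda>y. indicator (B (c x)) y * (u x y)\<^sup>2)"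
    using int by (rule Bochner_Integration.integrable_cong[THEN iffD1, rotated 2]) (simp_all only: ind(2))
  from indicator_Cauchy_Schwarz[OF B_meas _ meas2_section[OF u(1) x] this] p_pos'[OF x]
  have "(\<integral>y. indicator (B (c x)) y * u x y \<partial>M)\<^sup>2 / p (c x) \<le> (\<integral>y. indicator (B (c x)) y * (u x y)\<^sup>2 \<partial>M)"
    by (simp add: p_def)
  also have "(\<integral>y. indicator (B (c x)) y * u x y \<partial>M) = (\<integral>y. u x y \<partial>M)"
    by (rule Bochner_Integration.integral_cong[OF refl]) (rule ind)
  also have "(\<integral>y. indicator (B (c x)) y * (u x y)\<^sup>2 \<partial>M) = (\<integral>y. (u x y)\<^sup>2 \<partial>M)"
    by (rule Bochner_Integration.integral_cong[OF refl]) (rule ind)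
  finally show ?thesis using p_pos'[OF x] by (simp add: proj_def power2_eq_square field_simps)
qed

lemma psq_le:
  assumes u: "L2 u" "\<And>x y. x \<in> space M \<Longrightarrow> y \<in> space M \<Longrightarrow> u x y \<noteq> 0 \<Longrightarrow> c y = c x"
  shows "psq u \<le> sq u" "integrable M (\<lambda>x. p (c x) * (proj u x)\<^sup>2)"
proof -
  have int: "integrable M (\<lambda>x. \<integral>y. (u x y)\<^sup>2 \<partial>M)"
    using PP.integrable_fst'[of "\<lambda>z. (u (fst z) (snd z))\<^sup>2"] u(1) by (simp add: L2_def)
  have ae: "AE x in M. p (c x) * (proj u x)\<^sup>2 \<le> (\<integral>y. (u x y)\<^sup>2 \<partial>M)"
    using L2_section[OF u(1)] AE_space
    by eventually_elim (rule p_proj_sq_le, use u in \<open>auto simp: L2_def\<close>)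
  have [measurable]: "proj u \<in> borel_measurable M" using u(1) by (intro proj_meas) (simp add: L2_def)
  show i: "integrable M (\<lambda>x. p (c x) * (proj u x)\<^sup>2)"
  proof (rule Bochner_Integration.integrable_bound[OF int])
    show "AE x in M. norm (p (c x) * (proj u x)\<^sup>2) \<le> norm (\<integral>y. (u x y)\<^sup>2 \<partial>M)"
      using ae by eventually_elim (simp add: p_def)
  qed measurable
  have "psq u \<le> (\<integral>x. \<integral>y. (u x y)\<^sup>2 \<partial>M \<partial>M)" unfolding psq_def by (rule integral_mono_AE[OF i int ae])
  also have "\<dots> = sq u" unfolding sq_def
    using PP.integral_fst'[of "\<lambda>z. (u (fst z) (snd z))\<^sup>2"] u(1) by (simp add: L2_def)
  finally show "psq u \<le> sq u" .
qed

text \<open>The operator norm will bound the projection of the untruncated \<open>diag\<close>, not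
  that of \<open>low\<close>. Since \<open>low\<close> is \<open>diag\<close> minus
  \<open>high\<close>, the difference costs the projection of \<open>high\<close>, which is a
  contraction.\<close>

lemma psq_low_le: "psq low \<le> 2 * psq diag + 2 * sq high"
proof -
  have pd: "integrable M (\<lambda>x. p (c x) * (proj diag x)\<^sup>2)" by (rule psq_le[OF L2_parts(3)]) (auto simp: diag_def split: if_splits)
  have ph: "integrable M (\<lambda>x. p (c x) * (proj high x)\<^sup>2)" "psq high \<le> sq high"
    by (rule psq_le[OF L2_parts(2)], auto simp: high_def split: if_splits)+
  have pl: "integrable M (\<lambda>x. p (c x) * (proj low x)\<^sup>2)" by (rule psq_le[OF L2_parts(1)]) (auto simp: low_def split: if_splits)
  have "psq low \<le> (\<integral>x. 2 * (p (c x) * (proj diag x)\<^sup>2) + 2 * (p (c x) * (proj high x)\<^sup>2) \<partial>M)"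
    unfolding psq_def
  proof (rule integral_mono_AE[OF pl])
    show "integrable M (\<lambda>x. 2 * (p (c x) * (proj diag x)\<^sup>2) + 2 * (p (c x) * (proj high x)\<^sup>2))" using pd ph by simp
    show "AE x in M. p (c x) * (proj low x)\<^sup>2 \<le> 2 * (p (c x) * (proj diag x)\<^sup>2) + 2 * (p (c x) * (proj high x)\<^sup>2)"
      using L2_section[OF L2_parts(2)] L2_section[OF L2_parts(3)]
    proof eventually_elim
      case (elim x)
      have "(\<integral>y. low x y \<partial>M) = (\<integral>y. diag x y - high x y \<partial>M)"
        by (intro Bochner_Integration.integral_cong) (auto simp: low_def diag_def high_def)
      also have "\<dots> = (\<integral>y. diag x y \<partial>M) - (\<integral>y. high x y \<partial>M)" using elim by (intro Bochner_Integration.integral_diff) auto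
      finally have pl: "proj low x = proj diag x - proj high x" by (simp add: proj_def diff_divide_distrib)
      have "(proj low x)\<^sup>2 \<le> 2 * (proj diag x)\<^sup>2 + 2 * (proj high x)\<^sup>2"
        unfolding pl using zero_le_power2[of "proj diag x + proj high x"] by (simp add: power2_eq_square algebra_simps)
      then have "p (c x) * (proj low x)\<^sup>2 \<le> p (c x) * (2 * (proj diag x)\<^sup>2 + 2 * (proj high x)\<^sup>2)"
        by (intro mult_left_mono) (auto simp: p_def)
      then show ?case by (simp add: algebra_simps)
    qed
  qed
  also have "\<dots> = 2 * psq diag + 2 * psq high" using pd ph by (simp add: psq_def)
  finally show ?thesis using ph by simp
qed

lemma integral_cells:
  fixes F :: "'a \<Rightarrow> real"
  assumes "integrable M F"
  shows "(\<integral>x. F x \<partial>M) = (\<Sum>m\<in>{1..N}. \<integral>x. indicator (B m) x * F x \<partial>M)"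
proof -
  have "(\<Sum>m\<in>{1..N}. \<integral>x. indicator (B m) x * F x \<partial>M) = (\<integral>x. (\<Sum>m\<in>{1..N}. indicator (B m) x * F x) \<partial>M)"
    using assms by (intro Bochner_Integration.integral_sum[symmetric]) (use integrable_mult_indicator[OF B_meas, of F] in auto)
  also have "\<dots> = (\<integral>x. F x \<partial>M)"
  proof (rule Bochner_Integration.integral_cong[OF refl])
    fix x assume x: "x \<in> space M"
    have "(\<Sum>m\<in>{1..N}. indicator (B m) x * F x) = (\<Sum>m\<in>{1..N}. if m = c x then F x else 0)"
      using x by (intro sum.cong) (auto simp: B_def indicator_def)
    then show "(\<Sum>m\<in>{1..N}. indicator (B m) x * F x) = F x" using c_in[OF x] by simp
  qed
  finally show ?thesis ..
qed

lemma integral_cell_const: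
  fixes \<phi> :: "nat \<Rightarrow> real"
  shows "(\<integral>x. \<phi> (c x) \<partial>M) = (\<Sum>m\<in>{1..N}. p m * \<phi> m)" "integrable M (\<lambda>x. \<phi> (c x))"
proof -
  have "\<bar>\<phi> (c x)\<bar> \<le> (\<Sum>m\<in>{1..N}. \<bar>\<phi> m\<bar>)" if "x \<in> space M" for x
    using c_in[OF that] by (intro member_le_sum) auto
  moreover have "(\<lambda>x. \<phi> (c x)) \<in> borel_measurable M" by (rule measurable_compose[OF c_meas]) simp
  ultimately show i: "integrable M (\<lambda>x. \<phi> (c x))"
    by (intro integrable_const_bound[where B="\<Sum>m\<in>{1..N}. \<bar>\<phi> m\<bar>"]) auto
  have "(\<integral>x. indicator (B m) x * \<phi> (c x) \<partial>M) = p m * \<phi> m" for m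
  proof -
    have "(\<integral>x. indicator (B m) x * \<phi> (c x) \<partial>M) = (\<integral>x. indicator (B m) x * \<phi> m \<partial>M)"
      by (intro Bochner_Integration.integral_cong) (auto simp: B_def indicator_def)
    then show ?thesis by (simp only: integral_B_const)
  qed
  then show "(\<integral>x. \<phi> (c x) \<partial>M) = (\<Sum>m\<in>{1..N}. p m * \<phi> m)" using integral_cells[OF i] by simp
qed

lemma integral_cell_indicator: "x \<in> space M \<Longrightarrow> (\<integral>y. of_bool (c x = c y) * k \<partial>M) = p (c x) * (k::real)"
proof -
  assume "x \<in> space M"
  have "(\<integral>y. of_bool (c x = c y) * k \<partial>M) = (\<integral>y. indicator (B (c x)) y * k \<partial>M)"
    by (intro Bochner_Integration.integral_cong) (auto simp: B_def indicator_def)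
  then show ?thesis by (simp only: integral_B_const)
qed

lemma proj_low_sq_cell:
  assumes m: "m \<in> {1..N}"
  shows "p m * (mean low m)\<^sup>2 \<le> (\<integral>x. indicator (B m) x * (proj low x)\<^sup>2 \<partial>M)"
    "integrable M (\<lambda>x. indicator (B m) x * (proj low x)\<^sup>2)"
proof -
  show i: "integrable M (\<lambda>x. indicator (B m) x * (proj low x)\<^sup>2)"
  proof (rule integrable_const_bound[where B="L\<^sup>2"])
    show "AE x in M. norm (indicator (B m) x * (proj low x)\<^sup>2) \<le> L\<^sup>2"
    proof (rule AE_I2)
      fix x assume "x \<in> space M"
      then have "\<bar>proj low x\<bar>\<^sup>2 \<le> L\<^sup>2" by (intro power_mono proj_low_bdd) auto
      then show "norm (indicator (B m) x * (proj low x)\<^sup>2) \<le> L\<^sup>2" by (auto simp: indicator_def)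
    qed
  qed measurable
  have pm: "0 < p m" using p_pos[OF m] by (simp add: p_def B_def)
  from indicator_Cauchy_Schwarz[OF B_meas _ _ i] pm
  have "(\<integral>x. indicator (B m) x * proj low x \<partial>M)\<^sup>2 / p m \<le> (\<integral>x. indicator (B m) x * (proj low x)\<^sup>2 \<partial>M)"
    by (simp add: p_def)
  then show "p m * (mean low m)\<^sup>2 \<le> (\<integral>x. indicator (B m) x * (proj low x)\<^sup>2 \<partial>M)"
    using pm by (simp add: integral_proj_low[OF m] power2_eq_square mult_ac)
qed

text \<open>Jensen's inequality within each cell.\<close>

lemma mean_sq_le: "(\<integral>x. p (c x) * (mean low (c x))\<^sup>2 \<partial>M) \<le> psq low"
proof -
  have pl: "integrable M (\<lambda>x. p (c x) * (proj low x)\<^sup>2)" by (rule psq_le[OF L2_parts(1)]) (auto simp: low_def split: if_splits)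
  have "(\<integral>x. p (c x) * (mean low (c x))\<^sup>2 \<partial>M) = (\<Sum>m\<in>{1..N}. p m * (p m * (mean low m)\<^sup>2))"
    by (rule integral_cell_const)
  also have "\<dots> \<le> (\<Sum>m\<in>{1..N}. p m * (\<integral>x. indicator (B m) x * (proj low x)\<^sup>2 \<partial>M))"
    by (intro sum_mono mult_left_mono proj_low_sq_cell) (auto simp: p_def)
  also have "\<dots> = (\<Sum>m\<in>{1..N}. \<integral>x. indicator (B m) x * (p (c x) * (proj low x)\<^sup>2) \<partial>M)"
  proof (rule sum.cong[OF refl])
    fix m
    have "(\<integral>x. indicator (B m) x * (p (c x) * (proj low x)\<^sup>2) \<partial>M) = (\<integral>x. p m * (indicator (B m) x * (proj low x)\<^sup>2) \<partial>M)"
      by (intro Bochner_Integration.integral_cong) (auto simp: B_def indicator_def)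
    then show "p m * (\<integral>x. indicator (B m) x * (proj low x)\<^sup>2 \<partial>M) = (\<integral>x. indicator (B m) x * (p (c x) * (proj low x)\<^sup>2) \<partial>M)" by simp
  qed
  also have "\<dots> = psq low" unfolding psq_def by (rule integral_cells[OF pl, symmetric])
  finally show ?thesis .
qed

definition "off x y = (if c x = c y then 0 else f x y)"

lemma L2_off: "L2 off"
  by (rule L2_dominated[OF L2_f]) (auto simp: off_def meas2_def)

lemma sq_iterated: "L2 u \<Longrightarrow> sq u = (\<integral>x. \<integral>y. (u x y)\<^sup>2 \<partial>M \<partial>M)"
  unfolding sq_def L2_def using PP.integral_fst'[of "\<lambda>z. (u (fst z) (snd z))\<^sup>2"] by simp

lemma L2_bounded: "meas2 u \<Longrightarrow> (\<And>x y. x \<in> space M \<Longrightarrow> y \<in> space M \<Longrightarrow> \<bar>u x y\<bar> \<le> b) \<Longrightarrow> L2 u"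
  unfolding L2_def using bounded_L2 by blast

lemma sq_transpose: "L2 u \<Longrightarrow> sq (\<lambda>x y. u y x) = sq u"
  unfolding sq_def L2_def using PP.integral_product_swap[of "\<lambda>z. (u (fst z) (snd z))\<^sup>2"] by (simp add: split_beta' borel_measurable_integrable)

text \<open>\<open>f - g\<close> has five parts: off-diagonal, truncated, two one-sided projections
  and the cell mean. The last three have squared norm at most \<open>psq low\<close>, hence at most
  2 psq diag + 2 sq high. With the factor 5 of \<open>sq_sum5\<close> the coefficients are 5, 35 and
  30, all at most 35.\<close>

theorem sq_diff_le: "sq (\<lambda>x y. f x y - g x y) \<le> 35 * (sq off + sq high + psq diag)"
proof -
  define b1 where "b1 x y = of_bool (c x = c y) * proj low x" for x y
  define b2 where "b2 x y = b1 y x" for x y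
  define b3 where "b3 x y = of_bool (c x = c y) * - mean low (c x)" for x y
  have m: "meas2 b1" "meas2 b2" "meas2 b3" unfolding meas2_def b1_def b2_def b3_def by measurable
  have "\<bar>b1 x y\<bar> \<le> L" "\<bar>b2 x y\<bar> \<le> L" "\<bar>b3 x y\<bar> \<le> L" if "x \<in> space M" "y \<in> space M" for x y
    using that proj_low_bdd mean_low_bdd[OF c_in] L_pos by (auto simp: b1_def b2_def b3_def)
  then have L2: "L2 b1" "L2 b2" "L2 b3" using m by (auto intro!: L2_bounded[where b=L])
  have s1: "sq b1 = psq low"
    unfolding sq_iterated[OF L2(1)] psq_def
  proof (rule Bochner_Integration.integral_cong[OF refl])
    fix x assume x: "x \<in> space M"
    have "(b1 x y)\<^sup>2 = of_bool (c x = c y) * (proj low x)\<^sup>2" for y by (simp add: b1_def)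
    then show "(\<integral>y. (b1 x y)\<^sup>2 \<partial>M) = p (c x) * (proj low x)\<^sup>2" by (simp only: integral_cell_indicator[OF x])
  qed
  have s2: "sq b2 = psq low" unfolding b2_def[abs_def] using sq_transpose[OF L2(1)] s1 by simp
  have "sq b3 = (\<integral>x. p (c x) * (mean low (c x))\<^sup>2 \<partial>M)"
    unfolding sq_iterated[OF L2(3)]
  proof (rule Bochner_Integration.integral_cong[OF refl])
    fix x assume x: "x \<in> space M"
    have "(b3 x y)\<^sup>2 = of_bool (c x = c y) * (mean low (c x))\<^sup>2" for y by (simp add: b3_def)
    then show "(\<integral>y. (b3 x y)\<^sup>2 \<partial>M) = p (c x) * (mean low (c x))\<^sup>2" by (simp only: integral_cell_indicator[OF x])
  qed
  then have s3: "sq b3 \<le> psq low" using mean_sq_le by simp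
  have le: "(f x y - g x y)\<^sup>2 \<le> 5 * ((off x y)\<^sup>2 + (high x y)\<^sup>2 + (b1 x y)\<^sup>2 + (b2 x y)\<^sup>2 + (b3 x y)\<^sup>2)" for x y
  proof -
    have "f x y - g x y = off x y + high x y + b1 x y + b2 x y + b3 x y"
      by (auto simp: g_def off_def high_def low_def b1_def b2_def b3_def)
    then show ?thesis using sq_sum5[of "off x y" "high x y" "b1 x y" "b2 x y" "b3 x y"] by simp
  qed
  note ints = L2_off[unfolded L2_def] L2_parts(2)[unfolded L2_def] L2[unfolded L2_def]
  have I: "integrable (M \<Otimes>\<^sub>M M) (\<lambda>z. 5 * ((off (fst z) (snd z))\<^sup>2 + (high (fst z) (snd z))\<^sup>2
      + (b1 (fst z) (snd z))\<^sup>2 + (b2 (fst z) (snd z))\<^sup>2 + (b3 (fst z) (snd z))\<^sup>2))"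
    using ints by simp
  have "sq (\<lambda>x y. f x y - g x y) \<le> (\<integral>z. 5 * ((off (fst z) (snd z))\<^sup>2 + (high (fst z) (snd z))\<^sup>2
      + (b1 (fst z) (snd z))\<^sup>2 + (b2 (fst z) (snd z))\<^sup>2 + (b3 (fst z) (snd z))\<^sup>2) \<partial>(M \<Otimes>\<^sub>M M))"
    unfolding sq_def by (rule integral_mono_AE'[OF I], rule AE_I2, rule le) simp
  also have "\<dots> = 5 * (sq off + sq high + sq b1 + sq b2 + sq b3)"
    unfolding sq_def using ints by simp
  also have "\<dots> \<le> 35 * (sq off + sq high + psq diag)"
    using s1 s2 s3 psq_low_le sq_nonneg[of off] sq_nonneg[of high] psq_nonneg[of diag] by simp
  finally show ?thesis .
qed

sublocale d: kernel M "\<lambda>x y. f x y - g x y"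
proof
  show m: "(\<lambda>z. f (fst z) (snd z) - g (fst z) (snd z)) \<in> borel_measurable (M \<Otimes>\<^sub>M M)"
    using f_meas g.f_meas by measurable
  show "integrable (M \<Otimes>\<^sub>M M) (\<lambda>z. (f (fst z) (snd z) - g (fst z) (snd z))\<^sup>2)"
  proof (rule Bochner_Integration.integrable_bound)
    show "integrable (M \<Otimes>\<^sub>M M) (\<lambda>z. 2 * (f (fst z) (snd z))\<^sup>2 + 2 * (g (fst z) (snd z))\<^sup>2)"
      using f_L2 g.f_L2 by simp
    show "(\<lambda>z. (f (fst z) (snd z) - g (fst z) (snd z))\<^sup>2) \<in> borel_measurable (M \<Otimes>\<^sub>M M)" using m by measurable
    have "(a - b)\<^sup>2 \<le> 2 * a\<^sup>2 + 2 * (b::real)\<^sup>2" for a b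
      using zero_le_power2[of "a + b"] by (simp add: power2_eq_square algebra_simps)
    then show "AE z in M \<Otimes>\<^sub>M M. norm ((f (fst z) (snd z) - g (fst z) (snd z))\<^sup>2)
       \<le> norm (2 * (f (fst z) (snd z))\<^sup>2 + 2 * (g (fst z) (snd z))\<^sup>2)" by simp
  qed
qed (use f_sym g_sym in auto)

text \<open>Subtracting a degenerate kernel does not change the first projection, so the remainder
  carries the whole linear part of \<open>f\<close>.\<close>

lemma d_\<beta>: "d.\<beta> = \<beta>"
  unfolding d.\<beta>_def \<beta>_def
proof (rule integral_cong_AE)
  show "AE x in M. (d.f1 x)\<^sup>2 = (f1 x)\<^sup>2"
    using L2_section[OF L2_f] AE_space
  proof eventually_elim
    case (elim x)
    have "integrable M (g x)"
      using g_bdd elim by (intro integrable_const_bound[where B="4 * L"]) (auto intro!: meas2_section g_meas2)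
    then show ?case using elim g_degen[of x] by (simp add: d.f1_def f1_def)
  qed
qed measurable

lemma d_\<kappa>: "d.\<kappa> \<le> 35 * (sq off + sq high + psq diag)"
  using sq_diff_le by (simp add: sq_def d.\<kappa>_def)

definition "\<kappa>m m = (\<integral>z. (of_bool (c (fst z) = m \<and> c (snd z) = m) * f (fst z) (snd z))\<^sup>2 \<partial>(M \<Otimes>\<^sub>M M))"

text \<open>Truncation and averaging within the block do not increase the squared norm, so each of
  the four pieces of \<open>gm m\<close> is at most the block of \<open>f\<close>. The constant is 5
  from \<open>sq_sum5\<close>, with its fifth entry 0, times 4.\<close>

lemma gm_\<kappa>_le:
  assumes m: "m \<in> {1..N}" shows "gm.\<kappa> m \<le> 20 * \<kappa>m m"
proof -
  define u where "u x y = of_bool (c x = m \<and> c y = m) * f x y" for x y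
  define a where "a x y = of_bool (c x = m \<and> c y = m) * low x y" for x y
  define b1 where "b1 x y = of_bool (c x = m \<and> c y = m) * proj low x" for x y
  define b2 where "b2 x y = b1 y x" for x y
  define b3 where "b3 x y = of_bool (c x = m \<and> c y = m) * mean low m" for x y
  have ms: "meas2 u" "meas2 a" "meas2 b1" "meas2 b2" "meas2 b3" unfolding meas2_def u_def a_def b1_def b2_def b3_def by measurable
  have bd: "\<bar>b1 x y\<bar> \<le> L" "\<bar>b2 x y\<bar> \<le> L" "\<bar>b3 x y\<bar> \<le> L" if "x \<in> space M" "y \<in> space M" for x y
    using that proj_low_bdd mean_low_bdd[OF m] L_pos by (auto simp: b1_def b2_def b3_def)
  have L2: "L2 u" "L2 b1" "L2 b2" "L2 b3" using L2_dominated(1)[OF L2_f ms(1)] bd ms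
    by (auto intro!: L2_bounded[where b=L] simp: u_def)
  have L2a: "L2 a" "sq a \<le> sq u" using L2_dominated[OF L2(1) ms(2)] by (auto simp: a_def u_def low_def)
  have low0: "(\<integral>y. (a x y)\<^sup>2 \<partial>M) = of_bool (c x = m) * (\<integral>y. (low x y)\<^sup>2 \<partial>M)" for x
  proof (cases "c x = m")
    case True
    then have "a x y = low x y" for y by (auto simp: a_def low_def)
    then show ?thesis using True by simp
  qed (simp add: a_def)
  have pm: "0 < p m" using p_pos[OF m] by (simp add: p_def B_def)
  have pl: "integrable M (\<lambda>x. indicator (B m) x * (proj low x)\<^sup>2)" by (rule proj_low_sq_cell[OF m])
  have inner: "(\<integral>y. (b1 x y)\<^sup>2 \<partial>M) = p m * (indicator (B m) x * (proj low x)\<^sup>2)" if x: "x \<in> space M" for x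
  proof -
    have "(\<integral>y. (b1 x y)\<^sup>2 \<partial>M) = (\<integral>y. indicator (B m) y * (indicator (B m) x * (proj low x)\<^sup>2) \<partial>M)"
      using x by (intro Bochner_Integration.integral_cong) (auto simp: b1_def B_def indicator_def)
    then show ?thesis by (simp only: integral_B_const)
  qed
  have s1e: "sq b1 = p m * (\<integral>x. indicator (B m) x * (proj low x)\<^sup>2 \<partial>M)"
    unfolding sq_iterated[OF L2(2)] using inner by (simp cong: Bochner_Integration.integral_cong)
  have "sq b1 \<le> sq a"
    unfolding sq_iterated[OF L2(2)] sq_iterated[OF L2a(1)]
  proof (rule integral_mono)
    show "integrable M (\<lambda>x. \<integral>y. (b1 x y)\<^sup>2 \<partial>M)" using PP.integrable_fst'[of "\<lambda>z. (b1 (fst z) (snd z))\<^sup>2"] L2(2) by (simp add: L2_def)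
    show "integrable M (\<lambda>x. \<integral>y. (a x y)\<^sup>2 \<partial>M)" using PP.integrable_fst'[of "\<lambda>z. (a (fst z) (snd z))\<^sup>2"] L2a(1) by (simp add: L2_def)
    fix x assume x: "x \<in> space M"
    have "integrable M (\<lambda>y. (low x y)\<^sup>2)"
    proof (rule integrable_const_bound[where B="L\<^sup>2"])
      show "AE y in M. norm ((low x y)\<^sup>2) \<le> L\<^sup>2"
        using power_mono[OF low_bdd abs_ge_zero, of x _ 2] by simp
    qed (use x in measurable)
    then have "p (c x) * (proj low x)\<^sup>2 \<le> (\<integral>y. (low x y)\<^sup>2 \<partial>M)"
      by (intro p_proj_sq_le[OF x meas2_kernels(2)]) (auto simp: low_def split: if_splits)
    then show "(\<integral>y. (b1 x y)\<^sup>2 \<partial>M) \<le> (\<integral>y. (a x y)\<^sup>2 \<partial>M)"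
      unfolding inner[OF x] low0 using x by (cases "c x = m") (auto simp: B_def)
  qed
  then have s1: "sq b1 \<le> sq u" using L2a by simp
  have s2: "sq b2 \<le> sq u" unfolding b2_def[abs_def] using sq_transpose[OF L2(2)] s1 by simp
  have "sq b3 = (\<integral>x. p m * (indicator (B m) x * (mean low m)\<^sup>2) \<partial>M)"
    unfolding sq_iterated[OF L2(4)]
  proof (rule Bochner_Integration.integral_cong[OF refl])
    fix x assume x: "x \<in> space M"
    have "(\<integral>y. (b3 x y)\<^sup>2 \<partial>M) = (\<integral>y. indicator (B m) y * (indicator (B m) x * (mean low m)\<^sup>2) \<partial>M)"
      using x by (intro Bochner_Integration.integral_cong) (auto simp: b3_def B_def indicator_def)
    then show "(\<integral>y. (b3 x y)\<^sup>2 \<partial>M) = p m * (indicator (B m) x * (mean low m)\<^sup>2)" by (simp only: integral_B_const)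
  qed
  also have "\<dots> = p m * (p m * (mean low m)\<^sup>2)" by (simp only: integral_mult_right_zero integral_B_const)
  also have "\<dots> \<le> p m * (\<integral>x. indicator (B m) x * (proj low x)\<^sup>2 \<partial>M)"
    using pm by (intro mult_left_mono proj_low_sq_cell m) auto
  finally have s3: "sq b3 \<le> sq u" using s1 s1e by simp
  have le: "(gm m x y)\<^sup>2 \<le> 5 * ((a x y)\<^sup>2 + (b1 x y)\<^sup>2 + (b2 x y)\<^sup>2 + (b3 x y)\<^sup>2)" for x y
  proof -
    have "gm m x y = a x y + (- b1 x y) + (- b2 x y) + b3 x y + 0"
      by (auto simp: gm_eq g_def a_def b1_def b2_def b3_def)
    then show ?thesis using sq_sum5[of "a x y" "- b1 x y" "- b2 x y" "b3 x y" 0] by simp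
  qed
  note ints = L2a(1)[unfolded L2_def] L2[unfolded L2_def]
  have I: "integrable (M \<Otimes>\<^sub>M M) (\<lambda>z. 5 * ((a (fst z) (snd z))\<^sup>2
      + (b1 (fst z) (snd z))\<^sup>2 + (b2 (fst z) (snd z))\<^sup>2 + (b3 (fst z) (snd z))\<^sup>2))"
    using ints by simp
  have "gm.\<kappa> m \<le> (\<integral>z. 5 * ((a (fst z) (snd z))\<^sup>2
      + (b1 (fst z) (snd z))\<^sup>2 + (b2 (fst z) (snd z))\<^sup>2 + (b3 (fst z) (snd z))\<^sup>2) \<partial>(M \<Otimes>\<^sub>M M))"
    unfolding gm.\<kappa>_def by (rule integral_mono_AE'[OF I], rule AE_I2, rule le) simp
  also have "\<dots> = 5 * (sq a + sq b1 + sq b2 + sq b3)"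
    unfolding sq_def using ints by simp
  also have "\<dots> \<le> 20 * sq u" using s1 s2 s3 L2a by simp
  finally show ?thesis by (simp add: sq_def u_def \<kappa>m_def)
qed

end

section \<open>Conditional normal approximation\<close>

text \<open>Weighted inequality 2|ab| <= t a^2 + b^2 / t. The free parameter lets the relative error
  be made small once \<open>b\<close> is negligible.\<close>

lemma abs_integral_sq_add_le:
  fixes a b :: "'a \<Rightarrow> real"
  assumes m: "a \<in> borel_measurable M" "b \<in> borel_measurable M"
    and i: "integrable M (\<lambda>x. (a x)\<^sup>2)" "integrable M (\<lambda>x. (b x)\<^sup>2)" and t: "0 < t"
  shows "\<bar>(\<integral>x. (a x + b x)\<^sup>2 \<partial>M) - (\<integral>x. (a x)\<^sup>2 \<partial>M)\<bar> \<le> t * (\<integral>x. (a x)\<^sup>2 \<partial>M) + (1 + 1 / t) * (\<integral>x. (b x)\<^sup>2 \<partial>M)"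
proof -
  have pw: "2 * \<bar>a x * b x\<bar> \<le> t * (a x)\<^sup>2 + (1 / t) * (b x)\<^sup>2" for x
  proof -
    have "0 \<le> (t * \<bar>a x\<bar> - \<bar>b x\<bar>)\<^sup>2 / t" using t by simp
    also have "\<dots> = t * (a x)\<^sup>2 - 2 * \<bar>a x * b x\<bar> + (1 / t) * (b x)\<^sup>2"
      using t by (simp add: power2_diff power_mult_distrib field_simps abs_mult power2_eq_square)
    finally show ?thesis by simp
  qed
  have ab: "integrable M (\<lambda>x. a x * b x)"
  proof (rule Bochner_Integration.integrable_bound)
    show "integrable M (\<lambda>x. t * (a x)\<^sup>2 + (1 / t) * (b x)\<^sup>2)" using i by simp
    show "AE x in M. norm (a x * b x) \<le> norm (t * (a x)\<^sup>2 + (1 / t) * (b x)\<^sup>2)"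
    proof (rule AE_I2)
      fix x
      have "0 \<le> \<bar>a x * b x\<bar>" by simp
      then have "\<bar>a x * b x\<bar> \<le> t * (a x)\<^sup>2 + (1 / t) * (b x)\<^sup>2" using pw[of x] by linarith
      then show "norm (a x * b x) \<le> norm (t * (a x)\<^sup>2 + (1 / t) * (b x)\<^sup>2)" by simp
    qed
  qed (use m in measurable)
  have "(\<integral>x. (a x + b x)\<^sup>2 \<partial>M) = (\<integral>x. (a x)\<^sup>2 + 2 * (a x * b x) + (b x)\<^sup>2 \<partial>M)"
    by (simp add: power2_sum algebra_simps)
  also have "\<dots> = (\<integral>x. (a x)\<^sup>2 \<partial>M) + 2 * (\<integral>x. a x * b x \<partial>M) + (\<integral>x. (b x)\<^sup>2 \<partial>M)" using i ab by simp
  finally have e: "(\<integral>x. (a x + b x)\<^sup>2 \<partial>M) - (\<integral>x. (a x)\<^sup>2 \<partial>M) = 2 * (\<integral>x. a x * b x \<partial>M) + (\<integral>x. (b x)\<^sup>2 \<partial>M)" by simp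
  have "\<bar>2 * (\<integral>x. a x * b x \<partial>M)\<bar> \<le> 2 * (\<integral>x. \<bar>a x * b x\<bar> \<partial>M)"
    using integral_abs_bound[of M "\<lambda>x. a x * b x"] by (simp add: abs_mult)
  also have "\<dots> = (\<integral>x. 2 * \<bar>a x * b x\<bar> \<partial>M)" by simp
  also have "\<dots> \<le> (\<integral>x. t * (a x)\<^sup>2 + (1 / t) * (b x)\<^sup>2 \<partial>M)"
    using ab i by (intro integral_mono pw) (auto intro!: integrable_mult_right integrable_abs simp del: abs_mult)
  also have "\<dots> = t * (\<integral>x. (a x)\<^sup>2 \<partial>M) + (1 / t) * (\<integral>x. (b x)\<^sup>2 \<partial>M)" using i by simp
  finally have "\<bar>2 * (\<integral>x. a x * b x \<partial>M)\<bar> \<le> t * (\<integral>x. (a x)\<^sup>2 \<partial>M) + (1 / t) * (\<integral>x. (b x)\<^sup>2 \<partial>M)" .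
  moreover have "0 \<le> (\<integral>x. (b x)\<^sup>2 \<partial>M)" by simp
  ultimately show ?thesis unfolding e distrib_right mult_1_left by linarith
qed

context block_kernel
begin

text \<open>An auxiliary kernel: twice its sum over the ordered pairs of the sample is the
  conditional variance of the block sums given the indices. As this is again a sum over pairs,
  \<open>variance_le\<close> yields its concentration, with no computation on multinomial
  counts.\<close>

definition "A x y = of_bool (c x = c y) * \<rho> (c x)"

sublocale A: kernel M A
proof
  have r: "(\<lambda>x. \<rho> (c x)) \<in> borel_measurable M" by (rule measurable_compose[OF c_meas]) simp
  have m: "meas2 A" unfolding meas2_def A_def using measurable_compose[OF measurable_fst r] by measurable
  then show "(\<lambda>z. A (fst z) (snd z)) \<in> borel_measurable (M \<Otimes>\<^sub>M M)" by (simp add: meas2_def)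
  have "\<bar>A x y\<bar> \<le> (\<Sum>m\<in>{1..N}. \<bar>\<rho> m\<bar>)" if "x \<in> space M" for x y
  proof -
    have "\<bar>A x y\<bar> \<le> \<bar>\<rho> (c x)\<bar>" by (simp add: A_def)
    also have "\<dots> \<le> (\<Sum>m\<in>{1..N}. \<bar>\<rho> m\<bar>)" using c_in[OF that] by (intro member_le_sum) auto
    finally show ?thesis .
  qed
  then show "integrable (M \<Otimes>\<^sub>M M) (\<lambda>z. (A (fst z) (snd z))\<^sup>2)" by (intro bounded_L2[OF m])
qed (auto simp: A_def)

lemma gm_\<kappa>: "m \<in> {1..N} \<Longrightarrow> gm.\<kappa> m = (p m)\<^sup>2 * \<rho> m"
  using p_pos_m[of m] by (simp add: \<rho>_def)

lemma A_\<kappa>: "A.\<kappa> = (\<Sum>m\<in>{1..N}. p m * (p m * (\<rho> m)\<^sup>2))"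
proof -
  have "A.\<kappa> = (\<integral>x. \<integral>y. (A x y)\<^sup>2 \<partial>M \<partial>M)"
    unfolding A.\<kappa>_def using PP.integral_fst'[OF A.f_L2] by simp
  also have "\<dots> = (\<integral>x. p (c x) * (\<rho> (c x))\<^sup>2 \<partial>M)"
  proof (rule Bochner_Integration.integral_cong[OF refl])
    fix x assume x: "x \<in> space M"
    have "(A x y)\<^sup>2 = of_bool (c x = c y) * (\<rho> (c x))\<^sup>2" for y by (simp add: A_def)
    then show "(\<integral>y. (A x y)\<^sup>2 \<partial>M) = p (c x) * (\<rho> (c x))\<^sup>2" by (simp only: integral_cell_indicator[OF x])
  qed
  also have "\<dots> = (\<Sum>m\<in>{1..N}. p m * (p m * (\<rho> m)\<^sup>2))" by (rule integral_cell_const)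
  finally show ?thesis .
qed

lemma A_f1: "x \<in> space M \<Longrightarrow> A.f1 x = p (c x) * \<rho> (c x)"
  by (simp only: A.f1_def A_def integral_cell_indicator)

lemma A_\<beta>: "A.\<beta> = (\<Sum>m\<in>{1..N}. p m * (p m * \<rho> m)\<^sup>2)"
proof -
  have "A.\<beta> = (\<integral>x. (p (c x) * \<rho> (c x))\<^sup>2 \<partial>M)"
    unfolding A.\<beta>_def by (intro Bochner_Integration.integral_cong) (auto simp: A_f1)
  also have "\<dots> = (\<Sum>m\<in>{1..N}. p m * (p m * \<rho> m)\<^sup>2)" by (rule integral_cell_const)
  finally show ?thesis .
qed

lemma g_\<kappa>: "g.\<kappa> = (\<Sum>m\<in>{1..N}. gm.\<kappa> m)"
proof -
  have "(\<Sum>m\<in>{1..N}. gm.\<kappa> m) = (\<integral>z. (\<Sum>m\<in>{1..N}. (gm m (fst z) (snd z))\<^sup>2) \<partial>(M \<Otimes>\<^sub>M M))"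
    unfolding gm.\<kappa>_def by (intro Bochner_Integration.integral_sum[symmetric] gm.f_L2)
  also have "\<dots> = g.\<kappa>" unfolding g.\<kappa>_def
  proof (intro Bochner_Integration.integral_cong refl)
    fix z assume "z \<in> space (M \<Otimes>\<^sub>M M)"
    then have z: "c (fst z) \<in> {1..N}" using c_in by (auto simp: space_pair_measure)
    have "(\<Sum>m\<in>{1..N}. (gm m (fst z) (snd z))\<^sup>2) = (\<Sum>m\<in>{1..N}. if m = c (fst z) then (g (fst z) (snd z))\<^sup>2 else 0)"
      by (intro sum.cong) (auto simp: gm_def)
    then show "(\<Sum>m\<in>{1..N}. (gm m (fst z) (snd z))\<^sup>2) = (g (fst z) (snd z))\<^sup>2" using z by simp
  qed
  finally show ?thesis ..
qed

text \<open>The conditional variance averages to the unconditional one.\<close>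

lemma A_\<theta>: "A.\<theta> = g.\<kappa>"
proof -
  have "A.\<theta> = (\<integral>x. A.f1 x \<partial>M)" unfolding A.\<theta>_def A.f1_def using PP.integral_fst'[OF A.f_int] by simp
  also have "\<dots> = (\<integral>x. p (c x) * \<rho> (c x) \<partial>M)" by (intro Bochner_Integration.integral_cong) (auto simp: A_f1)
  also have "\<dots> = (\<Sum>m\<in>{1..N}. p m * (p m * \<rho> m))" by (rule integral_cell_const)
  also have "\<dots> = (\<Sum>m\<in>{1..N}. gm.\<kappa> m)" by (intro sum.cong refl) (simp add: gm_\<kappa> power2_eq_square)
  finally show ?thesis by (simp add: g_\<kappa>)
qed

lemma g_eq_sum_gm: "x \<in> space M \<Longrightarrow> g x y = (\<Sum>m\<in>{1..N}. gm m x y)"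
  using c_in[of x] by (simp add: gm_def)

text \<open>Here \<open>g\<close> is viewed as \<open>f\<close> plus the negative of the difference
  kernel \<open>d\<close>.\<close>

lemma \<kappa>_perturb:
  assumes t: "0 < t" shows "\<bar>g.\<kappa> - \<kappa>\<bar> \<le> t * \<kappa> + (1 + 1 / t) * d.\<kappa>"
  using abs_integral_sq_add_le[of "\<lambda>z. f (fst z) (snd z)" "M \<Otimes>\<^sub>M M" "\<lambda>z. g (fst z) (snd z) - f (fst z) (snd z)" t] t
    f_meas g.f_meas f_L2 d.f_L2
  by (simp add: g.\<kappa>_def \<kappa>_def d.\<kappa>_def power2_commute[of "g _ _"])

end

section \<open>U-statistics of an i.i.d. sample\<close>

locale block_sample = block_kernel H f c N L for H :: "'s measure" and f c N L +
  fixes P :: "'w measure" and S :: "'s measure" and Z :: "nat \<Rightarrow> 'w \<Rightarrow> 's" and n :: nat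
  assumes P: "prob_space P" and n: "2 \<le> n"
    and Z_indep: "prob_space.indep_vars P (\<lambda>_. S) Z {0..<n}"
    and Z_distr: "\<And>r. r < n \<Longrightarrow> distr P S (Z r) = H"
begin

sublocale P: prob_space P by (rule P)

abbreviation "NN \<equiv> {0..<n}"

lemma NN: "finite NN" "NN \<noteq> {}" "card NN = n" using n by auto

lemma Z_meas[measurable]: "r \<in> NN \<Longrightarrow> Z r \<in> measurable P S"
  using Z_indep by (auto simp: P.indep_vars_def)

lemma sets_H: "sets H = sets S" using Z_distr[of 0] n sets_distr[of P S "Z 0"] by auto

lemma space_H: "space H = space S" using sets_eq_imp_space_eq[OF sets_H] .

lemma Z_meas_H: "r \<in> NN \<Longrightarrow> Z r \<in> measurable P H"
  using Z_meas measurable_cong_sets[OF refl sets_H] by blast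

lemma Z_space: "r \<in> NN \<Longrightarrow> \<omega> \<in> space P \<Longrightarrow> Z r \<omega> \<in> space H"
  using measurable_space[OF Z_meas_H] .

abbreviation "esum u J \<omega> \<equiv> (\<Sum>e\<in>pairs J. u (Z (fst e) \<omega>) (Z (snd e) \<omega>))"

lemma
  assumes F: "F \<in> borel_measurable (iid H NN)"
  shows integral_sample: "(\<integral>\<omega>. F (\<lambda>r\<in>NN. Z r \<omega>) \<partial>P) = (\<integral>w. F w \<partial>iid H NN)"
    and integrable_sample: "integrable (iid H NN) F \<Longrightarrow> integrable P (\<lambda>\<omega>. F (\<lambda>r\<in>NN. Z r \<omega>) :: real)"
proof -
  have s: "sets (PiM NN (\<lambda>_. S)) = sets (iid H NN)" by (intro sets_PiM_cong) (auto simp: sets_H)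
  have F': "F \<in> borel_measurable (PiM NN (\<lambda>_. S))" using F measurable_cong_sets[OF s refl] by blast
  show "(\<integral>\<omega>. F (\<lambda>r\<in>NN. Z r \<omega>) \<partial>P) = (\<integral>w. F w \<partial>iid H NN)"
    by (rule P.integral_iid[OF Z_indep NN(2) Z_distr F']) simp
  show "integrable P (\<lambda>\<omega>. F (\<lambda>r\<in>NN. Z r \<omega>))" if "integrable (iid H NN) F"
    by (rule P.integrable_iid[OF Z_indep NN(2) Z_distr F' that]) simp
qed

lemma esum_restrict: "(\<Sum>e\<in>pairs J. u ((\<lambda>r\<in>J. Z r \<omega>) (fst e)) ((\<lambda>r\<in>J. Z r \<omega>) (snd e))) = esum u J \<omega>"
  by (intro sum.cong refl) (simp add: mem_pairs)

lemma sample_variance: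
  assumes "kernel H u"
  shows "(\<lambda>\<omega>. esum u NN \<omega>) \<in> borel_measurable P"
    "integrable P (\<lambda>\<omega>. (esum u NN \<omega> - real (card (pairs NN)) * kernel.\<theta> H u)\<^sup>2)"
    "(\<integral>\<omega>. (esum u NN \<omega> - real (card (pairs NN)) * kernel.\<theta> H u)\<^sup>2 \<partial>P) \<le> 4 * real n ^ 3 * kernel.\<beta> H u + 2 * (real n)\<^sup>2 * kernel.\<kappa> H u"
    "(\<integral>\<omega>. esum u NN \<omega> \<partial>P) = real (card (pairs NN)) * kernel.\<theta> H u"
    "integrable P (\<lambda>\<omega>. esum u NN \<omega>)"
proof -
  interpret u: kernel H u by fact
  let ?F = "\<lambda>w. (\<Sum>e\<in>pairs NN. u (w (fst e)) (w (snd e)))"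
  have m: "?F \<in> borel_measurable (iid H NN)" by (intro borel_measurable_sum u.edge_L2(4) NN)
  have i: "integrable (iid H NN) ?F" by (intro Bochner_Integration.integrable_sum u.edge_int NN)
  have c: "(\<Sum>e\<in>pairs NN. u (w (fst e)) (w (snd e)) - u.\<theta>) = ?F w - real (card (pairs NN)) * u.\<theta>" for w
    by (simp add: sum_subtractf)
  have m2: "(\<lambda>w. (?F w - real (card (pairs NN)) * u.\<theta>)\<^sup>2) \<in> borel_measurable (iid H NN)" using m by measurable
  note v = u.variance_le[OF NN(1), unfolded c NN(3)]
  show "integrable P (\<lambda>\<omega>. (esum u NN \<omega> - real (card (pairs NN)) * u.\<theta>)\<^sup>2)"
    using integrable_sample[OF m2 v(1)] unfolding esum_restrict .
  show "(\<integral>\<omega>. (esum u NN \<omega> - real (card (pairs NN)) * u.\<theta>)\<^sup>2 \<partial>P) \<le> 4 * real n ^ 3 * u.\<beta> + 2 * (real n)\<^sup>2 * u.\<kappa>"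
    using integral_sample[OF m2] v(2) unfolding esum_restrict by simp
  show int: "integrable P (\<lambda>\<omega>. esum u NN \<omega>)" using integrable_sample[OF m i] unfolding esum_restrict .
  then show "(\<lambda>\<omega>. esum u NN \<omega>) \<in> borel_measurable P" by simp
  show "(\<integral>\<omega>. esum u NN \<omega> \<partial>P) = real (card (pairs NN)) * u.\<theta>"
    using integral_sample[OF m] u.edge_int[OF NN(1)] u.edge_L2(3)[OF NN(1)] unfolding esum_restrict by simp
qed

end

section \<open>Conditional law given the cell indices\<close>

context block_sample
begin

definition "cells \<omega> = map (\<lambda>r. c (Z r \<omega>)) [0..<n]"
definition "J i m = {r \<in> NN. i ! r = m}" for i :: "nat list"
abbreviation "atom i \<equiv> {\<omega> \<in> space P. cells \<omega> = i}"
abbreviation "cond i \<equiv> uniform_measure P (atom i)"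

lemma cells_nth: "r \<in> NN \<Longrightarrow> cells \<omega> ! r = c (Z r \<omega>)" by (simp add: cells_def)

lemma length_cells: "length (cells \<omega>) = n" by (simp add: cells_def)

lemma cells_eq_iff:
  assumes "length i = n" shows "cells \<omega> = i \<longleftrightarrow> (\<forall>r\<in>NN. c (Z r \<omega>) = i ! r)"
proof -
  have "cells \<omega> = i \<longleftrightarrow> (\<forall>r<n. cells \<omega> ! r = i ! r)"
    unfolding list_eq_iff_nth_eq[of "cells \<omega>" i] length_cells assms by simp
  then show ?thesis using cells_nth[of _ \<omega>] by (metis atLeastLessThan_iff le0)
qed

lemma atom_eq:
  assumes "length i = n"
  shows "atom i = {\<omega> \<in> space P. \<forall>r\<in>NN. Z r \<omega> \<in> B (i ! r)}"
  using Z_space by (auto simp: cells_eq_iff[OF assms] B_def)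

lemma atom_sets: "atom i \<in> P.events"
proof (cases "length i = n")
  case True
  have "{\<omega> \<in> space P. \<forall>r\<in>NN. Z r \<omega> \<in> B (i ! r)} = (\<Inter>r\<in>NN. Z r -` B (i ! r) \<inter> space P)" using NN by auto
  also have "\<dots> \<in> P.events"
    using NN by (intro sets.finite_INT measurable_sets[OF Z_meas_H] B_meas) auto
  finally show ?thesis unfolding atom_eq[OF True] .
next
  case False
  then have empty: "atom i = {}" using length_cells by auto
  show ?thesis unfolding empty by simp
qed

lemma finite_cells: "finite (cells ` space P)"
proof (rule finite_subset)
  show "cells ` space P \<subseteq> {xs. set xs \<subseteq> {1..N} \<and> length xs = n}"
    using c_in[OF Z_space] by (force simp: cells_def)
  show "finite {xs. set xs \<subseteq> {1..N} \<and> length xs = n}" by (rule finite_lists_length_eq) simp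
qed

text \<open>The index vector takes finitely many values, so every event expressed through it is a
  finite union of atoms; this covers conditions on the conditional law itself.\<close>

lemma cells_pred_sets: "{\<omega> \<in> space P. \<Phi> (cells \<omega>)} \<in> P.events"
proof -
  have "{\<omega> \<in> space P. \<Phi> (cells \<omega>)} = (\<Union>i\<in>{i \<in> cells ` space P. \<Phi> i}. atom i)" by auto
  also have "\<dots> \<in> P.events" using finite_cells by (intro sets.finite_UN atom_sets) auto
  finally show ?thesis .
qed

lemma esum_gm:
  assumes "\<omega> \<in> space P" "cells \<omega> = i"
  shows "esum (gm m) NN \<omega> = esum (gm m) (J i m) \<omega>"
proof (rule sum.mono_neutral_right)
  show "\<forall>e\<in>pairs NN - pairs (J i m). gm m (Z (fst e) \<omega>) (Z (snd e) \<omega>) = 0"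
    using assms(2) by (auto simp: mem_pairs J_def gm_eq cells_nth)
qed (auto simp: mem_pairs J_def)

lemma esum_g: "\<omega> \<in> space P \<Longrightarrow> esum g NN \<omega> = (\<Sum>m\<in>{1..N}. esum (gm m) NN \<omega>)"
proof -
  assume \<omega>: "\<omega> \<in> space P"
  have "esum g NN \<omega> = (\<Sum>e\<in>pairs NN. \<Sum>m\<in>{1..N}. gm m (Z (fst e) \<omega>) (Z (snd e) \<omega>))"
    using Z_space[OF _ \<omega>] by (intro sum.cong refl g_eq_sum_gm) (auto simp: mem_pairs)
  also have "\<dots> = (\<Sum>m\<in>{1..N}. esum (gm m) NN \<omega>)" by (rule sum.swap)
  finally show ?thesis .
qed

lemma esum_A:
  assumes "\<omega> \<in> space P" "cells \<omega> = i"
  shows "esum A NN \<omega> = (\<Sum>m\<in>{1..N}. real (card (pairs (J i m))) * \<rho> m)"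
proof -
  have "esum A NN \<omega> = (\<Sum>e\<in>pairs NN. \<Sum>m\<in>{1..N}. if e \<in> pairs (J i m) then \<rho> m else 0)"
  proof (rule sum.cong[OF refl])
    fix e assume e: "e \<in> pairs NN"
    then have e': "fst e \<in> NN" "snd e \<in> NN" "fst e \<noteq> snd e" by (auto simp: mem_pairs)
    have i: "i ! fst e = c (Z (fst e) \<omega>)" "i ! snd e = c (Z (snd e) \<omega>)" using e' assms(2) cells_nth by auto
    have "(\<Sum>m\<in>{1..N}. if e \<in> pairs (J i m) then \<rho> m else 0)
        = (\<Sum>m\<in>{1..N}. if m = c (Z (fst e) \<omega>) then A (Z (fst e) \<omega>) (Z (snd e) \<omega>) else 0)"
      using e' i by (intro sum.cong refl) (auto simp: mem_pairs J_def A_def)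
    then show "A (Z (fst e) \<omega>) (Z (snd e) \<omega>) = (\<Sum>m\<in>{1..N}. if e \<in> pairs (J i m) then \<rho> m else 0)"
      using c_in[OF Z_space[OF e'(1) assms(1)]] by simp
  qed
  also have "\<dots> = (\<Sum>m\<in>{1..N}. \<Sum>e\<in>pairs NN. if e \<in> pairs (J i m) then \<rho> m else 0)" by (rule sum.swap)
  also have "\<dots> = (\<Sum>m\<in>{1..N}. real (card (pairs (J i m))) * \<rho> m)"
  proof (rule sum.cong[OF refl])
    fix m
    have "pairs NN \<inter> {e. e \<in> pairs (J i m)} = pairs (J i m)" by (auto simp: mem_pairs J_def)
    then show "(\<Sum>e\<in>pairs NN. if e \<in> pairs (J i m) then \<rho> m else 0) = real (card (pairs (J i m))) * \<rho> m"
      by (simp add: sum.If_cases)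
  qed
  finally show ?thesis .
qed

context
  fixes i :: "nat list"
  assumes i: "P.prob (atom i) \<noteq> 0"
begin

lemma i_length: "length i = n"
proof (rule ccontr)
  assume "length i \<noteq> n"
  then have empty: "atom i = {}" using length_cells by auto
  show False using i unfolding empty by simp
qed

lemma
  shows cond_prob: "prob_space (cond i)"
    and cond_indep: "prob_space.indep_vars (cond i) (\<lambda>_. S) Z NN"
    and cond_distr: "\<And>r. r \<in> NN \<Longrightarrow> distr (cond i) S (Z r) = uniform_measure H (B (i ! r))"
proof -
  have B: "B (i ! r) \<in> sets S" for r using B_meas sets_H by blast
  note c = P.indep_vars_uniform_measure[OF Z_indep NN(1,2) B atom_eq[OF i_length] i]
  show "prob_space (cond i)" "prob_space.indep_vars (cond i) (\<lambda>_. S) Z NN" by (rule c)+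
  show "distr (cond i) S (Z r) = uniform_measure H (B (i ! r))" if "r \<in> NN" for r
    using c(3)[OF that] Z_distr[of r] that by simp
qed

interpretation Q: prob_space "cond i" by (rule cond_prob)

lemma J_indep: "Q.indep_vars (\<lambda>_. S) Z (J i m)"
  by (rule Q.indep_vars_subset[OF cond_indep]) (auto simp: J_def)

lemma J_distr: "r \<in> J i m \<Longrightarrow> distr (cond i) S (Z r) = uniform_measure H (B m)"
  using cond_distr by (auto simp: J_def)

text \<open>Given the indices, the observations of cell \<open>m\<close> are i.i.d. from the law
  conditioned on that cell, under which the block kernel is degenerate; the general second moment
  formula then applies with \<rho>.\<close>

lemma J_moments:
  assumes m: "m \<in> {1..N}"
  shows "(\<integral>\<omega>. esum (gm m) (J i m) \<omega> \<partial>cond i) = 0"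
    "(\<integral>\<omega>. (esum (gm m) (J i m) \<omega>)\<^sup>2 \<partial>cond i) = 2 * real (card (pairs (J i m))) * \<rho> m"
    "integrable (cond i) (\<lambda>\<omega>. esum (gm m) (J i m) \<omega> ^ 4)"
proof -
  have fin: "finite (J i m)" by (simp add: J_def)
  interpret U: degenerate_kernel "uniform_measure H (B m)" "gm m" "4 * L" by (rule gm_uniform[OF m])
  have "(\<integral>\<omega>. esum (gm m) (J i m) \<omega> \<partial>cond i) = 0 \<and>
    (\<integral>\<omega>. (esum (gm m) (J i m) \<omega>)\<^sup>2 \<partial>cond i) = 2 * real (card (pairs (J i m))) * \<rho> m \<and>
    integrable (cond i) (\<lambda>\<omega>. esum (gm m) (J i m) \<omega> ^ 4)"
  \<comment> \<open>The transfer to a product measure asks for a nonempty index set; an empty cell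
    has the zero sum.\<close>
  proof (cases "J i m = {}")
    case True
    then show ?thesis by (simp add: pairs_def)
  next
    case False
    let ?F = "\<lambda>w. (\<Sum>e\<in>pairs (J i m). gm m (w (fst e)) (w (snd e)))"
    have s: "sets (PiM (J i m) (\<lambda>_. S)) = sets (iid (uniform_measure H (B m)) (J i m))"
      by (intro sets_PiM_cong) (auto simp: sets_H)
    have "?F \<in> borel_measurable (iid (uniform_measure H (B m)) (J i m))" by (intro borel_measurable_sum U.edge_L2(4) fin)
    then have F: "?F \<in> borel_measurable (PiM (J i m) (\<lambda>_. S))" using measurable_cong_sets[OF s refl] by blast
    have F2: "(\<lambda>w. (?F w)\<^sup>2) \<in> borel_measurable (PiM (J i m) (\<lambda>_. S))"
      and F4: "(\<lambda>w. (?F w)^4) \<in> borel_measurable (PiM (J i m) (\<lambda>_. S))" using F by measurable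
    note t = Q.integral_iid[OF J_indep False J_distr] Q.integrable_iid[OF J_indep False J_distr]
    have "(\<integral>w. ?F w \<partial>iid (uniform_measure H (B m)) (J i m)) = 0"
      using U.edge_int[OF fin] U.edge_L2(3)[OF fin] U.\<theta>_0 by simp
    then have 1: "(\<integral>\<omega>. esum (gm m) (J i m) \<omega> \<partial>cond i) = 0"
      using t(1)[of m ?F] F unfolding esum_restrict by simp
    have "(\<integral>w. (?F w)\<^sup>2 \<partial>iid (uniform_measure H (B m)) (J i m)) = 2 * real (card (pairs (J i m))) * \<rho> m"
      using U.second_moment[OF fin] gm_uniform(2)[OF m] by simp
    then have 2: "(\<integral>\<omega>. (esum (gm m) (J i m) \<omega>)\<^sup>2 \<partial>cond i) = 2 * real (card (pairs (J i m))) * \<rho> m"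
      using t(1)[of m "\<lambda>w. (?F w)\<^sup>2"] F2 unfolding esum_restrict by simp
    \<comment> \<open>Only integrability is wanted here, so the whole space serves as support. The
      size of the fourth moments is estimated for the unconditioned sample in
      \<open>T4_moment\<close>.\<close>
    have "integrable (iid (uniform_measure H (B m)) (J i m)) (\<lambda>w. ?F w ^ 4)"
      by (rule U.fourth_moment_le(1)[OF fin, of "space H"]) auto
    then have 3: "integrable (cond i) (\<lambda>\<omega>. esum (gm m) (J i m) \<omega> ^ 4)"
      using t(2)[of m "\<lambda>w. (?F w)^4"] F4 unfolding esum_restrict by simp
    show ?thesis using 1 2 3 by blast
  qed
  then show "(\<integral>\<omega>. esum (gm m) (J i m) \<omega> \<partial>cond i) = 0"
    "(\<integral>\<omega>. (esum (gm m) (J i m) \<omega>)\<^sup>2 \<partial>cond i) = 2 * real (card (pairs (J i m))) * \<rho> m"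
    "integrable (cond i) (\<lambda>\<omega>. esum (gm m) (J i m) \<omega> ^ 4)" by auto
qed

text \<open>The blocks are functions of disjoint groups of conditionally independent
  observations.\<close>

lemma blocks_indep: "Q.indep_vars (\<lambda>_. borel) (\<lambda>m \<omega>. esum (gm m) (J i m) \<omega> / s) {1..N}"
proof -
  let ?F = "\<lambda>m w. (\<Sum>e\<in>pairs (J i m). gm m (w (fst e)) (w (snd e))) / s"
  have "Q.indep_vars (\<lambda>m. PiM (J i m) (\<lambda>_. S)) (\<lambda>m \<omega>. restrict (\<lambda>r. Z r \<omega>) (J i m)) {1..N}"
    by (rule Q.indep_vars_restrict[OF cond_indep]) (auto simp: J_def disjoint_family_on_def)
  moreover have "?F m \<in> borel_measurable (PiM (J i m) (\<lambda>_. S))" for m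
  proof -
    have s: "sets (PiM (J i m) (\<lambda>_. S)) = sets (iid H (J i m))" by (intro sets_PiM_cong) (auto simp: sets_H)
    have fin: "finite (J i m)" by (simp add: J_def)
    have "(\<lambda>w. \<Sum>e\<in>pairs (J i m). gm m (w (fst e)) (w (snd e))) \<in> borel_measurable (iid H (J i m))"
      by (rule borel_measurable_sum) (rule gm.edge_L2(4)[OF fin])
    then have "?F m \<in> borel_measurable (iid H (J i m))" by measurable
    then show ?thesis using measurable_cong_sets[OF s refl] by blast
  qed
  ultimately have "Q.indep_vars (\<lambda>_. borel) (\<lambda>m \<omega>. ?F m (restrict (\<lambda>r. Z r \<omega>) (J i m))) {1..N}"
    by (rule Q.indep_vars_compose2)
  then show ?thesis unfolding esum_restrict .
qed

end

end

section \<open>From conditional moments to a bound in probability\<close>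

context block_sample
begin

abbreviation "E\<^sub>f \<equiv> real (card (pairs NN)) * \<theta>"
definition "Vf = (\<integral>\<omega>. (esum f NN \<omega> - E\<^sub>f)\<^sup>2 \<partial>P)"
text \<open>The sums run over all indices, so the function does not depend on the atom and its
  unconditional mean can be bounded. On an atom each summand agrees with the block sum by
  \<open>esum_gm\<close>.\<close>

definition "T4 \<omega> = (\<Sum>m\<in>{1..N}. esum (gm m) NN \<omega> ^ 4)"

lemma d_\<theta>: "d.\<theta> = \<theta>"
  using f_int g.f_int g.\<theta>_0 by (simp add: d.\<theta>_def \<theta>_def g.\<theta>_def)

lemma esum_d: "esum (\<lambda>x y. f x y - g x y) NN \<omega> = esum f NN \<omega> - esum g NN \<omega>"
  by (simp add: sum_subtractf)

lemma kernels: "kernel H f" "kernel H g" "kernel H A" "kernel H (\<lambda>x y. f x y - g x y)"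
  by (rule kernel_axioms g.kernel_axioms A.kernel_axioms d.kernel_axioms)+

text \<open>This is the centred U-statistic of \<open>f - g\<close>: the mean is \<theta> because
  \<open>g\<close> has mean 0, and the coefficient of the cubic term is \<beta> by
  \<open>d_\<beta>\<close>.\<close>

lemma remainder:
  "integrable P (\<lambda>\<omega>. (esum f NN \<omega> - E\<^sub>f - esum g NN \<omega>)\<^sup>2)"
  "(\<integral>\<omega>. (esum f NN \<omega> - E\<^sub>f - esum g NN \<omega>)\<^sup>2 \<partial>P) \<le> 4 * real n ^ 3 * \<beta> + 2 * (real n)\<^sup>2 * d.\<kappa>"
  using sample_variance(2,3)[OF kernels(4)] unfolding esum_d d_\<theta> d_\<beta> by (simp_all add: algebra_simps)

lemma esum_g_second_moment: "(\<integral>\<omega>. (esum g NN \<omega>)\<^sup>2 \<partial>P) = 2 * real (card (pairs NN)) * g.\<kappa>"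
proof -
  let ?F = "\<lambda>w. (\<Sum>e\<in>pairs NN. g (w (fst e)) (w (snd e)))\<^sup>2"
  have "(\<lambda>w. \<Sum>e\<in>pairs NN. g (w (fst e)) (w (snd e))) \<in> borel_measurable (iid H NN)"
    by (intro borel_measurable_sum g.edge_L2(4) NN)
  then have m: "?F \<in> borel_measurable (iid H NN)" by measurable
  show ?thesis using integral_sample[OF m] g.second_moment[OF NN(1)] unfolding esum_restrict by simp
qed

lemma T4_moment:
  "integrable P T4"
  "(\<integral>\<omega>. T4 \<omega> \<partial>P) \<le> (\<Sum>m\<in>{1..N}. 4 ^ 4 * real n ^ 2 * ((4 * L)\<^sup>2 * gm.\<kappa> m)
     + 9 ^ 4 * real n ^ 3 * ((4 * L)\<^sup>2 * p m * gm.\<kappa> m) + 16 ^ 4 * real n ^ 4 * (gm.\<kappa> m)\<^sup>2)"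
proof -
  have one: "integrable P (\<lambda>\<omega>. esum (gm m) NN \<omega> ^ 4) \<and>
    (\<integral>\<omega>. esum (gm m) NN \<omega> ^ 4 \<partial>P) \<le> 4 ^ 4 * real n ^ 2 * ((4 * L)\<^sup>2 * gm.\<kappa> m)
     + 9 ^ 4 * real n ^ 3 * ((4 * L)\<^sup>2 * p m * gm.\<kappa> m) + 16 ^ 4 * real n ^ 4 * (gm.\<kappa> m)\<^sup>2" for m
  proof -
    let ?F = "\<lambda>w. (\<Sum>e\<in>pairs NN. gm m (w (fst e)) (w (snd e))) ^ 4"
    have "(\<lambda>w. \<Sum>e\<in>pairs NN. gm m (w (fst e)) (w (snd e))) \<in> borel_measurable (iid H NN)"
      by (intro borel_measurable_sum gm.edge_L2(4) NN)
    then have m: "?F \<in> borel_measurable (iid H NN)" by measurable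
    note f4 = gm.fourth_moment_le[OF NN(1) B_meas[of m] gm_supp, unfolded NN(3) p_def[symmetric]]
    show ?thesis using integral_sample[OF m] integrable_sample[OF m] f4 unfolding esum_restrict by simp
  qed
  show "integrable P T4" unfolding T4_def[abs_def] using one by (intro Bochner_Integration.integrable_sum) auto
  show "(\<integral>\<omega>. T4 \<omega> \<partial>P) \<le> (\<Sum>m\<in>{1..N}. 4 ^ 4 * real n ^ 2 * ((4 * L)\<^sup>2 * gm.\<kappa> m)
     + 9 ^ 4 * real n ^ 3 * ((4 * L)\<^sup>2 * p m * gm.\<kappa> m) + 16 ^ 4 * real n ^ 4 * (gm.\<kappa> m)\<^sup>2)"
    unfolding T4_def[abs_def] using one by (subst Bochner_Integration.integral_sum) (auto intro!: sum_mono)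
qed

lemma variance_perturb:
  assumes t: "0 < t"
  shows "\<bar>Vf - 2 * real (card (pairs NN)) * g.\<kappa>\<bar>
    \<le> t * (2 * real (card (pairs NN)) * g.\<kappa>) + (1 + 1 / t) * (4 * real n ^ 3 * \<beta> + 2 * (real n)\<^sup>2 * d.\<kappa>)"
proof -
  note mf = sample_variance(1)[OF kernels(1)] and mg = sample_variance(1)[OF kernels(2)]
  have ig: "integrable P (\<lambda>\<omega>. (esum g NN \<omega>)\<^sup>2)" using sample_variance(2)[OF kernels(2)] by (simp add: g.\<theta>_0)
  have mb: "(\<lambda>\<omega>. esum f NN \<omega> - E\<^sub>f - esum g NN \<omega>) \<in> borel_measurable P" using mf mg by measurable
  have "\<bar>Vf - 2 * real (card (pairs NN)) * g.\<kappa>\<bar>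
     \<le> t * (2 * real (card (pairs NN)) * g.\<kappa>) + (1 + 1 / t) * (\<integral>\<omega>. (esum f NN \<omega> - E\<^sub>f - esum g NN \<omega>)\<^sup>2 \<partial>P)"
    using abs_integral_sq_add_le[OF mg mb ig remainder(1) t] by (simp add: esum_g_second_moment Vf_def)
  also have "\<dots> \<le> t * (2 * real (card (pairs NN)) * g.\<kappa>) + (1 + 1 / t) * (4 * real n ^ 3 * \<beta> + 2 * (real n)\<^sup>2 * d.\<kappa>)"
    using t remainder(2) by (intro add_left_mono mult_left_mono) auto
  finally show ?thesis .
qed

text \<open>The deterministic half of the argument: on a fixed atom of positive probability,
  closeness of the conditional variance to 1 and smallness of the conditional remainder and Lyapunov
  sum are exactly the premises of the threshold.\<close>

lemma conditional_bl_dist_le: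
  fixes \<delta> \<epsilon> :: real
  assumes clt: "clt_threshold TYPE('w) \<epsilon> \<delta>"
    and s: "s = sqrt Vf" "0 < Vf"
    and \<omega>: "\<omega> \<in> space P" "i = cells \<omega>" "P.prob (atom i) \<noteq> 0"
    and v: "\<bar>2 * esum A NN \<omega> / Vf - 1\<bar> \<le> \<delta>"
    and r: "(\<integral>x. ((esum f NN x - E\<^sub>f - esum g NN x) / s)\<^sup>2 \<partial>cond i) \<le> \<delta>"
    and t4: "(\<integral>x. T4 x / s ^ 4 \<partial>cond i) \<le> \<delta>"
  shows "bl_dist (distr (cond i) borel (\<lambda>x. (esum f NN x - E\<^sub>f) / s)) std_normal_distribution \<le> \<epsilon>"
proof -
  interpret Q: prob_space "cond i" by (rule cond_prob[OF \<omega>(3)])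
  have s2: "s\<^sup>2 = Vf" "0 < s" using s by auto
  note [measurable] = sample_variance(1)[OF kernels(1)] sample_variance(1)[OF kernels(2)] sample_variance(1)[OF gm.kernel_axioms]
  let ?\<xi> = "\<lambda>m x. esum (gm m) (J i m) x / s"
  \<comment> \<open>Defined as the full difference, so that block sums plus \<open>?R\<close> equal
    the standardised statistic everywhere. Only on the atom does it coincide with the remainder in
    terms of \<open>g\<close>, which suffices for integrals under the conditional law.\<close>
  let ?R = "\<lambda>x. (esum f NN x - E\<^sub>f) / s - (\<Sum>m\<in>{1..N}. ?\<xi> m x)"
  have aeI: "AE x in cond i. \<Phi> x" if "\<And>x. x \<in> space P \<Longrightarrow> cells x = i \<Longrightarrow> \<Phi> x" for \<Phi>
    by (rule AE_uniform_measureI[OF atom_sets]) (use that in auto)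
  have \<xi>: "?\<xi> m x = esum (gm m) NN x / s" if "x \<in> space P" "cells x = i" for m x
    using esum_gm[OF that] by simp
  have \<xi>m: "?\<xi> m \<in> borel_measurable (cond i)" if "m \<in> {1..N}" for m
    using blocks_indep[OF \<omega>(3), of s] that by (auto simp: Q.indep_vars_def)
  have \<xi>sum: "(\<Sum>m\<in>{1..N}. ?\<xi> m x) = esum g NN x / s" if "x \<in> space P" "cells x = i" for x
  proof -
    have "(\<Sum>m\<in>{1..N}. ?\<xi> m x) = (\<Sum>m\<in>{1..N}. esum (gm m) NN x / s)" by (intro sum.cong refl \<xi> that)
    also have "\<dots> = esum g NN x / s" unfolding esum_g[OF that(1)] by (rule sum_divide_distrib[symmetric])
    finally show ?thesis .
  qed
  have Rm: "?R \<in> borel_measurable (cond i)"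
  proof (rule borel_measurable_diff)
    show "(\<lambda>x. \<Sum>m\<in>{1..N}. ?\<xi> m x) \<in> borel_measurable (cond i)" by (intro borel_measurable_sum \<xi>m)
    show "(\<lambda>x. (esum f NN x - E\<^sub>f) / s) \<in> borel_measurable (cond i)" by measurable
  qed
  let ?R' = "\<lambda>x. ((esum f NN x - E\<^sub>f - esum g NN x) / s)\<^sup>2"
  have R'm: "?R' \<in> borel_measurable P" by measurable
  have R': "AE x in cond i. ?R' x = (?R x)\<^sup>2"
    by (rule aeI) (simp only: \<xi>sum diff_divide_distrib)
  have R'i: "integrable (cond i) ?R'"
    by (rule P.integrable_uniform_measure[OF atom_sets \<omega>(3) R'm]) (use remainder(1) in \<open>simp add: power_divide\<close>)
  have Rsq: "(\<lambda>x. (?R x)\<^sup>2) \<in> borel_measurable (cond i)" using Rm by measurable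
  have R'm': "?R' \<in> borel_measurable (cond i)" using R'm by simp
  have Ri: "integrable (cond i) (\<lambda>x. (?R x)\<^sup>2)"
    using R'i integrable_cong_AE[OF R'm' Rsq R'] by simp
  have Re: "(\<integral>x. (?R x)\<^sup>2 \<partial>cond i) \<le> \<delta>"
    using r integral_cong_AE[OF R'm' Rsq R'] by simp
  have second: "(\<integral>x. (?\<xi> m x)\<^sup>2 \<partial>cond i) = 2 * (real (card (pairs (J i m))) * \<rho> m) / Vf" if "m \<in> {1..N}" for m
    using J_moments(2)[OF \<omega>(3) that] by (simp add: power_divide s2)
  have "(\<Sum>m\<in>{1..N}. \<integral>x. (?\<xi> m x)\<^sup>2 \<partial>cond i) = (\<Sum>m\<in>{1..N}. 2 * (real (card (pairs (J i m))) * \<rho> m) / Vf)"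
    by (intro sum.cong refl second)
  also have "\<dots> = 2 * esum A NN \<omega> / Vf"
    unfolding esum_A[OF \<omega>(1) \<omega>(2)[symmetric]] by (simp only: sum_divide_distrib sum_distrib_left)
  finally have V: "\<bar>(\<Sum>m\<in>{1..N}. \<integral>x. (?\<xi> m x)\<^sup>2 \<partial>cond i) - 1\<bar> \<le> \<delta>" using v by simp
  have \<xi>4: "integrable (cond i) (\<lambda>x. ?\<xi> m x ^ 4)" if "m \<in> {1..N}" for m
    using J_moments(3)[OF \<omega>(3) that] by (simp add: power_divide)
  have "(\<Sum>m\<in>{1..N}. \<integral>x. ?\<xi> m x ^ 4 \<partial>cond i) = (\<integral>x. (\<Sum>m\<in>{1..N}. ?\<xi> m x ^ 4) \<partial>cond i)"
    by (intro Bochner_Integration.integral_sum[symmetric] \<xi>4)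
  also have "\<dots> = (\<integral>x. T4 x / s ^ 4 \<partial>cond i)"
  proof (rule integral_cong_AE)
    show "(\<lambda>x. \<Sum>m\<in>{1..N}. ?\<xi> m x ^ 4) \<in> borel_measurable (cond i)"
      by (intro borel_measurable_sum borel_measurable_power \<xi>m)
    have "T4 \<in> borel_measurable P" using T4_moment(1) by simp
    then show "(\<lambda>x. T4 x / s ^ 4) \<in> borel_measurable (cond i)" by measurable
    show "AE x in cond i. (\<Sum>m\<in>{1..N}. ?\<xi> m x ^ 4) = T4 x / s ^ 4"
    proof (rule aeI)
      fix x assume x: "x \<in> space P" "cells x = i"
      have "(\<Sum>m\<in>{1..N}. ?\<xi> m x ^ 4) = (\<Sum>m\<in>{1..N}. (esum (gm m) NN x / s) ^ 4)"
        by (intro sum.cong refl) (simp only: \<xi>[OF x])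
      also have "\<dots> = T4 x / s ^ 4" unfolding T4_def power_divide by (rule sum_divide_distrib[symmetric])
      finally show "(\<Sum>m\<in>{1..N}. ?\<xi> m x ^ 4) = T4 x / s ^ 4" .
    qed
  qed
  finally have F4: "(\<Sum>m\<in>{1..N}. \<integral>x. ?\<xi> m x ^ 4 \<partial>cond i) \<le> \<delta>" using t4 by simp
  have "bl_dist (distr (cond i) borel (\<lambda>x. (\<Sum>m\<in>{1..N}. ?\<xi> m x) + ?R x)) std_normal_distribution \<le> \<epsilon>"
  proof (rule clt_thresholdD[OF clt Q.prob_space_axioms _ blocks_indep[OF \<omega>(3)] \<xi>4 _ V F4 Rm Ri Re])
    show "(\<integral>x. ?\<xi> m x \<partial>cond i) = 0" if "m \<in> {1..N}" for m
      using J_moments(1)[OF \<omega>(3) that] by simp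
  qed auto
  then show ?thesis by simp
qed

text \<open>The distance can exceed \<epsilon> only on four events: the conditional Markov
  inequality handles the remainder and the Lyapunov sum, Chebyshev's inequality the conditional
  variance, and the fourth event is null. The tolerance \<delta> for the variance is split evenly
  between bias and fluctuation; the factor 4 is the square of the 2 in
  \<open>2 * esum A\<close>.\<close>

theorem prob_conditional_bl_dist_gt_le:
  fixes \<delta> \<epsilon> :: real
  assumes clt: "clt_threshold TYPE('w) \<epsilon> \<delta>"
    and \<delta>: "0 < \<delta>" and V: "0 < Vf"
    and mean: "\<bar>2 * real (card (pairs NN)) * g.\<kappa> / Vf - 1\<bar> \<le> \<delta> / 2"
  shows "P.prob {\<omega> \<in> space P. bl_dist (distr (cond (cells \<omega>)) borel (\<lambda>x. (esum f NN x - E\<^sub>f) / sqrt Vf)) std_normal_distribution > \<epsilon>}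
    \<le> (4 * real n ^ 3 * \<beta> + 2 * (real n)\<^sup>2 * d.\<kappa>) / Vf / \<delta>
      + 4 * (4 * real n ^ 3 * A.\<beta> + 2 * (real n)\<^sup>2 * A.\<kappa>) / Vf\<^sup>2 / (\<delta> / 2)\<^sup>2
      + (\<integral>\<omega>. T4 \<omega> \<partial>P) / Vf\<^sup>2 / \<delta>"
proof -
  define s where "s = sqrt Vf"
  have s2: "s\<^sup>2 = Vf" "0 < s" using V by (auto simp: s_def)
  have s4: "s ^ 4 = Vf\<^sup>2" using s2 by (simp add: power4_eq_xxxx power2_eq_square)
  let ?R = "\<lambda>x. ((esum f NN x - E\<^sub>f - esum g NN x) / s)\<^sup>2"
  let ?\<psi> = "\<lambda>x. 2 * esum A NN x / Vf"
  let ?A1 = "{\<omega> \<in> space P. (\<integral>x. ?R x \<partial>cond (cells \<omega>)) > \<delta>}"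
  let ?A2 = "{\<omega> \<in> space P. \<delta> / 2 \<le> \<bar>?\<psi> \<omega> - P.expectation ?\<psi>\<bar>}"
  let ?A3 = "{\<omega> \<in> space P. (\<integral>x. T4 x / s ^ 4 \<partial>cond (cells \<omega>)) > \<delta>}"
  \<comment> \<open>On null atoms \<open>uniform_measure\<close> is not a probability measure, so
    they are discarded; being finitely many, they have total probability 0.\<close>
  let ?A4 = "{\<omega> \<in> space P. P.prob (atom (cells \<omega>)) = 0}"
  let ?bad = "{\<omega> \<in> space P. bl_dist (distr (cond (cells \<omega>)) borel (\<lambda>x. (esum f NN x - E\<^sub>f) / s)) std_normal_distribution > \<epsilon>}"
  have \<psi>m: "?\<psi> \<in> borel_measurable P" using sample_variance(1)[OF kernels(3)] by measurable
  have E\<psi>: "P.expectation ?\<psi> = 2 * real (card (pairs NN)) * g.\<kappa> / Vf"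
    using sample_variance(4)[OF kernels(3)] by (simp add: A_\<theta>)
  have sets: "?A1 \<in> P.events" "?A3 \<in> P.events" "?A4 \<in> P.events" by (rule cells_pred_sets)+
  have sets2: "?A2 \<in> P.events" using \<psi>m by measurable
  have p1: "P.prob ?A1 \<le> (4 * real n ^ 3 * \<beta> + 2 * (real n)\<^sup>2 * d.\<kappa>) / Vf / \<delta>"
  proof -
    have "P.prob ?A1 \<le> P.expectation ?R / \<delta>"
      by (rule P.prob_conditional_expectation_gt_le[OF finite_cells atom_sets _ _ \<delta>])
         (use remainder(1) in \<open>simp_all add: power_divide\<close>)
    also have "P.expectation ?R = (\<integral>\<omega>. (esum f NN \<omega> - E\<^sub>f - esum g NN \<omega>)\<^sup>2 \<partial>P) / Vf" by (simp add: power_divide s2)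
    also have "\<dots> / \<delta> \<le> (4 * real n ^ 3 * \<beta> + 2 * (real n)\<^sup>2 * d.\<kappa>) / Vf / \<delta>"
      using remainder(2) V \<delta> by (intro divide_right_mono) auto
    finally show ?thesis .
  qed
  have p3: "P.prob ?A3 \<le> (\<integral>\<omega>. T4 \<omega> \<partial>P) / Vf\<^sup>2 / \<delta>"
  proof -
    have i: "integrable P (\<lambda>x. T4 x / s ^ 4)" using T4_moment(1) by simp
    have nn: "0 \<le> T4 x / s ^ 4" for x by (simp add: T4_def sum_nonneg)
    have "P.prob ?A3 \<le> P.expectation (\<lambda>x. T4 x / s ^ 4) / \<delta>"
      by (rule P.prob_conditional_expectation_gt_le[OF finite_cells atom_sets i nn \<delta>])
    then show ?thesis by (simp add: s4)
  qed
  have p4: "P.prob ?A4 = 0"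
  proof -
    have "?A4 = (\<Union>i\<in>{i \<in> cells ` space P. P.prob (atom i) = 0}. atom i)" by auto
    also have "P.prob \<dots> \<le> (\<Sum>i\<in>{i \<in> cells ` space P. P.prob (atom i) = 0}. P.prob (atom i))"
      using finite_cells by (intro P.finite_measure_subadditive_finite) (auto intro: atom_sets)
    also have "\<dots> = 0" by simp
    finally show ?thesis by (simp add: measure_le_0_iff)
  qed
  have p2: "P.prob ?A2 \<le> 4 * (4 * real n ^ 3 * A.\<beta> + 2 * (real n)\<^sup>2 * A.\<kappa>) / Vf\<^sup>2 / (\<delta> / 2)\<^sup>2"
  proof -
    let ?E = "real (card (pairs NN)) * A.\<theta>"
    have eq: "?\<psi> \<omega> - P.expectation ?\<psi> = (2 / Vf) * (esum A NN \<omega> - ?E)" for \<omega>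
      unfolding E\<psi> A_\<theta> by (simp add: diff_divide_distrib right_diff_distrib)
    have "integrable P (\<lambda>\<omega>. (2 / Vf)\<^sup>2 * (esum A NN \<omega> - ?E)\<^sup>2)"
      using sample_variance(2)[OF kernels(3)] by simp
    then have i0: "integrable P (\<lambda>\<omega>. (?\<psi> \<omega> - P.expectation ?\<psi>)\<^sup>2)" unfolding eq power_mult_distrib .
    have i1: "integrable P ?\<psi>" using sample_variance(5)[OF kernels(3)] by simp
    define e where "e = P.expectation ?\<psi>"
    \<comment> \<open>Chebyshev's inequality asks for square integrability of the uncentred
      variable, recovered here from the centred one.\<close>
    have "integrable P (\<lambda>\<omega>. (?\<psi> \<omega> - e)\<^sup>2 + 2 * e * ?\<psi> \<omega> - e\<^sup>2)"
      using i0 i1 unfolding e_def[symmetric]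
      by (intro Bochner_Integration.integrable_diff Bochner_Integration.integrable_add integrable_mult_right) auto
    moreover have "(\<lambda>\<omega>. (?\<psi> \<omega> - e)\<^sup>2 + 2 * e * ?\<psi> \<omega> - e\<^sup>2) = (\<lambda>\<omega>. (?\<psi> \<omega>)\<^sup>2)"
    proof -
      have "(x - y)\<^sup>2 + 2 * y * x - y\<^sup>2 = x\<^sup>2" for x y :: real by (simp add: power2_eq_square algebra_simps)
      then show ?thesis by blast
    qed
    ultimately have i2: "integrable P (\<lambda>\<omega>. (?\<psi> \<omega>)\<^sup>2)" by (rule back_subst[where P="integrable P"])
    have "P.prob ?A2 \<le> P.variance ?\<psi> / (\<delta> / 2)\<^sup>2"
      by (rule P.Chebyshev_inequality[OF \<psi>m i2]) (use \<delta> in simp)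
    also have "P.variance ?\<psi> = (2 / Vf)\<^sup>2 * (\<integral>\<omega>. (esum A NN \<omega> - ?E)\<^sup>2 \<partial>P)"
      unfolding eq power_mult_distrib by simp
    also have "\<dots> / (\<delta> / 2)\<^sup>2 \<le> (2 / Vf)\<^sup>2 * (4 * real n ^ 3 * A.\<beta> + 2 * (real n)\<^sup>2 * A.\<kappa>) / (\<delta> / 2)\<^sup>2"
      using sample_variance(3)[OF kernels(3)] by (intro divide_right_mono mult_left_mono) auto
    finally show ?thesis by (simp add: power_divide)
  qed
  have "?bad \<subseteq> ?A1 \<union> ?A2 \<union> ?A3 \<union> ?A4"
  proof
    fix \<omega> assume bad: "\<omega> \<in> ?bad"
    show "\<omega> \<in> ?A1 \<union> ?A2 \<union> ?A3 \<union> ?A4"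
    proof (rule ccontr)
      assume nb: "\<omega> \<notin> ?A1 \<union> ?A2 \<union> ?A3 \<union> ?A4"
      have "\<bar>?\<psi> \<omega> - P.expectation ?\<psi>\<bar> < \<delta> / 2" using nb bad by auto
      moreover have "\<bar>x - 1\<bar> \<le> \<delta>" if "\<bar>x - y\<bar> < \<delta> / 2" "\<bar>y - 1\<bar> \<le> \<delta> / 2" for x y using that by linarith
      ultimately have v: "\<bar>?\<psi> \<omega> - 1\<bar> \<le> \<delta>" using mean unfolding E\<psi> by blast
      have "bl_dist (distr (cond (cells \<omega>)) borel (\<lambda>x. (esum f NN x - E\<^sub>f) / s)) std_normal_distribution \<le> \<epsilon>"
      proof (rule conditional_bl_dist_le[OF clt s_def V _ refl _ v])
        show "\<omega> \<in> space P" using bad by simp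
      qed (use nb bad in auto)
      then show False using bad by simp
    qed
  qed
  then have "P.prob ?bad \<le> P.prob (?A1 \<union> ?A2 \<union> ?A3 \<union> ?A4)"
    by (rule P.finite_measure_mono) (intro sets.Un sets sets2)
  also have "\<dots> \<le> P.prob ?A1 + P.prob ?A2 + P.prob ?A3 + P.prob ?A4"
    by (intro order_trans[OF measure_Un_le] add_mono sets.Un sets sets2 order_refl)
  also have "\<dots> \<le> (4 * real n ^ 3 * \<beta> + 2 * (real n)\<^sup>2 * d.\<kappa>) / Vf / \<delta>
      + 4 * (4 * real n ^ 3 * A.\<beta> + 2 * (real n)\<^sup>2 * A.\<kappa>) / Vf\<^sup>2 / (\<delta> / 2)\<^sup>2
      + (\<integral>\<omega>. T4 \<omega> \<partial>P) / Vf\<^sup>2 / \<delta>"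
    using p1 p2 p3 p4 by linarith
  finally show ?thesis by (simp add: s_def)
qed

end

section \<open>Kernels with random weights\<close>

lemma Cauchy_Schwarz_L2:
  fixes u v :: "'a \<Rightarrow> real"
  assumes m[measurable]: "u \<in> borel_measurable N" "v \<in> borel_measurable N"
    and i: "integrable N (\<lambda>x. (u x)\<^sup>2)" "integrable N (\<lambda>x. (v x)\<^sup>2)"
  shows "(\<integral>x. u x * v x \<partial>N)\<^sup>2 \<le> (\<integral>x. (u x)\<^sup>2 \<partial>N) * (\<integral>x. (v x)\<^sup>2 \<partial>N)"
proof -
  have uv: "integrable N (\<lambda>x. \<bar>u x\<bar> * \<bar>v x\<bar>)"
    using integrable_abs[OF integrable_mult_L2[OF m i]] by (simp add: abs_mult)
  have "ennreal ((\<integral>x. \<bar>u x\<bar> * \<bar>v x\<bar> \<partial>N)\<^sup>2) = (\<integral>\<^sup>+x. ennreal \<bar>u x\<bar> * ennreal \<bar>v x\<bar> \<partial>N)\<^sup>2"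
    using nn_integral_eq_integral[OF uv] by (simp add: ennreal_mult ennreal_power Bochner_Integration.integral_nonneg)
  also have "\<dots> \<le> (\<integral>\<^sup>+x. (ennreal \<bar>u x\<bar>)\<^sup>2 \<partial>N) * (\<integral>\<^sup>+x. (ennreal \<bar>v x\<bar>)\<^sup>2 \<partial>N)"
    by (rule Cauchy_Schwarz_nn_integral) measurable
  also have "\<dots> = ennreal (\<integral>x. (u x)\<^sup>2 \<partial>N) * ennreal (\<integral>x. (v x)\<^sup>2 \<partial>N)"
    using nn_integral_eq_integral[OF i(1)] nn_integral_eq_integral[OF i(2)] by (simp add: ennreal_power)
  also have "\<dots> = ennreal ((\<integral>x. (u x)\<^sup>2 \<partial>N) * (\<integral>x. (v x)\<^sup>2 \<partial>N))"
    by (rule ennreal_mult[symmetric]) auto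
  finally have "(\<integral>x. \<bar>u x\<bar> * \<bar>v x\<bar> \<partial>N)\<^sup>2 \<le> (\<integral>x. (u x)\<^sup>2 \<partial>N) * (\<integral>x. (v x)\<^sup>2 \<partial>N)"
    by (subst (asm) ennreal_le_iff) (auto intro!: mult_nonneg_nonneg)
  moreover have "\<bar>\<integral>x. u x * v x \<partial>N\<bar>\<^sup>2 \<le> (\<integral>x. \<bar>u x\<bar> * \<bar>v x\<bar> \<partial>N)\<^sup>2"
    using integral_abs_bound[of N "\<lambda>x. u x * v x"] by (intro power_mono) (auto simp: abs_mult)
  ultimately show ?thesis by simp
qed

text \<open>Holds without integrability because the Bochner integral is then 0. This permits
  Cauchy-Schwarz estimates before finiteness is known.\<close>

lemma ennreal_abs_integral_le: "ennreal \<bar>\<integral>x. u x \<partial>N\<bar> \<le> (\<integral>\<^sup>+x. ennreal \<bar>u x :: real\<bar> \<partial>N)"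
proof (cases "integrable N u")
  case True
  have "ennreal \<bar>\<integral>x. u x \<partial>N\<bar> \<le> ennreal (\<integral>x. \<bar>u x\<bar> \<partial>N)" by (intro ennreal_leI integral_abs_bound)
  also have "\<dots> = (\<integral>\<^sup>+x. ennreal \<bar>u x\<bar> \<partial>N)" using True by (intro nn_integral_eq_integral[symmetric]) auto
  finally show ?thesis .
qed (simp add: not_integrable_integral_eq)

lemma ennreal_sq_integral_le:
  fixes u v :: "'a \<Rightarrow> real"
  assumes [measurable]: "u \<in> borel_measurable N" "v \<in> borel_measurable N"
  shows "ennreal ((\<integral>x. u x * v x \<partial>N)\<^sup>2) \<le> (\<integral>\<^sup>+x. ennreal ((u x)\<^sup>2) \<partial>N) * (\<integral>\<^sup>+x. ennreal ((v x)\<^sup>2) \<partial>N)"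
proof -
  have "ennreal ((\<integral>x. u x * v x \<partial>N)\<^sup>2) = (ennreal \<bar>\<integral>x. u x * v x \<partial>N\<bar>)\<^sup>2" by (simp add: ennreal_power)
  also have "\<dots> \<le> (\<integral>\<^sup>+x. ennreal \<bar>u x * v x\<bar> \<partial>N)\<^sup>2" by (intro power_mono ennreal_abs_integral_le) auto
  also have "\<dots> = (\<integral>\<^sup>+x. ennreal \<bar>u x\<bar> * ennreal \<bar>v x\<bar> \<partial>N)\<^sup>2" by (simp add: abs_mult ennreal_mult)
  also have "\<dots> \<le> (\<integral>\<^sup>+x. (ennreal \<bar>u x\<bar>)\<^sup>2 \<partial>N) * (\<integral>\<^sup>+x. (ennreal \<bar>v x\<bar>)\<^sup>2 \<partial>N)"
    by (rule Cauchy_Schwarz_nn_integral) measurable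
  finally show ?thesis by (simp add: ennreal_power)
qed

locale design = prob_space H for H :: "('x \<times> real) measure" +
  fixes M :: "'x measure" and mu :: "real \<Rightarrow> 'x \<Rightarrow> ennreal" and C :: real
  assumes sets_H: "sets H = sets (M \<Otimes>\<^sub>M borel)"
    and mu: "\<And>q. q > 0 \<Longrightarrow> cond_moment H M q (mu q)"
    and mu2: "\<And>x. x \<in> space M \<Longrightarrow> mu 2 x \<le> ennreal C"
    and C: "0 \<le> C"
begin

definition "G = distr H M fst"

lemma space_H: "space H = space M \<times> UNIV" using sets_eq_imp_space_eq[OF sets_H] by (simp add: space_pair_measure)

lemma fst_H[measurable]: "fst \<in> measurable H M" using measurable_cong_sets[OF sets_H refl] measurable_fst by blast
lemma snd_H[measurable]: "snd \<in> borel_measurable H" using measurable_cong_sets[OF sets_H refl] measurable_snd by blast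
lemma fst_space: "z \<in> space H \<Longrightarrow> fst z \<in> space M" by (auto simp: space_H)

lemma sets_G[simp, measurable_cong]: "sets G = sets M" and space_G[simp]: "space G = space M" by (simp_all add: G_def)

sublocale G: prob_space G unfolding G_def by (rule prob_space_distr) measurable
sublocale GG: pair_prob_space G G ..
sublocale GH: pair_prob_space G H ..
sublocale HH: pair_prob_space H H ..

lemma mu_meas[measurable]: "q > 0 \<Longrightarrow> mu q \<in> borel_measurable M" using mu by (simp add: cond_moment_def)

lemma nn_G: "\<phi> \<in> borel_measurable M \<Longrightarrow> (\<integral>\<^sup>+z. \<phi> (fst z) \<partial>H) = (\<integral>\<^sup>+x. \<phi> x \<partial>G)"
  unfolding G_def by (subst nn_integral_distr) auto

lemma int_G:
  fixes \<phi> :: "'x \<Rightarrow> real"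
  shows "\<phi> \<in> borel_measurable M \<Longrightarrow> (\<integral>z. \<phi> (fst z) \<partial>H) = (\<integral>x. \<phi> x \<partial>G)"
    and "integrable G \<phi> \<Longrightarrow> integrable H (\<lambda>z. \<phi> (fst z))"
  unfolding G_def by (rule integral_distr[OF fst_H, symmetric], assumption) (rule integrable_distr[OF fst_H])

text \<open>Extends the defining property of \<open>mu q\<close> from indicators to all nonnegative
  functions, by identifying the image under \<open>fst\<close> of the measure with density |y| powr
  q as the measure with density \<open>mu q\<close>.\<close>

lemma nn_moment:
  assumes \<phi>[measurable]: "\<phi> \<in> borel_measurable M" and q: "q > 0"
  shows "(\<integral>\<^sup>+z. \<phi> (fst z) * ennreal (\<bar>snd z\<bar> powr q) \<partial>H) = (\<integral>\<^sup>+x. \<phi> x * mu q x \<partial>G)"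
proof -
  let ?w = "\<lambda>z. ennreal (\<bar>snd z\<bar> powr q)"
  have w[measurable]: "?w \<in> borel_measurable H" by measurable
  have [measurable]: "mu q \<in> borel_measurable M" by (rule mu_meas[OF q])
  have "distr (density H ?w) M fst = density G (mu q)"
  proof (rule measure_eqI)
    fix A assume "A \<in> sets (distr (density H ?w) M fst)"
    then have A[measurable]: "A \<in> sets M" by simp
    have cm: "(\<integral>\<^sup>+x\<in>A. mu q x \<partial>(distr H M fst)) = (\<integral>\<^sup>+z. indicator A (fst z) * ?w z \<partial>H)"
      using mu[OF q] A by (simp add: cond_moment_def)
    have "emeasure (distr (density H ?w) M fst) A = (\<integral>\<^sup>+z. ?w z * indicator (fst -` A \<inter> space H) z \<partial>H)"
      by (subst emeasure_distr) (auto simp: emeasure_density)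
    also have "\<dots> = (\<integral>\<^sup>+z. indicator A (fst z) * ?w z \<partial>H)"
      by (intro nn_integral_cong) (auto simp: indicator_def)
    also have "\<dots> = (\<integral>\<^sup>+x\<in>A. mu q x \<partial>G)"
      unfolding G_def by (rule cm[symmetric])
    also have "\<dots> = emeasure (density G (mu q)) A" by (simp add: emeasure_density)
    finally show "emeasure (distr (density H ?w) M fst) A = emeasure (density G (mu q)) A" .
  qed simp
  then have "(\<integral>\<^sup>+x. \<phi> x \<partial>distr (density H ?w) M fst) = (\<integral>\<^sup>+x. \<phi> x \<partial>density G (mu q))" by simp
  then show ?thesis by (simp add: nn_integral_distr nn_integral_density mult.commute)
qed

text \<open>Tonelli, with \<open>nn_moment\<close> applied to the two observations in turn.\<close>

lemma nn_moment2:
  assumes \<Phi>[measurable]: "(\<lambda>z. \<Phi> (fst z) (snd z)) \<in> borel_measurable (M \<Otimes>\<^sub>M M)" and q: "q > 0"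
  shows "(\<integral>\<^sup>+z. \<Phi> (fst (fst z)) (fst (snd z)) * ennreal (\<bar>snd (fst z)\<bar> powr q) * ennreal (\<bar>snd (snd z)\<bar> powr q) \<partial>(H \<Otimes>\<^sub>M H))
      = (\<integral>\<^sup>+z. \<Phi> (fst z) (snd z) * mu q (fst z) * mu q (snd z) \<partial>(G \<Otimes>\<^sub>M G))"
proof -
  have [measurable]: "mu q \<in> borel_measurable M" by (rule mu_meas[OF q])
  have comp: "(\<lambda>x. \<Phi> (u x) (v x)) \<in> borel_measurable N" if "u \<in> measurable N M" "v \<in> measurable N M" for u v N
    using measurable_compose[OF measurable_Pair[OF that] \<Phi>] by simp
  have [measurable]: "(\<lambda>z. \<Phi> (fst (fst z)) (fst (snd z))) \<in> borel_measurable (H \<Otimes>\<^sub>M H)" by (rule comp) measurable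
  have [measurable]: "(\<lambda>z. \<Phi> (fst z) (snd z)) \<in> borel_measurable (G \<Otimes>\<^sub>M G)" by (rule comp) measurable
  have sec: "\<Phi> x \<in> borel_measurable M" if "x \<in> space M" for x
    by (rule comp[of "\<lambda>_. x" M "\<lambda>y. y", OF measurable_const[OF that] measurable_ident_sets[OF refl]])
  have [measurable]: "(\<lambda>z. \<Phi> (fst z) (snd z)) \<in> borel_measurable (M \<Otimes>\<^sub>M G)" by (rule comp) measurable
  have Gm: "(\<lambda>z. \<Phi> (fst z) (snd z) * mu q (snd z)) \<in> borel_measurable (M \<Otimes>\<^sub>M G)"
    by measurable
  have inner: "(\<lambda>x. \<integral>\<^sup>+y. \<Phi> x y * mu q y \<partial>G) \<in> borel_measurable M"
    using G.borel_measurable_nn_integral[of "\<lambda>x y. \<Phi> x y * mu q y" M] Gm by (simp add: split_beta')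
  have "(\<integral>\<^sup>+z. \<Phi> (fst (fst z)) (fst (snd z)) * ennreal (\<bar>snd (fst z)\<bar> powr q) * ennreal (\<bar>snd (snd z)\<bar> powr q) \<partial>(H \<Otimes>\<^sub>M H))
     = (\<integral>\<^sup>+z. \<integral>\<^sup>+z'. ennreal (\<bar>snd z\<bar> powr q) * (\<Phi> (fst z) (fst z') * ennreal (\<bar>snd z'\<bar> powr q)) \<partial>H \<partial>H)"
    by (subst nn_integral_fst[symmetric]) (auto simp: mult_ac)
  also have "\<dots> = (\<integral>\<^sup>+z. (\<integral>\<^sup>+y. \<Phi> (fst z) y * mu q y \<partial>G) * ennreal (\<bar>snd z\<bar> powr q) \<partial>H)"
  proof (rule nn_integral_cong)
    fix z assume z: "z \<in> space H"
    note s[measurable] = sec[OF fst_space[OF z]]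
    have "(\<integral>\<^sup>+z'. ennreal (\<bar>snd z\<bar> powr q) * (\<Phi> (fst z) (fst z') * ennreal (\<bar>snd z'\<bar> powr q)) \<partial>H)
       = ennreal (\<bar>snd z\<bar> powr q) * (\<integral>\<^sup>+z'. \<Phi> (fst z) (fst z') * ennreal (\<bar>snd z'\<bar> powr q) \<partial>H)"
      by (rule nn_integral_cmult) measurable
    also have "(\<integral>\<^sup>+z'. \<Phi> (fst z) (fst z') * ennreal (\<bar>snd z'\<bar> powr q) \<partial>H) = (\<integral>\<^sup>+y. \<Phi> (fst z) y * mu q y \<partial>G)"
      by (rule nn_moment[OF s q])
    finally show "(\<integral>\<^sup>+z'. ennreal (\<bar>snd z\<bar> powr q) * (\<Phi> (fst z) (fst z') * ennreal (\<bar>snd z'\<bar> powr q)) \<partial>H)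
       = (\<integral>\<^sup>+y. \<Phi> (fst z) y * mu q y \<partial>G) * ennreal (\<bar>snd z\<bar> powr q)" by (simp add: mult.commute)
  qed
  also have "\<dots> = (\<integral>\<^sup>+x. (\<integral>\<^sup>+y. \<Phi> x y * mu q y \<partial>G) * mu q x \<partial>G)" by (rule nn_moment[OF inner q])
  also have "\<dots> = (\<integral>\<^sup>+x. \<integral>\<^sup>+y. \<Phi> x y * mu q x * mu q y \<partial>G \<partial>G)"
  proof (rule nn_integral_cong)
    fix x assume "x \<in> space G"
    then have [measurable]: "\<Phi> x \<in> borel_measurable G" using sec by simp
    have "(\<integral>\<^sup>+y. \<Phi> x y * mu q y \<partial>G) * mu q x = (\<integral>\<^sup>+y. \<Phi> x y * mu q y * mu q x \<partial>G)"
      by (rule nn_integral_multc[symmetric]) measurable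
    then show "(\<integral>\<^sup>+y. \<Phi> x y * mu q y \<partial>G) * mu q x = (\<integral>\<^sup>+y. \<Phi> x y * mu q x * mu q y \<partial>G)" by (simp add: mult_ac)
  qed
  also have "\<dots> = (\<integral>\<^sup>+z. \<Phi> (fst z) (snd z) * mu q (fst z) * mu q (snd z) \<partial>(G \<Otimes>\<^sub>M G))"
    by (subst G.nn_integral_fst[symmetric]) auto
  finally show ?thesis .
qed

lemma sq_powr: "(y::real)\<^sup>2 = \<bar>y\<bar> powr 2"
  by (cases "y = 0") (simp_all add: powr_numeral)

lemma nn_second:
  assumes "\<phi> \<in> borel_measurable M"
  shows "(\<integral>\<^sup>+z. \<phi> (fst z) * ennreal ((snd z)\<^sup>2) \<partial>H) \<le> ennreal C * (\<integral>\<^sup>+x. \<phi> x \<partial>G)"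
proof -
  have "(\<integral>\<^sup>+z. \<phi> (fst z) * ennreal ((snd z)\<^sup>2) \<partial>H) = (\<integral>\<^sup>+x. \<phi> x * mu 2 x \<partial>G)"
    using nn_moment[OF assms, of 2] unfolding sq_powr[symmetric] by simp
  also have "\<dots> \<le> (\<integral>\<^sup>+x. \<phi> x * ennreal C \<partial>G)"
    using mu2 by (intro nn_integral_mono mult_left_mono) auto
  also have "\<dots> = (\<integral>\<^sup>+x. \<phi> x \<partial>G) * ennreal C" using assms by (intro nn_integral_multc) auto
  finally show ?thesis by (simp add: mult.commute)
qed

end

section \<open>The linear part and the operator norm\<close>

locale design_kernel = design H M mu C for H :: "('x \<times> real) measure" and M mu C +
  fixes K :: "'x \<Rightarrow> 'x \<Rightarrow> real" and Bd :: real
  assumes K_sym: "\<And>x y. x \<in> space M \<Longrightarrow> y \<in> space M \<Longrightarrow> K x y = K y x"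
    and K_meas: "(\<lambda>z. K (fst z) (snd z)) \<in> borel_measurable (M \<Otimes>\<^sub>M M)"
    and K_L2: "(\<integral>\<^sup>+z. ennreal ((K (fst z) (snd z))\<^sup>2) \<partial>(G \<Otimes>\<^sub>M G)) < \<infinity>"
    and K_norm: "kernel_op_norm G K \<le> ennreal Bd" and Bd: "0 \<le> Bd"
begin

lemma K_comp[measurable (raw)]: "u \<in> measurable N M \<Longrightarrow> v \<in> measurable N M \<Longrightarrow> (\<lambda>x. K (u x) (v x)) \<in> borel_measurable N"
  using measurable_compose[OF measurable_Pair K_meas, of u N v] by simp

text \<open>The kernel operator applied to the product of the indicator of \<open>D\<close> with the
  regression function, written directly as an expectation over (X,Y).\<close>

definition "av D x = (\<integral>z. K x (fst z) * (snd z * indicator D (fst z)) \<partial>H)"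

lemma av_meas[measurable]:
  assumes [measurable]: "D \<in> sets M" shows "av D \<in> borel_measurable M"
  unfolding av_def[abs_def] by (rule borel_measurable_lebesgue_integral) (simp add: split_beta')

lemma second_D:
  assumes [measurable]: "D \<in> sets M"
  shows "(\<integral>\<^sup>+z. ennreal ((snd z * indicator D (fst z))\<^sup>2) \<partial>H) \<le> ennreal (C * measure G D)"
    "integrable H (\<lambda>z. (snd z * indicator D (fst z))\<^sup>2)"
    "(\<integral>z. (snd z * indicator D (fst z))\<^sup>2 \<partial>H) \<le> C * measure G D"
proof -
  have "(\<integral>\<^sup>+z. ennreal ((snd z * indicator D (fst z))\<^sup>2) \<partial>H) = (\<integral>\<^sup>+z. indicator D (fst z) * ennreal ((snd z)\<^sup>2) \<partial>H)"
    by (intro nn_integral_cong) (auto simp: indicator_def)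
  also have "\<dots> \<le> ennreal C * (\<integral>\<^sup>+x. indicator D x \<partial>G)" by (rule nn_second) measurable
  also have "\<dots> = ennreal (C * measure G D)" using C by (simp add: ennreal_mult G.emeasure_eq_measure)
  finally show 1: "(\<integral>\<^sup>+z. ennreal ((snd z * indicator D (fst z))\<^sup>2) \<partial>H) \<le> ennreal (C * measure G D)" .
  show "integrable H (\<lambda>z. (snd z * indicator D (fst z))\<^sup>2)"
    by (rule integrableI_nonneg) (use 1 in \<open>auto simp: less_top[symmetric] top_unique\<close>)
  then have "ennreal (\<integral>z. (snd z * indicator D (fst z))\<^sup>2 \<partial>H) \<le> ennreal (C * measure G D)"
    using 1 by (subst nn_integral_eq_integral[symmetric]) auto
  then show "(\<integral>z. (snd z * indicator D (fst z))\<^sup>2 \<partial>H) \<le> C * measure G D"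
    using C by (simp add: ennreal_le_iff)
qed

lemma K_GH: "integrable (G \<Otimes>\<^sub>M H) (\<lambda>z. (K (fst z) (fst (snd z)))\<^sup>2)"
proof (rule integrableI_nonneg)
  have "(\<integral>\<^sup>+z. ennreal ((K (fst z) (fst (snd z)))\<^sup>2) \<partial>(G \<Otimes>\<^sub>M H)) = (\<integral>\<^sup>+x. \<integral>\<^sup>+z. ennreal ((K x (fst z))\<^sup>2) \<partial>H \<partial>G)"
    by (subst nn_integral_fst[symmetric]) auto
  also have "\<dots> = (\<integral>\<^sup>+x. \<integral>\<^sup>+y. ennreal ((K x y)\<^sup>2) \<partial>G \<partial>G)"
    by (intro nn_integral_cong nn_G) measurable
  also have "\<dots> = (\<integral>\<^sup>+z. ennreal ((K (fst z) (snd z))\<^sup>2) \<partial>(G \<Otimes>\<^sub>M G))"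
    by (subst G.nn_integral_fst[symmetric]) auto
  finally show "(\<integral>\<^sup>+z. ennreal ((K (fst z) (fst (snd z)))\<^sup>2) \<partial>(G \<Otimes>\<^sub>M H)) < \<infinity>" using K_L2 by simp
qed auto

text \<open>Finiteness comes from the Hilbert-Schmidt norm of \<open>K\<close>. It has to precede
  \<open>av_norm\<close>, whose proof applies the operator to \<open>av D\<close> and cancels this
  integral.\<close>

lemma av_L2:
  assumes D[measurable]: "D \<in> sets M" shows "integrable G (\<lambda>x. (av D x)\<^sup>2)"
proof (rule integrableI_nonneg)
  let ?e = "\<integral>\<^sup>+z. ennreal ((snd z * indicator D (fst z))\<^sup>2) \<partial>H"
  have "(\<integral>\<^sup>+x. ennreal ((av D x)\<^sup>2) \<partial>G) \<le> (\<integral>\<^sup>+x. (\<integral>\<^sup>+z. ennreal ((K x (fst z))\<^sup>2) \<partial>H) * ?e \<partial>G)"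
    unfolding av_def by (intro nn_integral_mono ennreal_sq_integral_le) measurable
  also have "\<dots> = (\<integral>\<^sup>+x. \<integral>\<^sup>+z. ennreal ((K x (fst z))\<^sup>2) \<partial>H \<partial>G) * ?e" by (rule nn_integral_multc) measurable
  also have "(\<integral>\<^sup>+x. \<integral>\<^sup>+z. ennreal ((K x (fst z))\<^sup>2) \<partial>H \<partial>G) = (\<integral>\<^sup>+z. ennreal ((K (fst z) (fst (snd z)))\<^sup>2) \<partial>(G \<Otimes>\<^sub>M H))"
    by (subst nn_integral_fst[symmetric]) auto
  also have "\<dots> * ?e < \<infinity>"
  proof -
    have "(\<integral>\<^sup>+z. ennreal ((K (fst z) (fst (snd z)))\<^sup>2) \<partial>(G \<Otimes>\<^sub>M H)) < \<infinity>"
      using K_GH by (simp add: integrable_iff_bounded)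
    moreover have "?e < \<infinity>" using second_D(1)[OF D] by (rule le_less_trans) simp
    ultimately show ?thesis by (simp add: ennreal_mult_less_top)
  qed
  finally show "(\<integral>\<^sup>+x. ennreal ((av D x)\<^sup>2) \<partial>G) < \<infinity>" .
qed (use av_meas[OF D] in auto)

text \<open>The first two claims follow from Cauchy-Schwarz and square integrability of
  \<open>K\<close>; the third turns the supremum over unit vectors into an inequality for all
  \<open>a\<close> by normalising.\<close>

lemma kernel_op_L2:
  assumes a[measurable]: "a \<in> borel_measurable M" and int: "integrable G (\<lambda>x. (a x)\<^sup>2)"
  shows "kernel_op G K a \<in> borel_measurable M" "integrable G (\<lambda>x. (kernel_op G K a x)\<^sup>2)"
    "(\<integral>x. (kernel_op G K a x)\<^sup>2 \<partial>G) \<le> Bd\<^sup>2 * (\<integral>x. (a x)\<^sup>2 \<partial>G)"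
proof -
  show m: "kernel_op G K a \<in> borel_measurable M"
    unfolding kernel_op_def by (rule G.borel_measurable_lebesgue_integral) (simp add: split_beta')
  let ?e = "\<integral>\<^sup>+x. ennreal ((a x)\<^sup>2) \<partial>G"
  have e: "?e = ennreal (\<integral>x. (a x)\<^sup>2 \<partial>G)" using int by (intro nn_integral_eq_integral) auto
  show i: "integrable G (\<lambda>x. (kernel_op G K a x)\<^sup>2)"
  proof (rule integrableI_nonneg)
    have "(\<integral>\<^sup>+x. ennreal ((kernel_op G K a x)\<^sup>2) \<partial>G) \<le> (\<integral>\<^sup>+x. ?e * (\<integral>\<^sup>+y. ennreal ((K x y)\<^sup>2) \<partial>G) \<partial>G)"
      unfolding kernel_op_def by (intro nn_integral_mono ennreal_sq_integral_le) measurable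
    also have "\<dots> = ?e * (\<integral>\<^sup>+x. \<integral>\<^sup>+y. ennreal ((K x y)\<^sup>2) \<partial>G \<partial>G)" by (rule nn_integral_cmult) measurable
    also have "(\<integral>\<^sup>+x. \<integral>\<^sup>+y. ennreal ((K x y)\<^sup>2) \<partial>G \<partial>G) = (\<integral>\<^sup>+z. ennreal ((K (fst z) (snd z))\<^sup>2) \<partial>(G \<Otimes>\<^sub>M G))"
      by (subst G.nn_integral_fst[symmetric]) auto
    also have "?e * \<dots> < \<infinity>" using K_L2 e by (simp add: ennreal_mult_less_top)
    finally show "(\<integral>\<^sup>+x. ennreal ((kernel_op G K a x)\<^sup>2) \<partial>G) < \<infinity>" .
  qed (use m in auto)
  let ?s = "\<integral>x. (a x)\<^sup>2 \<partial>G"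
  show "(\<integral>x. (kernel_op G K a x)\<^sup>2 \<partial>G) \<le> Bd\<^sup>2 * ?s"
  proof (cases "?s = 0")
    \<comment> \<open>No normalisation is possible, but \<open>a\<close> vanishes almost everywhere
      and so does its image.\<close>
    case True
    then have "AE x in G. (a x)\<^sup>2 = 0" using integral_nonneg_eq_0_iff_AE[OF int] by simp
    then have z: "AE x in G. a x = 0" by simp
    have "kernel_op G K a x = 0" if "x \<in> space M" for x
    proof -
      have "(\<integral>v. a v * K x v \<partial>G) = (\<integral>v. 0 \<partial>G)" by (rule integral_cong_AE) (use z that in auto)
      then show ?thesis by (simp add: kernel_op_def)
    qed
    then have "(\<integral>x. (kernel_op G K a x)\<^sup>2 \<partial>G) = (\<integral>x. 0 \<partial>G)" by (intro Bochner_Integration.integral_cong) auto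
    then show ?thesis using True by simp
  next
    case False
    have "0 \<le> ?s" by simp
    then have s: "0 < ?s" using False by linarith
    let ?f = "\<lambda>x. a x / sqrt ?s"
    have f2: "(?f x)\<^sup>2 = (a x)\<^sup>2 / ?s" for x using s by (simp add: power_divide)
    have "?f \<in> {f \<in> borel_measurable G. integrable G (\<lambda>x. (f x)\<^sup>2) \<and> L2_norm G f = 1}"
      using s int by (simp add: L2_norm_def f2)
    then have "ennreal (L2_norm G (kernel_op G K ?f)) \<le> kernel_op_norm G K"
      unfolding kernel_op_norm_def by (rule SUP_upper)
    then have "ennreal (L2_norm G (kernel_op G K ?f)) \<le> ennreal Bd" using K_norm by (rule order_trans)
    then have "L2_norm G (kernel_op G K ?f) \<le> Bd" using Bd by (simp add: ennreal_le_iff)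
    moreover have "0 \<le> L2_norm G (kernel_op G K ?f)" by (simp add: L2_norm_def)
    ultimately have "(L2_norm G (kernel_op G K ?f))\<^sup>2 \<le> Bd\<^sup>2" by (intro power_mono)
    moreover have "kernel_op G K ?f x = kernel_op G K a x / sqrt ?s" for x by (simp add: kernel_op_def)
    ultimately have "(\<integral>x. (kernel_op G K a x)\<^sup>2 \<partial>G) / ?s \<le> Bd\<^sup>2"
      using s by (simp add: L2_norm_def power_divide)
    then show ?thesis using s by (simp add: pos_divide_le_eq)
  qed
qed

text \<open>The bound is obtained by testing \<open>av D\<close> against itself and moving the operator to the other side
  by symmetry; this avoids the regression function \<open>E (Y | X)\<close>.\<close>

lemma av_norm:
  assumes D[measurable]: "D \<in> sets M"
  shows "(\<integral>x. (av D x)\<^sup>2 \<partial>G) \<le> Bd\<^sup>2 * (C * measure G D)"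
proof -
  let ?y = "\<lambda>z. snd z * indicator D (fst z) :: real" and ?v = "kernel_op G K (av D)"
  let ?N = "\<integral>x. (av D x)\<^sup>2 \<partial>G"
  note [measurable] = av_meas[OF D]
  note v = kernel_op_L2[OF av_meas[OF D] av_L2[OF D]]
  note [measurable] = v(1)
  have vH: "integrable H (\<lambda>z. (?v (fst z))\<^sup>2)" "(\<integral>z. (?v (fst z))\<^sup>2 \<partial>H) = (\<integral>x. (?v x)\<^sup>2 \<partial>G)"
    by (rule int_G(2)[OF v(2)], rule int_G(1)) measurable
  have i2: "integrable (G \<Otimes>\<^sub>M H) (\<lambda>z. (av D (fst z) * ?y (snd z))\<^sup>2)"
  proof (rule integrableI_nonneg)
    have "(\<integral>\<^sup>+z. ennreal ((av D (fst z) * ?y (snd z))\<^sup>2) \<partial>(G \<Otimes>\<^sub>M H))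
        = (\<integral>\<^sup>+x. \<integral>\<^sup>+z. ennreal ((av D x)\<^sup>2) * ennreal ((?y z)\<^sup>2) \<partial>H \<partial>G)"
      by (subst nn_integral_fst[symmetric]) (auto simp: power_mult_distrib ennreal_mult)
    also have "\<dots> = (\<integral>\<^sup>+x. ennreal ((av D x)\<^sup>2) * (\<integral>\<^sup>+z. ennreal ((?y z)\<^sup>2) \<partial>H) \<partial>G)"
      by (intro nn_integral_cong nn_integral_cmult) measurable
    also have "\<dots> = (\<integral>\<^sup>+x. ennreal ((av D x)\<^sup>2) \<partial>G) * (\<integral>\<^sup>+z. ennreal ((?y z)\<^sup>2) \<partial>H)"
      by (rule nn_integral_multc) measurable
    also have "\<dots> < \<infinity>"
      using av_L2[OF D] second_D(2)[OF D] by (simp add: nn_integral_eq_integral ennreal_mult_less_top)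
    finally show "(\<integral>\<^sup>+z. ennreal ((av D (fst z) * ?y (snd z))\<^sup>2) \<partial>(G \<Otimes>\<^sub>M H)) < \<infinity>" .
  qed auto
  have int: "integrable (G \<Otimes>\<^sub>M H) (\<lambda>z. (av D (fst z) * ?y (snd z)) * K (fst z) (fst (snd z)))"
    by (rule integrable_mult_L2[OF _ _ i2 K_GH]) measurable
  have "?N = (\<integral>x. \<integral>z. (av D x * ?y z) * K x (fst z) \<partial>H \<partial>G)"
  proof (rule Bochner_Integration.integral_cong[OF refl])
    fix x
    have "(\<integral>z. (av D x * ?y z) * K x (fst z) \<partial>H) = (\<integral>z. av D x * (K x (fst z) * ?y z) \<partial>H)"
      by (simp add: mult_ac)
    then show "(av D x)\<^sup>2 = (\<integral>z. (av D x * ?y z) * K x (fst z) \<partial>H)" by (simp add: av_def power2_eq_square)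
  qed
  also have "\<dots> = (\<integral>z. \<integral>x. (av D x * ?y z) * K x (fst z) \<partial>G \<partial>H)"
    using GH.Fubini_integral[of "\<lambda>x z. (av D x * ?y z) * K x (fst z)"] int by (simp add: split_beta')
  also have "\<dots> = (\<integral>z. ?y z * ?v (fst z) \<partial>H)"
  proof (rule Bochner_Integration.integral_cong[OF refl])
    fix z assume z: "z \<in> space H"
    have "(\<integral>x. (av D x * ?y z) * K x (fst z) \<partial>G) = (\<integral>x. ?y z * (av D x * K (fst z) x) \<partial>G)"
      using K_sym[OF _ fst_space[OF z]] by (intro Bochner_Integration.integral_cong) auto
    then show "(\<integral>x. (av D x * ?y z) * K x (fst z) \<partial>G) = ?y z * ?v (fst z)" by (simp add: kernel_op_def)
  qed
  finally have N: "?N = (\<integral>z. ?y z * ?v (fst z) \<partial>H)" .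
  have "?N\<^sup>2 \<le> (\<integral>z. (?y z)\<^sup>2 \<partial>H) * (\<integral>z. (?v (fst z))\<^sup>2 \<partial>H)"
    unfolding N by (rule Cauchy_Schwarz_L2[OF _ _ second_D(2)[OF D] vH(1)]) measurable
  also have "\<dots> \<le> (C * measure G D) * (Bd\<^sup>2 * ?N)"
    unfolding vH(2) using second_D(3)[OF D] v(3) C by (intro mult_mono) auto
  \<comment> \<open>Cauchy-Schwarz bounds the square of \<open>?N\<close> by a multiple of
    \<open>?N\<close>; one factor is then cancelled.\<close>
  finally have le: "?N * ?N \<le> (Bd\<^sup>2 * (C * measure G D)) * ?N" by (simp add: power2_eq_square mult_ac)
  have "0 \<le> ?N" by simp
  then consider "?N = 0" | "0 < ?N" by linarith
  then show ?thesis
  proof cases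
    case 1
    then show ?thesis using C by simp
  next
    case 2
    then show ?thesis using le by (simp add: mult_le_cancel_right)
  qed
qed

lemma moment_av:
  assumes D[measurable]: "D \<in> sets M"
  shows "integrable H (\<lambda>z. (snd z * av D (fst z))\<^sup>2)"
    "(\<integral>z. (snd z * av D (fst z))\<^sup>2 \<partial>H) \<le> C\<^sup>2 * Bd\<^sup>2 * measure G D"
proof -
  note [measurable] = av_meas[OF D]
  have "(\<integral>\<^sup>+z. ennreal ((snd z * av D (fst z))\<^sup>2) \<partial>H) = (\<integral>\<^sup>+z. ennreal ((av D (fst z))\<^sup>2) * ennreal ((snd z)\<^sup>2) \<partial>H)"
    by (intro nn_integral_cong) (simp add: power_mult_distrib ennreal_mult mult.commute)
  also have "\<dots> \<le> ennreal C * (\<integral>\<^sup>+x. ennreal ((av D x)\<^sup>2) \<partial>G)" by (rule nn_second) measurable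
  also have "\<dots> = ennreal (C * (\<integral>x. (av D x)\<^sup>2 \<partial>G))"
    using av_L2[OF D] C by (simp add: nn_integral_eq_integral ennreal_mult)
  also have "\<dots> \<le> ennreal (C * (Bd\<^sup>2 * (C * measure G D)))"
    using av_norm[OF D] C by (intro ennreal_leI mult_left_mono)
  finally have le: "(\<integral>\<^sup>+z. ennreal ((snd z * av D (fst z))\<^sup>2) \<partial>H) \<le> ennreal (C\<^sup>2 * Bd\<^sup>2 * measure G D)"
    by (simp add: power2_eq_square mult_ac)
  show i: "integrable H (\<lambda>z. (snd z * av D (fst z))\<^sup>2)"
    by (rule integrableI_nonneg) (use le in \<open>auto simp: less_top[symmetric] top_unique\<close>)
  then have "ennreal (\<integral>z. (snd z * av D (fst z))\<^sup>2 \<partial>H) \<le> ennreal (C\<^sup>2 * Bd\<^sup>2 * measure G D)"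
    using le by (subst nn_integral_eq_integral[symmetric]) auto
  then show "(\<integral>z. (snd z * av D (fst z))\<^sup>2 \<partial>H) \<le> C\<^sup>2 * Bd\<^sup>2 * measure G D"
    using C by (simp add: ennreal_le_iff)
qed

end

section \<open>The kernel with its random weights, cut into cells\<close>

locale design_blocks = design_kernel H M mu C K Bd for H :: "('x \<times> real) measure" and M mu C K Bd +
  fixes N :: nat and X :: "nat \<Rightarrow> 'x set" and L :: real
  assumes X_meas: "\<And>m. m \<in> {1..N} \<Longrightarrow> X m \<in> sets M"
    and X_cover: "(\<Union>m\<in>{1..N}. X m) = space M"
    and X_disj: "\<And>m m'. m \<in> {1..N} \<Longrightarrow> m' \<in> {1..N} \<Longrightarrow> m \<noteq> m' \<Longrightarrow> X m \<inter> X m' = {}"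
    and X_pos: "\<And>m. m \<in> {1..N} \<Longrightarrow> 0 < measure G (X m)"
    and L0: "0 \<le> L"
begin

lemma cell_eq: "m \<in> {1..N} \<Longrightarrow> x \<in> X m \<Longrightarrow> cell N X x = m"
  unfolding cell_def by (rule the_equality) (use X_disj in blast)+

lemma cell_in: "x \<in> space M \<Longrightarrow> cell N X x \<in> {1..N} \<and> x \<in> X (cell N X x)"
proof -
  assume "x \<in> space M"
  then obtain m where "m \<in> {1..N}" "x \<in> X m" using X_cover by blast
  then show ?thesis using cell_eq by simp
qed

lemma cell_iff: "m \<in> {1..N} \<Longrightarrow> x \<in> space M \<Longrightarrow> cell N X x = m \<longleftrightarrow> x \<in> X m"
  using cell_in cell_eq by blast

lemma cell_meas: "cell N X \<in> measurable M (count_space UNIV)"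
proof -
  have "cell N X \<in> measurable M (count_space {1..N})"
  proof (subst measurable_count_space_eq2)
    show "cell N X \<in> space M \<rightarrow> {1..N} \<and> (\<forall>a\<in>{1..N}. cell N X -` {a} \<inter> space M \<in> sets M)"
    proof (intro conjI ballI)
      show "cell N X \<in> space M \<rightarrow> {1..N}" using cell_in by auto
      fix a assume a: "a \<in> {1..N}"
      have "cell N X -` {a} \<inter> space M = X a"
        using cell_iff[OF a] sets.sets_into_space[OF X_meas[OF a]] by auto
      then show "cell N X -` {a} \<inter> space M \<in> sets M" using X_meas[OF a] by simp
    qed
  qed simp
  from measurable_compose[OF this, of "\<lambda>x. x" "count_space UNIV"] show ?thesis by simp
qed

definition "ker z z' = K (fst z) (fst z') * snd z * snd z'"
abbreviation "cel z \<equiv> cell N X (fst z)"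

lemma ker_meas: "(\<lambda>z. ker (fst z) (snd z)) \<in> borel_measurable (H \<Otimes>\<^sub>M H)"
  unfolding ker_def by measurable

lemma ker_powr:
  assumes "q > 0" shows "ennreal (\<bar>ker z z'\<bar> powr q) = ennreal (\<bar>K (fst z) (fst z')\<bar> powr q) * ennreal (\<bar>snd z\<bar> powr q) * ennreal (\<bar>snd z'\<bar> powr q)"
  by (simp add: ker_def abs_mult powr_mult ennreal_mult)

lemma nn_ker_powr:
  assumes [measurable]: "D \<in> sets (M \<Otimes>\<^sub>M M)" and q: "q > 0"
  shows "(\<integral>\<^sup>+z. indicator D (fst (fst z), fst (snd z)) * ennreal (\<bar>ker (fst z) (snd z)\<bar> powr q) \<partial>(H \<Otimes>\<^sub>M H))
    = (\<integral>\<^sup>+z\<in>D. ennreal (\<bar>K (fst z) (snd z)\<bar> powr q) * mu q (fst z) * mu q (snd z) \<partial>(G \<Otimes>\<^sub>M G))"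
proof -
  have "(\<lambda>z. indicator D (fst z, snd z) * ennreal (\<bar>K (fst z) (snd z)\<bar> powr q)) \<in> borel_measurable (M \<Otimes>\<^sub>M M)"
    by measurable
  from nn_moment2[OF this q] show ?thesis
    by (simp add: ker_powr[OF q] mult_ac)
qed

lemma nn_ker_sq:
  assumes D: "D \<in> sets (M \<Otimes>\<^sub>M M)"
  shows "(\<integral>\<^sup>+z. indicator D (fst (fst z), fst (snd z)) * ennreal ((ker (fst z) (snd z))\<^sup>2) \<partial>(H \<Otimes>\<^sub>M H))
    = (\<integral>\<^sup>+z\<in>D. ennreal ((K (fst z) (snd z))\<^sup>2) * mu 2 (fst z) * mu 2 (snd z) \<partial>(G \<Otimes>\<^sub>M G))"
  using nn_ker_powr[OF D, of 2] unfolding sq_powr[symmetric] by simp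

lemma nn_ker_sq_space:
  "(\<integral>\<^sup>+z. ennreal ((ker (fst z) (snd z))\<^sup>2) \<partial>(H \<Otimes>\<^sub>M H))
    = (\<integral>\<^sup>+z. ennreal ((K (fst z) (snd z))\<^sup>2) * mu 2 (fst z) * mu 2 (snd z) \<partial>(G \<Otimes>\<^sub>M G))"
proof -
  have "(\<integral>\<^sup>+z. ennreal ((ker (fst z) (snd z))\<^sup>2) \<partial>(H \<Otimes>\<^sub>M H))
     = (\<integral>\<^sup>+z. indicator (space (M \<Otimes>\<^sub>M M)) (fst (fst z), fst (snd z)) * ennreal ((ker (fst z) (snd z))\<^sup>2) \<partial>(H \<Otimes>\<^sub>M H))"
    using fst_space by (intro nn_integral_cong) (auto simp: space_pair_measure indicator_def)
  also have "\<dots> = (\<integral>\<^sup>+z\<in>space (M \<Otimes>\<^sub>M M). ennreal ((K (fst z) (snd z))\<^sup>2) * mu 2 (fst z) * mu 2 (snd z) \<partial>(G \<Otimes>\<^sub>M G))"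
    by (rule nn_ker_sq) simp
  also have "\<dots> = (\<integral>\<^sup>+z. ennreal ((K (fst z) (snd z))\<^sup>2) * mu 2 (fst z) * mu 2 (snd z) \<partial>(G \<Otimes>\<^sub>M G))"
    by (intro nn_integral_cong) (auto simp: space_pair_measure indicator_def)
  finally show ?thesis .
qed

lemma ker_L2: "integrable (H \<Otimes>\<^sub>M H) (\<lambda>z. (ker (fst z) (snd z))\<^sup>2)"
proof (rule integrableI_nonneg)
  show "(\<lambda>z. (ker (fst z) (snd z))\<^sup>2) \<in> borel_measurable (H \<Otimes>\<^sub>M H)" using ker_meas by measurable
  have "(\<integral>\<^sup>+z. ennreal ((ker (fst z) (snd z))\<^sup>2) \<partial>(H \<Otimes>\<^sub>M H))
     \<le> (\<integral>\<^sup>+z. ennreal ((K (fst z) (snd z))\<^sup>2) * (ennreal C * ennreal C) \<partial>(G \<Otimes>\<^sub>M G))"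
    unfolding nn_ker_sq_space mult.assoc
    using mu2 by (intro nn_integral_mono mult_left_mono mult_mono) (auto simp: space_pair_measure)
  also have "\<dots> = (\<integral>\<^sup>+z. ennreal ((K (fst z) (snd z))\<^sup>2) \<partial>(G \<Otimes>\<^sub>M G)) * (ennreal C * ennreal C)"
    by (rule nn_integral_multc) measurable
  also have "\<dots> < \<infinity>" using K_L2 by (simp add: ennreal_mult_less_top)
  finally show "(\<integral>\<^sup>+z. ennreal ((ker (fst z) (snd z))\<^sup>2) \<partial>(H \<Otimes>\<^sub>M H)) < \<infinity>" .
qed simp

lemma cel_meas: "(\<lambda>z. cel z) \<in> measurable H (count_space UNIV)"
  by (rule measurable_compose[OF fst_H cell_meas])

lemma cel_set: "m \<in> {1..N} \<Longrightarrow> {z \<in> space H. cel z = m} = fst -` X m \<inter> space H"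
proof (rule set_eqI)
  fix z assume "m \<in> {1..N}"
  from cell_iff[OF this fst_space, of z]
  show "z \<in> {z \<in> space H. cel z = m} \<longleftrightarrow> z \<in> fst -` X m \<inter> space H" by auto
qed

lemma prob_cel: "m \<in> {1..N} \<Longrightarrow> prob {z \<in> space H. cel z = m} = measure G (X m)"
  unfolding cel_set G_def by (rule measure_distr[symmetric]) (auto intro: X_meas)

sublocale block_kernel H ker "\<lambda>z. cel z" N L
proof
  show "(\<lambda>z. ker (fst z) (snd z)) \<in> borel_measurable (H \<Otimes>\<^sub>M H)" by (rule ker_meas)
  show "ker x y = ker y x" if "x \<in> space H" "y \<in> space H" for x y
    using K_sym[OF fst_space[OF that(1)] fst_space[OF that(2)]] by (simp add: ker_def)
  show "integrable (H \<Otimes>\<^sub>M H) (\<lambda>z. (ker (fst z) (snd z))\<^sup>2)" by (rule ker_L2)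
  show "(\<lambda>z. cel z) \<in> measurable H (count_space UNIV)" by (rule cel_meas)
  show "cel x \<in> {1..N}" if "x \<in> space H" for x using cell_in[OF fst_space[OF that]] by simp
  show "0 < prob {x \<in> space H. cel x = m}" if "m \<in> {1..N}" for m
    using X_pos[OF that] by (simp add: prob_cel[OF that])
qed (rule L0)

lemma p_eq: "m \<in> {1..N} \<Longrightarrow> p m = measure G (X m)"
  using prob_cel by (simp add: p_def B_def)

text \<open>Identifies the abstract second moment with the $k_n$ of the conditions.\<close>

lemma \<kappa>_eq: "\<kappa> = enn2real (\<integral>\<^sup>+z. ennreal ((K (fst z) (snd z))\<^sup>2) * mu 2 (fst z) * mu 2 (snd z) \<partial>(G \<Otimes>\<^sub>M G))"
proof -
  have "ennreal \<kappa> = (\<integral>\<^sup>+z. ennreal ((ker (fst z) (snd z))\<^sup>2) \<partial>(H \<Otimes>\<^sub>M H))"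
    unfolding \<kappa>_def using ker_L2 by (intro nn_integral_eq_integral[symmetric]) auto
  then show ?thesis using \<kappa>_nonneg unfolding nn_ker_sq_space[symmetric] by (metis enn2real_ennreal)
qed

lemma X_pair: "m \<in> {1..N} \<Longrightarrow> X m \<times> X m \<in> sets (M \<Otimes>\<^sub>M M)" using X_meas by auto

lemma indicator_cel:
  assumes "m \<in> {1..N}" "z \<in> space (H \<Otimes>\<^sub>M H)"
  shows "indicator (X m \<times> X m) (fst (fst z), fst (snd z)) = of_bool (cel (fst z) = m \<and> cel (snd z) = m)"
proof -
  have "fst z \<in> space H" "snd z \<in> space H" using assms(2) by (auto simp: space_pair_measure)
  from cell_iff[OF assms(1) fst_space[OF this(1)]] cell_iff[OF assms(1) fst_space[OF this(2)]]
  show ?thesis by (simp add: indicator_def)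
qed

lemma \<kappa>m_eq:
  assumes m: "m \<in> {1..N}"
  shows "\<kappa>m m = enn2real (\<integral>\<^sup>+z\<in>X m \<times> X m. ennreal ((K (fst z) (snd z))\<^sup>2) * mu 2 (fst z) * mu 2 (snd z) \<partial>(G \<Otimes>\<^sub>M G))"
proof -
  have i: "integrable (H \<Otimes>\<^sub>M H) (\<lambda>z. (of_bool (cel (fst z) = m \<and> cel (snd z) = m) * ker (fst z) (snd z))\<^sup>2)"
  proof (rule Bochner_Integration.integrable_bound[OF ker_L2])
    have "meas2 (\<lambda>x y. of_bool (cel x = m \<and> cel y = m) * ker x y)"
      unfolding meas2_def using c_comp[OF measurable_fst] c_comp[OF measurable_snd] ker_meas by measurable
    from f_meas2_sq[OF this] show "(\<lambda>z. (of_bool (cel (fst z) = m \<and> cel (snd z) = m) * ker (fst z) (snd z))\<^sup>2) \<in> borel_measurable (H \<Otimes>\<^sub>M H)"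
      by (simp add: meas2_def)
  qed auto
  have "ennreal (\<kappa>m m) = (\<integral>\<^sup>+z. ennreal ((of_bool (cel (fst z) = m \<and> cel (snd z) = m) * ker (fst z) (snd z))\<^sup>2) \<partial>(H \<Otimes>\<^sub>M H))"
    unfolding \<kappa>m_def using i by (intro nn_integral_eq_integral[symmetric]) auto
  also have "\<dots> = (\<integral>\<^sup>+z. indicator (X m \<times> X m) (fst (fst z), fst (snd z)) * ennreal ((ker (fst z) (snd z))\<^sup>2) \<partial>(H \<Otimes>\<^sub>M H))"
    by (intro nn_integral_cong) (simp add: indicator_cel[OF m] of_bool_def)
  also have "\<dots> = (\<integral>\<^sup>+z\<in>X m \<times> X m. ennreal ((K (fst z) (snd z))\<^sup>2) * mu 2 (fst z) * mu 2 (snd z) \<partial>(G \<Otimes>\<^sub>M G))"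
    by (rule nn_ker_sq[OF X_pair[OF m]])
  finally have e: "ennreal (\<kappa>m m) = (\<integral>\<^sup>+z\<in>X m \<times> X m. ennreal ((K (fst z) (snd z))\<^sup>2) * mu 2 (fst z) * mu 2 (snd z) \<partial>(G \<Otimes>\<^sub>M G))" .
  show ?thesis unfolding e[symmetric] by (simp add: \<kappa>m_def)
qed

lemma \<kappa>m_nonneg: "0 \<le> \<kappa>m m" by (simp add: \<kappa>m_def)

lemma sum_of_bool_cel:
  assumes "z \<in> space (H \<Otimes>\<^sub>M H)"
  shows "(\<Sum>m\<in>{1..N}. of_bool (cel (fst z) = m \<and> cel (snd z) = m) * v) = of_bool (cel (fst z) = cel (snd z)) * (v::'b::semiring_1)"
proof -
  have "cel (fst z) \<in> {1..N}" using assms cell_in[OF fst_space] by (auto simp: space_pair_measure)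
  moreover have "(\<Sum>m\<in>{1..N}. of_bool (cel (fst z) = m \<and> cel (snd z) = m) * v)
    = (\<Sum>m\<in>{1..N}. if m = cel (fst z) then of_bool (cel (fst z) = cel (snd z)) * v else 0)"
    by (intro sum.cong refl) auto
  ultimately show ?thesis by simp
qed

text \<open>Pythagoras for disjoint supports. Through it (C1) says that the off-diagonal part is
  negligible.\<close>

lemma \<kappa>_decomp: "\<kappa> = sq off + (\<Sum>m\<in>{1..N}. \<kappa>m m)"
proof -
  let ?u = "\<lambda>m x y. of_bool (cel x = m \<and> cel y = m) * ker x y"
  have "meas2 (?u m)" for m
    unfolding meas2_def using c_comp[OF measurable_fst] c_comp[OF measurable_snd] ker_meas by measurable
  then have i: "integrable (H \<Otimes>\<^sub>M H) (\<lambda>z. (?u m (fst z) (snd z))\<^sup>2)" for m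
    using L2_dominated(1)[OF L2_f, of "?u m"] by (simp add: L2_def)
  have io: "integrable (H \<Otimes>\<^sub>M H) (\<lambda>z. (off (fst z) (snd z))\<^sup>2)" using L2_off by (simp add: L2_def)
  have "\<kappa> = (\<integral>z. (off (fst z) (snd z))\<^sup>2 + (\<Sum>m\<in>{1..N}. (?u m (fst z) (snd z))\<^sup>2) \<partial>(H \<Otimes>\<^sub>M H))"
    unfolding \<kappa>_def
  proof (rule Bochner_Integration.integral_cong[OF refl])
    fix z assume z: "z \<in> space (H \<Otimes>\<^sub>M H)"
    have "(\<Sum>m\<in>{1..N}. (?u m (fst z) (snd z))\<^sup>2) = (\<Sum>m\<in>{1..N}. of_bool (cel (fst z) = m \<and> cel (snd z) = m) * (ker (fst z) (snd z))\<^sup>2)"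
      by (intro sum.cong refl) (simp add: power_mult_distrib of_bool_def)
    also have "\<dots> = of_bool (cel (fst z) = cel (snd z)) * (ker (fst z) (snd z))\<^sup>2" by (rule sum_of_bool_cel[OF z])
    finally show "(ker (fst z) (snd z))\<^sup>2 = (off (fst z) (snd z))\<^sup>2 + (\<Sum>m\<in>{1..N}. (?u m (fst z) (snd z))\<^sup>2)"
      by (simp add: off_def)
  qed
  also have "\<dots> = sq off + (\<Sum>m\<in>{1..N}. \<kappa>m m)"
    using i io by (simp add: sq_def \<kappa>m_def)
  finally show ?thesis .
qed

lemma integral_ker_section:
  assumes "D \<in> sets M" "\<And>z'. z' \<in> space H \<Longrightarrow> u z' = indicator D (fst z') * ker z z'"
  shows "(\<integral>z'. u z' \<partial>H) = snd z * av D (fst z)"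
proof -
  have "(\<integral>z'. u z' \<partial>H) = (\<integral>z'. snd z * (K (fst z) (fst z') * (snd z' * indicator D (fst z'))) \<partial>H)"
    using assms(2) by (intro Bochner_Integration.integral_cong) (simp_all add: ker_def mult_ac)
  then show ?thesis by (simp add: av_def)
qed

text \<open>The linear part stays bounded: it contributes at most order n^3 to the variance of the
  sum over pairs, against n^2 k for the whole, so (B) makes it negligible.\<close>

lemma \<beta>_le: "\<beta> \<le> C\<^sup>2 * Bd\<^sup>2"
proof -
  have "f1 z = snd z * av (space M) (fst z)" for z
    unfolding f1_def by (rule integral_ker_section) (use fst_space in auto)
  then have "\<beta> = (\<integral>z. (snd z * av (space M) (fst z))\<^sup>2 \<partial>H)" by (simp add: \<beta>_def)
  also have "\<dots> \<le> C\<^sup>2 * Bd\<^sup>2 * measure G (space M)" by (rule moment_av) simp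
  also have "measure G (space M) = 1" using G.prob_space by simp
  finally show ?thesis by simp
qed

text \<open>On cell \<open>m\<close> the projection of \<open>diag\<close> is y times
  \<open>av (X m)\<close> divided by \<open>p m\<close>. The second moment of the numerator is at
  most a constant times \<open>p m\<close>, so after the weighting each cell contributes the same
  constant.\<close>

lemma psq_diag_le: "psq diag \<le> real N * (C\<^sup>2 * Bd\<^sup>2)"
proof -
  have pd: "integrable H (\<lambda>z. p (cel z) * (proj diag z)\<^sup>2)" by (rule psq_le[OF L2_parts(3)]) (auto simp: diag_def split: if_splits)
  have "psq diag \<le> (\<integral>z. (\<Sum>m\<in>{1..N}. (snd z * av (X m) (fst z))\<^sup>2 / p m) \<partial>H)"
    unfolding psq_def
  proof (rule integral_mono[OF pd])
    show "integrable H (\<lambda>z. \<Sum>m\<in>{1..N}. (snd z * av (X m) (fst z))\<^sup>2 / p m)"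
      by (intro Bochner_Integration.integrable_sum integrable_divide moment_av X_meas)
    fix z assume z: "z \<in> space H"
    note c = cell_in[OF fst_space[OF z]]
    have "(\<integral>z'. diag z z' \<partial>H) = snd z * av (X (cel z)) (fst z)"
    proof (rule integral_ker_section)
      show "X (cel z) \<in> sets M" using c X_meas by blast
      fix z' assume "z' \<in> space H"
      then have "cel z' = cel z \<longleftrightarrow> fst z' \<in> X (cel z)" using c cell_iff fst_space by blast
      then show "diag z z' = indicator (X (cel z)) (fst z') * ker z z'" by (auto simp: diag_def indicator_def)
    qed
    then have "p (cel z) * (proj diag z)\<^sup>2 = (snd z * av (X (cel z)) (fst z))\<^sup>2 / p (cel z)"
      using p_pos'[OF z] by (simp add: proj_def power2_eq_square)
    \<comment> \<open>Replacing the term of the current cell by the sum over all cells removes the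
      dependence on the cell of \<open>z\<close>; the bound on \<open>av\<close> over the whole
      space absorbs the extra terms.\<close>
    also have "\<dots> \<le> (\<Sum>m\<in>{1..N}. (snd z * av (X m) (fst z))\<^sup>2 / p m)"
    proof (rule member_le_sum[where f="\<lambda>m. (snd z * av (X m) (fst z))\<^sup>2 / p m"])
      fix m assume "m \<in> {1..N} - {cel z}"
      then have "0 < p m" by (intro p_pos_m) simp
      then show "0 \<le> (snd z * av (X m) (fst z))\<^sup>2 / p m" by simp
    qed (use c in simp_all)
    finally show "p (cel z) * (proj diag z)\<^sup>2 \<le> (\<Sum>m\<in>{1..N}. (snd z * av (X m) (fst z))\<^sup>2 / p m)" .
  qed
  also have "\<dots> = (\<Sum>m\<in>{1..N}. (\<integral>z. (snd z * av (X m) (fst z))\<^sup>2 \<partial>H) / p m)"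
    by (subst Bochner_Integration.integral_sum) (auto intro!: integrable_divide moment_av X_meas)
  also have "\<dots> \<le> (\<Sum>m\<in>{1..N}. C\<^sup>2 * Bd\<^sup>2)"
  proof (rule sum_mono)
    fix m assume m: "m \<in> {1..N}"
    have "(\<integral>z. (snd z * av (X m) (fst z))\<^sup>2 \<partial>H) \<le> C\<^sup>2 * Bd\<^sup>2 * p m"
      using moment_av(2)[OF X_meas[OF m]] by (simp add: p_eq[OF m])
    then show "(\<integral>z. (snd z * av (X m) (fst z))\<^sup>2 \<partial>H) / p m \<le> C\<^sup>2 * Bd\<^sup>2"
      using p_pos_m[OF m] by (simp add: pos_divide_le_eq)
  qed
  finally show ?thesis by simp
qed

text \<open>Where the kernel exceeds \<open>L\<close>, its square is at most L powr (2 - q) times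
  its q-th power. The bound is in \<open>ennreal\<close> because the q-th moments may be
  infinite.\<close>

lemma sq_high_le:
  assumes L: "0 < L" and q: "2 < q"
  shows "ennreal (sq high) \<le> ennreal (L powr (2 - q)) * (\<Sum>m\<in>{1..N}. \<integral>\<^sup>+z\<in>X m \<times> X m.
      ennreal (\<bar>K (fst z) (snd z)\<bar> powr q) * mu q (fst z) * mu q (snd z) \<partial>(G \<Otimes>\<^sub>M G))"
proof -
  have q0: "0 < q" using q by simp
  note [measurable] = ker_meas
  have pw: "(high x y)\<^sup>2 \<le> L powr (2 - q) * \<bar>ker x y\<bar> powr q" for x y
  proof (cases "L < \<bar>ker x y\<bar>")
    case True
    have "(high x y)\<^sup>2 \<le> \<bar>ker x y\<bar> powr 2" unfolding sq_powr[symmetric] by (simp add: high_def)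
    also have "\<dots> = \<bar>ker x y\<bar> powr (2 - q) * \<bar>ker x y\<bar> powr q" by (simp flip: powr_add)
    also have "\<dots> \<le> L powr (2 - q) * \<bar>ker x y\<bar> powr q"
      using True L q by (intro mult_right_mono powr_mono2') auto
    finally show ?thesis .
  qed (simp add: high_def)
  have "ennreal (sq high) = (\<integral>\<^sup>+z. ennreal ((high (fst z) (snd z))\<^sup>2) \<partial>(H \<Otimes>\<^sub>M H))"
    unfolding sq_def using L2_parts(2) by (intro nn_integral_eq_integral[symmetric]) (auto simp: L2_def)
  also have "\<dots> \<le> (\<integral>\<^sup>+z. ennreal (L powr (2 - q)) * (\<Sum>m\<in>{1..N}. indicator (X m \<times> X m) (fst (fst z), fst (snd z)) * ennreal (\<bar>ker (fst z) (snd z)\<bar> powr q)) \<partial>(H \<Otimes>\<^sub>M H))"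
  proof (rule nn_integral_mono)
    fix z assume z: "z \<in> space (H \<Otimes>\<^sub>M H)"
    have "(\<Sum>m\<in>{1..N}. indicator (X m \<times> X m) (fst (fst z), fst (snd z)) * ennreal (\<bar>ker (fst z) (snd z)\<bar> powr q))
      = (\<Sum>m\<in>{1..N}. of_bool (cel (fst z) = m \<and> cel (snd z) = m) * ennreal (\<bar>ker (fst z) (snd z)\<bar> powr q))"
      using z by (intro sum.cong refl) (simp add: indicator_cel)
    also have "\<dots> = of_bool (cel (fst z) = cel (snd z)) * ennreal (\<bar>ker (fst z) (snd z)\<bar> powr q)" by (rule sum_of_bool_cel[OF z])
    finally have s: "(\<Sum>m\<in>{1..N}. indicator (X m \<times> X m) (fst (fst z), fst (snd z)) * ennreal (\<bar>ker (fst z) (snd z)\<bar> powr q))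
      = of_bool (cel (fst z) = cel (snd z)) * ennreal (\<bar>ker (fst z) (snd z)\<bar> powr q)" .
    show "ennreal ((high (fst z) (snd z))\<^sup>2) \<le> ennreal (L powr (2 - q)) * (\<Sum>m\<in>{1..N}. indicator (X m \<times> X m) (fst (fst z), fst (snd z)) * ennreal (\<bar>ker (fst z) (snd z)\<bar> powr q))"
    proof (cases "cel (fst z) = cel (snd z)")
      case True
      then show ?thesis unfolding s using pw[of "fst z" "snd z"] by (simp add: ennreal_leI flip: ennreal_mult)
    qed (simp add: high_def)
  qed
  also have "\<dots> = ennreal (L powr (2 - q)) * (\<Sum>m\<in>{1..N}. \<integral>\<^sup>+z. indicator (X m \<times> X m) (fst (fst z), fst (snd z)) * ennreal (\<bar>ker (fst z) (snd z)\<bar> powr q) \<partial>(H \<Otimes>\<^sub>M H))"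
  proof -
    have mm: "(\<lambda>z. indicator (X m \<times> X m) (fst (fst z), fst (snd z)) * ennreal (\<bar>ker (fst z) (snd z)\<bar> powr q)) \<in> borel_measurable (H \<Otimes>\<^sub>M H)"
      if "m \<in> {1..N}" for m
    proof -
      have "(\<lambda>z. indicator (X m \<times> X m) (fst (fst z), fst (snd z)) :: ennreal) \<in> borel_measurable (H \<Otimes>\<^sub>M H)"
        using X_pair[OF that] by measurable
      then show ?thesis by measurable
    qed
    have "(\<lambda>z. \<Sum>m\<in>{1..N}. indicator (X m \<times> X m) (fst (fst z), fst (snd z)) * ennreal (\<bar>ker (fst z) (snd z)\<bar> powr q)) \<in> borel_measurable (H \<Otimes>\<^sub>M H)"
      by (rule borel_measurable_sum) (rule mm)
    note nn_integral_cmult[OF this, of "ennreal (L powr (2 - q))"]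
    also have "(\<integral>\<^sup>+z. (\<Sum>m\<in>{1..N}. indicator (X m \<times> X m) (fst (fst z), fst (snd z)) * ennreal (\<bar>ker (fst z) (snd z)\<bar> powr q)) \<partial>(H \<Otimes>\<^sub>M H))
      = (\<Sum>m\<in>{1..N}. \<integral>\<^sup>+z. indicator (X m \<times> X m) (fst (fst z), fst (snd z)) * ennreal (\<bar>ker (fst z) (snd z)\<bar> powr q) \<partial>(H \<Otimes>\<^sub>M H))"
      by (rule nn_integral_sum) (rule mm)
    finally show ?thesis .
  qed
  also have "(\<Sum>m\<in>{1..N}. \<integral>\<^sup>+z. indicator (X m \<times> X m) (fst (fst z), fst (snd z)) * ennreal (\<bar>ker (fst z) (snd z)\<bar> powr q) \<partial>(H \<Otimes>\<^sub>M H))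
    = (\<Sum>m\<in>{1..N}. \<integral>\<^sup>+z\<in>X m \<times> X m.
      ennreal (\<bar>K (fst z) (snd z)\<bar> powr q) * mu q (fst z) * mu q (snd z) \<partial>(G \<Otimes>\<^sub>M G))"
  proof (rule sum.cong[OF refl])
    fix m assume "m \<in> {1..N}"
    from nn_ker_powr[OF X_pair[OF this] q0]
    show "(\<integral>\<^sup>+z. indicator (X m \<times> X m) (fst (fst z), fst (snd z)) * ennreal (\<bar>ker (fst z) (snd z)\<bar> powr q) \<partial>(H \<Otimes>\<^sub>M H))
      = (\<integral>\<^sup>+z\<in>X m \<times> X m. ennreal (\<bar>K (fst z) (snd z)\<bar> powr q) * mu q (fst z) * mu q (snd z) \<partial>(G \<Otimes>\<^sub>M G))" .
  qed
  finally show ?thesis .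
qed

lemma sum_p: "(\<Sum>m\<in>{1..N}. p m) = 1"
  using integral_cell_const(1)[of "\<lambda>_. 1"] by (simp add: prob_space)

end

lemma sum_le_aux:
  fixes x :: real
  assumes "y \<le> y'" "x \<le> 35 * (u + v + y)" "v \<le> v'" "w = u + s"
  shows "x \<le> 35 * (w - s + v' + y')"
proof -
  have "u + v + y \<le> (w - s) + v' + y'" unfolding assms(4) using assms(1,3) by (intro add_mono) auto
  then have "35 * (u + v + y) \<le> 35 * (w - s + v' + y')" by (rule mult_left_mono) simp
  with assms(2) show ?thesis by (rule order_trans)
qed

lemma standardize_scale: "0 < s \<Longrightarrow> (a / s) / sqrt (v / s\<^sup>2) = a / sqrt v" for a s v :: real
  by (simp add: real_sqrt_divide)

lemma variance_scale: "a \<noteq> 0 \<Longrightarrow> b \<noteq> 0 \<Longrightarrow> k \<noteq> 0 \<Longrightarrow> v / (2 * a\<^sup>2 * k) = v / (a * b)\<^sup>2 / (2 * k / a\<^sup>2) * (b / a)\<^sup>2"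
  for a b k v :: real
  by (simp add: field_simps power2_eq_square)

lemma abs_diff_mult_divide: "0 < s \<Longrightarrow> \<bar>a - s * w\<bar> / s = \<bar>a / s - w\<bar>" for a s w :: real
proof -
  assume s: "0 < s"
  then have "a / s - w = (a - s * w) / s" by (simp add: diff_divide_distrib)
  then show ?thesis using s by (simp add: abs_divide)
qed

section \<open>Explicit error bounds at a fixed sample size\<close>

locale design_sample = design_blocks H M mu C K Bd N X L
  for H :: "('x \<times> real) measure" and M mu C K Bd N X L +
  fixes P :: "'w measure" and Xs :: "nat \<Rightarrow> 'w \<Rightarrow> 'x" and Ys :: "nat \<Rightarrow> 'w \<Rightarrow> real" and n :: nat
  assumes prob_P: "prob_space P" and n2: "2 \<le> n"
    and indep: "prob_space.indep_vars P (\<lambda>_. M \<Otimes>\<^sub>M borel) (\<lambda>r \<omega>. (Xs r \<omega>, Ys r \<omega>)) {0..<n}"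
    and ident: "\<And>r. r < n \<Longrightarrow> distr P (M \<Otimes>\<^sub>M borel) (\<lambda>\<omega>. (Xs r \<omega>, Ys r \<omega>)) = H"
begin

sublocale block_sample H ker "\<lambda>z. cel z" N L P "M \<Otimes>\<^sub>M borel" "\<lambda>r \<omega>. (Xs r \<omega>, Ys r \<omega>)" n
  by (intro block_sample.intro[OF block_kernel_axioms] block_sample_axioms.intro prob_P n2 indep ident)

lemma sum_\<kappa>m_le: "(\<Sum>m\<in>{1..N}. \<kappa>m m) \<le> \<kappa>"
  using \<kappa>_decomp sq_nonneg[of off] by simp

lemma card_pairs_n: "real (card (pairs NN)) = real n * (real n - 1)"
  using n2 by (simp add: card_pairs of_nat_diff)

text \<open>The parameters are finite-sample forms of the conditions: \<open>c0\<close> of (C4),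
  \<open>R\<close> of (C2), \<open>e1\<close> of (C5), and \<open>e3\<close> records the choice of
  \<open>L\<close>. \<open>D\<close> bounds \<open>d.\<kappa>\<close> relative to \<kappa>; its
  three terms come from the off-diagonal part, the truncation and the projection of
  \<open>diag\<close>.\<close>

context
  fixes c0 R e1 e3 D :: real
  assumes \<kappa>_pos: "0 < \<kappa>" and c0: "0 < c0" and p_ge: "\<And>m. m \<in> {1..N} \<Longrightarrow> c0 \<le> real n * p m"
    and R: "\<And>m. m \<in> {1..N} \<Longrightarrow> \<kappa>m m \<le> R * \<kappa>"
    and e1: "sq high \<le> \<kappa> * e1"
    and e3: "\<And>m. m \<in> {1..N} \<Longrightarrow> L\<^sup>2 * p m \<le> e3 * \<kappa> * real n"
    and D: "D = 35 * ((1 - (\<Sum>m\<in>{1..N}. \<kappa>m m) / \<kappa>) + e1 + C\<^sup>2 * Bd\<^sup>2 / c0 * (real n / \<kappa>))"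
begin

abbreviation "b \<equiv> C\<^sup>2 * Bd\<^sup>2"

text \<open>The cell probabilities add up to 1 and each is at least c0 / n.\<close>

lemma N_le: "real N \<le> real n / c0"
proof -
  have "c0 * real N = (\<Sum>m\<in>{1..N}. c0)" by simp
  also have "\<dots> \<le> (\<Sum>m\<in>{1..N}. real n * p m)" by (rule sum_mono) (rule p_ge)
  also have "\<dots> = real n" using sum_p by (simp flip: sum_distrib_left)
  finally show ?thesis using c0 by (simp add: pos_le_divide_eq mult.commute)
qed

lemma N_pos: "0 < N"
  using sum_p by (cases N) auto

lemma R_nonneg: "0 \<le> R"
proof -
  have "0 \<le> R * \<kappa>" using R[of 1] \<kappa>m_nonneg[of 1] N_pos by (auto intro: order_trans)
  then show ?thesis using \<kappa>_pos by (simp add: zero_le_mult_iff)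
qed

lemma e3_nonneg: "0 \<le> e3"
proof -
  have "0 \<le> L\<^sup>2 * p 1" using p_pos_m[of 1] N_pos by simp
  also have "\<dots> \<le> e3 * \<kappa> * real n" using e3[of 1] N_pos by simp
  finally have "0 \<le> e3 * (\<kappa> * real n)" by (simp add: mult.assoc)
  moreover have "0 < \<kappa> * real n" using \<kappa>_pos n2 by simp
  ultimately show ?thesis by (simp add: zero_le_mult_iff)
qed

lemma d_\<kappa>_le: "d.\<kappa> \<le> \<kappa> * D"
proof -
  have "psq diag \<le> real n / c0 * b"
    using order_trans[OF psq_diag_le mult_right_mono[OF N_le]] by simp
  from this d_\<kappa> e1 \<kappa>_decomp have "d.\<kappa> \<le> 35 * ((\<kappa> - (\<Sum>m\<in>{1..N}. \<kappa>m m)) + \<kappa> * e1 + real n / c0 * b)"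
    by (rule sum_le_aux)
  also have "\<dots> = \<kappa> * D" using \<kappa>_pos c0 unfolding D by (simp add: field_simps)
  finally show ?thesis .
qed

lemma D_nonneg: "0 \<le> D"
proof -
  have "0 \<le> \<kappa> * D" using order_trans[OF d.\<kappa>_nonneg d_\<kappa>_le] .
  then show ?thesis using \<kappa>_pos by (simp add: zero_le_mult_iff)
qed

lemma g_ratio:
  assumes t: "0 < t" shows "\<bar>g.\<kappa> / \<kappa> - 1\<bar> \<le> t + (1 + 1 / t) * D"
proof -
  have "\<bar>g.\<kappa> - \<kappa>\<bar> \<le> t * \<kappa> + (1 + 1 / t) * (\<kappa> * D)"
    using \<kappa>_perturb[OF t] mult_left_mono[OF d_\<kappa>_le, of "1 + 1 / t"] t by simp
  then have "\<bar>g.\<kappa> - \<kappa>\<bar> / \<kappa> \<le> (t * \<kappa> + (1 + 1 / t) * (\<kappa> * D)) / \<kappa>" using \<kappa>_pos by (intro divide_right_mono) auto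
  also have "\<dots> = t + (1 + 1 / t) * D" using \<kappa>_pos by (simp add: add_divide_distrib)
  also have "\<bar>g.\<kappa> - \<kappa>\<bar> / \<kappa> = \<bar>g.\<kappa> / \<kappa> - 1\<bar>" using abs_diff_mult_divide[OF \<kappa>_pos, of g.\<kappa> 1] by simp
  finally show ?thesis .
qed

lemma remainder_le: "4 * real n ^ 3 * \<beta> + 2 * (real n)\<^sup>2 * d.\<kappa> \<le> (real n)\<^sup>2 * \<kappa> * (4 * b * (real n / \<kappa>) + 2 * D)"
proof -
  have "4 * real n ^ 3 * \<beta> + 2 * (real n)\<^sup>2 * d.\<kappa> \<le> 4 * real n ^ 3 * b + 2 * (real n)\<^sup>2 * (\<kappa> * D)"
    using \<beta>_le d_\<kappa>_le by (intro add_mono mult_left_mono) auto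
  also have "\<dots> = (real n)\<^sup>2 * \<kappa> * (4 * b * (real n / \<kappa>) + 2 * D)"
    using \<kappa>_pos by (simp add: field_simps power2_eq_square power3_eq_cube)
  finally show ?thesis .
qed

text \<open>The variance of the sum over pairs and the part of it due to \<open>g\<close>, both in
  units of 2 n^2 \<kappa>. The factor (n - 1) / n stems from the n (n - 1) ordered pairs.\<close>

abbreviation "V' \<equiv> Vf / (2 * (real n)\<^sup>2 * \<kappa>)"
abbreviation "W' \<equiv> (real n - 1) / real n * (g.\<kappa> / \<kappa>)"

lemma V_ratio:
  assumes t: "0 < t" shows "\<bar>V' - W'\<bar> \<le> t * W' + (1 + 1 / t) * (2 * b * (real n / \<kappa>) + D)"
proof -
  let ?s = "2 * (real n)\<^sup>2 * \<kappa>"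
  have s: "0 < ?s" using \<kappa>_pos n2 by simp
  have eq: "2 * real (card (pairs NN)) * g.\<kappa> = ?s * W'"
    unfolding card_pairs_n using \<kappa>_pos n2 by (simp add: field_simps power2_eq_square)
  have "\<bar>Vf - ?s * W'\<bar> \<le> t * (?s * W') + (1 + 1 / t) * ((real n)\<^sup>2 * \<kappa> * (4 * b * (real n / \<kappa>) + 2 * D))"
    using variance_perturb[OF t] mult_left_mono[OF remainder_le, of "1 + 1 / t"] t unfolding eq by simp
  also have "\<dots> = ?s * (t * W' + (1 + 1 / t) * (2 * b * (real n / \<kappa>) + D))"
  proof -
    have "t * (2 * m1 * m2 * w) + u * (m1 * m2 * (4 * bb * y + 2 * d)) = 2 * m1 * m2 * (t * w + u * (2 * bb * y + d))"
      for t m1 m2 w u bb y d :: real by (simp add: algebra_simps)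
    then show ?thesis .
  qed
  finally have "\<bar>Vf - ?s * W'\<bar> / ?s \<le> t * W' + (1 + 1 / t) * (2 * b * (real n / \<kappa>) + D)"
    using s by (simp add: pos_divide_le_eq mult.commute)
  moreover have "\<bar>Vf - ?s * W'\<bar> / ?s = \<bar>V' - W'\<bar>"
    by (rule abs_diff_mult_divide[OF s])
  ultimately show ?thesis by simp
qed

text \<open>One factor is bounded by the maximum over blocks, the other is kept because the block
  moments add up to at most \<kappa>; 400 is the square of the 20 in
  \<open>gm_\<kappa>_le\<close>.\<close>

lemma gm_\<kappa>_le': "m \<in> {1..N} \<Longrightarrow> gm.\<kappa> m * gm.\<kappa> m \<le> 400 * R * \<kappa> * \<kappa>m m"
proof -
  assume m: "m \<in> {1..N}"
  have "gm.\<kappa> m * gm.\<kappa> m \<le> (20 * \<kappa>m m) * (20 * \<kappa>m m)"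
    using gm_\<kappa>_le[OF m] gm.\<kappa>_nonneg[of m] by (intro mult_mono) auto
  also have "\<dots> \<le> (20 * (R * \<kappa>)) * (20 * \<kappa>m m)"
    using R[OF m] \<kappa>m_nonneg[of m] by (intro mult_right_mono) auto
  finally show ?thesis by simp
qed

text \<open>Negative powers of \<open>p m\<close> in \<open>A.\<beta>\<close> and
  \<open>A.\<kappa>\<close> are exchanged for powers of n / c0, leaving the sum of squared block
  moments, at most 400 R \<kappa>^2. The factors 4 and 2 of the variance bound give 1600 and
  800.\<close>

lemma A_bound: "4 * real n ^ 3 * A.\<beta> + 2 * (real n)\<^sup>2 * A.\<kappa> \<le> real n ^ 4 * \<kappa>\<^sup>2 * ((1600 / c0 + 800 / c0\<^sup>2) * R)"
proof -
  have pr: "p m * \<rho> m = gm.\<kappa> m / p m" if "m \<in> {1..N}" for m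
    using p_pos_m[OF that] by (simp add: \<rho>_def power2_eq_square)
  have ip: "1 / p m \<le> real n / c0" if "m \<in> {1..N}" for m
    using p_ge[OF that] p_pos_m[OF that] c0 by (simp add: field_simps)
  have sum: "(\<Sum>m\<in>{1..N}. gm.\<kappa> m * gm.\<kappa> m) \<le> 400 * R * \<kappa>\<^sup>2"
  proof -
    have "(\<Sum>m\<in>{1..N}. gm.\<kappa> m * gm.\<kappa> m) \<le> (\<Sum>m\<in>{1..N}. 400 * R * \<kappa> * \<kappa>m m)"
      by (intro sum_mono gm_\<kappa>_le')
    also have "\<dots> = 400 * R * \<kappa> * (\<Sum>m\<in>{1..N}. \<kappa>m m)" by (simp only: sum_distrib_left)
    also have "\<dots> \<le> 400 * R * \<kappa> * \<kappa>" using sum_\<kappa>m_le R_nonneg \<kappa>_nonneg by (intro mult_left_mono) auto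
    finally show ?thesis by (simp add: power2_eq_square)
  qed
  have "A.\<beta> = (\<Sum>m\<in>{1..N}. (1 / p m) * (gm.\<kappa> m * gm.\<kappa> m))"
    unfolding A_\<beta>
  proof (rule sum.cong[OF refl])
    fix m assume m: "m \<in> {1..N}"
    show "p m * (p m * \<rho> m)\<^sup>2 = (1 / p m) * (gm.\<kappa> m * gm.\<kappa> m)"
      unfolding pr[OF m] using p_pos_m[OF m] by (simp add: power2_eq_square)
  qed
  also have "\<dots> \<le> (\<Sum>m\<in>{1..N}. real n / c0 * (gm.\<kappa> m * gm.\<kappa> m))"
    by (intro sum_mono mult_right_mono ip) auto
  also have "\<dots> = real n / c0 * (\<Sum>m\<in>{1..N}. gm.\<kappa> m * gm.\<kappa> m)" by (simp only: sum_distrib_left)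
  also have "\<dots> \<le> real n / c0 * (400 * R * \<kappa>\<^sup>2)" using sum c0 by (intro mult_left_mono) auto
  finally have B: "A.\<beta> \<le> real n / c0 * (400 * R * \<kappa>\<^sup>2)" .
  have "A.\<kappa> = (\<Sum>m\<in>{1..N}. (1 / p m)\<^sup>2 * (gm.\<kappa> m * gm.\<kappa> m))"
    unfolding A_\<kappa>
  proof (rule sum.cong[OF refl])
    fix m assume m: "m \<in> {1..N}"
    have "p m * (p m * (\<rho> m)\<^sup>2) = (p m * \<rho> m)\<^sup>2" by (simp add: power2_eq_square)
    then show "p m * (p m * (\<rho> m)\<^sup>2) = (1 / p m)\<^sup>2 * (gm.\<kappa> m * gm.\<kappa> m)"
      unfolding pr[OF m] by (simp add: power2_eq_square)
  qed
  also have "\<dots> \<le> (\<Sum>m\<in>{1..N}. (real n / c0)\<^sup>2 * (gm.\<kappa> m * gm.\<kappa> m))"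
  proof (intro sum_mono mult_right_mono power_mono ip)
    fix m assume "m \<in> {1..N}"
    then show "0 \<le> 1 / p m" using p_pos_m by (simp add: less_imp_le)
  qed auto
  also have "\<dots> = (real n / c0)\<^sup>2 * (\<Sum>m\<in>{1..N}. gm.\<kappa> m * gm.\<kappa> m)" by (simp only: sum_distrib_left)
  also have "\<dots> \<le> (real n / c0)\<^sup>2 * (400 * R * \<kappa>\<^sup>2)" using sum by (intro mult_left_mono) auto
  finally have K: "A.\<kappa> \<le> (real n / c0)\<^sup>2 * (400 * R * \<kappa>\<^sup>2)" .
  have "4 * real n ^ 3 * A.\<beta> + 2 * (real n)\<^sup>2 * A.\<kappa>
     \<le> 4 * real n ^ 3 * (real n / c0 * (400 * R * \<kappa>\<^sup>2)) + 2 * (real n)\<^sup>2 * ((real n / c0)\<^sup>2 * (400 * R * \<kappa>\<^sup>2))"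
    using B K by (intro add_mono mult_left_mono) auto
  also have "\<dots> = real n ^ 4 * \<kappa>\<^sup>2 * ((1600 / c0 + 800 / c0\<^sup>2) * R)"
    using c0 by (simp add: field_simps power2_eq_square power3_eq_cube power4_eq_xxxx)
  finally show ?thesis .
qed

text \<open>The coefficients in \<open>T4_moment\<close> are 4096 = 4^4 * 16, 104976 = 9^4 * 16 and
  65536 = 16^4, the 16 coming from the bound 4 L on the kernel. Multiplied by 20, 20 and 400 from
  the estimates of the block moments they give the constants here.\<close>

lemma T4_bound: "(\<integral>\<omega>. T4 \<omega> \<partial>P) \<le> real n ^ 4 * \<kappa>\<^sup>2 * ((81920 / c0 + 2099520) * e3 + 26214400 * R)"
proof -
  let ?c = "(81920 / c0 + 2099520) * e3 + 26214400 * R"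
  have "(\<integral>\<omega>. T4 \<omega> \<partial>P) \<le> (\<Sum>m\<in>{1..N}. 4 ^ 4 * real n ^ 2 * ((4 * L)\<^sup>2 * gm.\<kappa> m)
     + 9 ^ 4 * real n ^ 3 * ((4 * L)\<^sup>2 * p m * gm.\<kappa> m) + 16 ^ 4 * real n ^ 4 * (gm.\<kappa> m)\<^sup>2)"
    by (rule T4_moment)
  also have "\<dots> \<le> (\<Sum>m\<in>{1..N}. real n ^ 4 * \<kappa> * ?c * \<kappa>m m)"
  proof (rule sum_mono)
    fix m assume m: "m \<in> {1..N}"
    let ?g = "gm.\<kappa> m" and ?k = "\<kappa>m m"
    have lp: "real n ^ 3 * (L\<^sup>2 * p m) * ?g \<le> real n ^ 3 * (e3 * \<kappa> * real n) * (20 * ?k)"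
      using gm.\<kappa>_nonneg[of m] e3_nonneg \<kappa>_nonneg
      by (intro mult_mono[OF mult_left_mono[OF e3[OF m]] gm_\<kappa>_le[OF m]]) auto
    then have lp': "real n ^ 3 * (L\<^sup>2 * p m) * ?g \<le> 20 * e3 * (real n ^ 4 * \<kappa> * ?k)"
      by (simp add: power3_eq_cube power4_eq_xxxx mult_ac)
    \<comment> \<open>The two-vertex term lacks the factor \<open>p m\<close> that balances L^2; the
      lower bound on \<open>n * p m\<close> supplies it and reduces this term to the three-vertex
      one.\<close>
    have "c0 * (real n ^ 2 * (L\<^sup>2 * ?g)) \<le> (real n * p m) * (real n ^ 2 * (L\<^sup>2 * ?g))"
      using p_ge[OF m] gm.\<kappa>_nonneg[of m] by (intro mult_right_mono) auto
    also have "\<dots> = real n ^ 3 * (L\<^sup>2 * p m) * ?g" by (simp add: power2_eq_square power3_eq_cube mult_ac)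
    finally have "c0 * (real n ^ 2 * (L\<^sup>2 * ?g)) \<le> 20 * e3 * (real n ^ 4 * \<kappa> * ?k)" using lp' by linarith
    then have l2: "real n ^ 2 * (L\<^sup>2 * ?g) \<le> 20 / c0 * e3 * (real n ^ 4 * \<kappa> * ?k)"
      using c0 by (simp add: field_simps)
    have l3: "real n ^ 4 * ?g\<^sup>2 \<le> 400 * R * (real n ^ 4 * \<kappa> * ?k)"
      using mult_left_mono[OF gm_\<kappa>_le'[OF m], of "real n ^ 4"] by (simp add: power2_eq_square mult_ac)
    have "4 ^ 4 * real n ^ 2 * ((4 * L)\<^sup>2 * ?g) + 9 ^ 4 * real n ^ 3 * ((4 * L)\<^sup>2 * p m * ?g) + 16 ^ 4 * real n ^ 4 * ?g\<^sup>2
       = 4096 * (real n ^ 2 * (L\<^sup>2 * ?g)) + 104976 * (real n ^ 3 * (L\<^sup>2 * p m) * ?g) + 65536 * (real n ^ 4 * ?g\<^sup>2)"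
      by (simp add: power_mult_distrib algebra_simps)
    also have "\<dots> \<le> 4096 * (20 / c0 * e3 * (real n ^ 4 * \<kappa> * ?k)) + 104976 * (20 * e3 * (real n ^ 4 * \<kappa> * ?k)) + 65536 * (400 * R * (real n ^ 4 * \<kappa> * ?k))"
      using l2 lp' l3 by linarith
    also have "\<dots> = real n ^ 4 * \<kappa> * ?c * ?k" by (simp add: algebra_simps)
    finally show "4 ^ 4 * real n ^ 2 * ((4 * L)\<^sup>2 * ?g) + 9 ^ 4 * real n ^ 3 * ((4 * L)\<^sup>2 * p m * ?g) + 16 ^ 4 * real n ^ 4 * ?g\<^sup>2
       \<le> real n ^ 4 * \<kappa> * ?c * ?k" .
  qed
  also have "\<dots> = real n ^ 4 * \<kappa> * ?c * (\<Sum>m\<in>{1..N}. \<kappa>m m)" by (simp only: sum_distrib_left)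
  also have "\<dots> \<le> real n ^ 4 * \<kappa> * ?c * \<kappa>"
    using sum_\<kappa>m_le c0 e3_nonneg R_nonneg \<kappa>_nonneg by (intro mult_left_mono mult_nonneg_nonneg add_nonneg_nonneg) auto
  finally show ?thesis by (simp add: power2_eq_square mult_ac)
qed

lemma prob_bound:
  fixes \<delta> \<epsilon> :: real
  assumes clt: "clt_threshold TYPE('w) \<epsilon> \<delta>"
    and \<delta>: "0 < \<delta>" and V: "1 / 2 \<le> V'" and mean: "\<bar>W' / V' - 1\<bar> \<le> \<delta> / 2"
  shows "P.prob {\<omega> \<in> space P. bl_dist (distr (uniform_measure P {\<omega>' \<in> space P. cells \<omega>' = cells \<omega>}) borel
       (\<lambda>x. (esum ker NN x - E\<^sub>f) / sqrt Vf)) std_normal_distribution > \<epsilon>}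
    \<le> (4 * b * (real n / \<kappa>) + 2 * D) / \<delta> + 4 * ((1600 / c0 + 800 / c0\<^sup>2) * R) / (\<delta> / 2)\<^sup>2
      + ((81920 / c0 + 2099520) * e3 + 26214400 * R) / \<delta>"
proof -
  let ?m = "(real n)\<^sup>2 * \<kappa>"
  have m: "0 < ?m" using \<kappa>_pos n2 by simp
  \<comment> \<open>\<open>V'\<close> at least 1/2 says that the variance is at least n^2 \<kappa>,
    the scale of all numerators.\<close>
  have V1: "?m \<le> Vf" using V m by (simp add: field_simps)
  then have V0: "0 < Vf" using m by linarith
  have V2: "?m\<^sup>2 \<le> Vf\<^sup>2" using V1 m by (intro power_mono) auto
  have m2: "?m\<^sup>2 = real n ^ 4 * \<kappa>\<^sup>2" by (simp add: power_mult_distrib flip: power_mult)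
  have eq: "2 * real (card (pairs NN)) * g.\<kappa> / Vf = W' / V'"
    unfolding card_pairs_n using \<kappa>_pos n2 V0 by (simp add: field_simps power2_eq_square)
  have dm: "x / y \<le> z" if "x \<le> w * z" "0 < w" "w \<le> y" "0 \<le> z" for x y w z :: real
  proof -
    have "x \<le> y * z" using that mult_right_mono[of w y z] by linarith
    then show ?thesis using that by (simp add: pos_divide_le_eq mult.commute)
  qed
  have t1: "(4 * real n ^ 3 * \<beta> + 2 * (real n)\<^sup>2 * d.\<kappa>) / Vf \<le> 4 * b * (real n / \<kappa>) + 2 * D"
    using D_nonneg \<kappa>_pos by (intro dm[OF remainder_le m V1]) auto
  have t2: "(4 * real n ^ 3 * A.\<beta> + 2 * (real n)\<^sup>2 * A.\<kappa>) / Vf\<^sup>2 \<le> (1600 / c0 + 800 / c0\<^sup>2) * R"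
    using c0 R_nonneg by (intro dm[OF A_bound[folded m2] zero_less_power[OF m] V2]) auto
  have t3: "(\<integral>\<omega>. T4 \<omega> \<partial>P) / Vf\<^sup>2 \<le> (81920 / c0 + 2099520) * e3 + 26214400 * R"
    using c0 R_nonneg e3_nonneg by (intro dm[OF T4_bound[folded m2] zero_less_power[OF m] V2]) auto
  have "P.prob {\<omega> \<in> space P. bl_dist (distr (uniform_measure P {\<omega>' \<in> space P. cells \<omega>' = cells \<omega>}) borel
       (\<lambda>x. (esum ker NN x - E\<^sub>f) / sqrt Vf)) std_normal_distribution > \<epsilon>}
    \<le> (4 * real n ^ 3 * \<beta> + 2 * (real n)\<^sup>2 * d.\<kappa>) / Vf / \<delta>
      + 4 * (4 * real n ^ 3 * A.\<beta> + 2 * (real n)\<^sup>2 * A.\<kappa>) / Vf\<^sup>2 / (\<delta> / 2)\<^sup>2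
      + (\<integral>\<omega>. T4 \<omega> \<partial>P) / Vf\<^sup>2 / \<delta>"
    using mean by (intro prob_conditional_bl_dist_gt_le[OF clt \<delta> V0]) (simp_all only: eq)
  also have "\<dots> \<le> (4 * b * (real n / \<kappa>) + 2 * D) / \<delta> + 4 * ((1600 / c0 + 800 / c0\<^sup>2) * R) / (\<delta> / 2)\<^sup>2
      + ((81920 / c0 + 2099520) * e3 + 26214400 * R) / \<delta>"
    using t1 t2 t3 \<delta> unfolding times_divide_eq_right[symmetric, of 4]
    by (intro add_mono divide_right_mono mult_left_mono) auto
  finally show ?thesis .
qed

end

text \<open>With this \<open>L\<close>, the factor L powr (2 - q) splits into \<eta> powr (2 - q),
  one power of \<kappa>, and exactly the prefactor of (C5). The number \<open>x\<close> is the (C5)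
  quantity, assumed finite.\<close>

lemma sq_high_small:
  assumes q: "2 < q" and \<eta>: "0 < \<eta>" and pm: "0 < pm" and \<kappa>0: "0 < \<kappa>"
    and L: "L = \<eta> * sqrt (\<kappa> * real n / pm)"
    and x: "ennreal (\<kappa> powr (- q / 2) * (pm / real n) powr (q / 2 - 1)) * (\<Sum>m\<in>{1..N}. \<integral>\<^sup>+z\<in>X m \<times> X m.
      ennreal (\<bar>K (fst z) (snd z)\<bar> powr q) * mu q (fst z) * mu q (snd z) \<partial>(G \<Otimes>\<^sub>M G)) = ennreal x" and x0: "0 \<le> x"
  shows "sq high \<le> \<kappa> * (\<eta> powr (2 - q) * x)"
proof -
  let ?W = "\<Sum>m\<in>{1..N}. \<integral>\<^sup>+z\<in>X m \<times> X m. ennreal (\<bar>K (fst z) (snd z)\<bar> powr q) * mu q (fst z) * mu q (snd z) \<partial>(G \<Otimes>\<^sub>M G)"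
  have n0: "0 < real n" using n2 by simp
  define r where "r = pm / real n"
  have r: "0 < r" using pm n0 by (simp add: r_def)
  have Lr: "L = \<eta> * (\<kappa> / r) powr (1 / 2)" unfolding L r_def using pm n0 \<kappa>0 by (subst powr_half_sqrt) auto
  have L0: "0 < L" using Lr \<eta> r \<kappa>0 by simp
  have "L powr (2 - q) = \<eta> powr (2 - q) * (\<kappa> / r) powr ((2 - q) / 2)"
    unfolding Lr using \<eta> r \<kappa>0 by (simp add: powr_mult powr_powr)
  also have "(\<kappa> / r) powr ((2 - q) / 2) = \<kappa> powr (1 + (- q / 2)) * r powr (q / 2 - 1)"
  proof -
    have e: "(2 - q) / 2 = 1 + (- q / 2)" "(2 - q) / 2 = - (q / 2 - 1)" by (simp_all add: field_simps)
    have "(\<kappa> / r) powr ((2 - q) / 2) = \<kappa> powr ((2 - q) / 2) / r powr ((2 - q) / 2)" using r \<kappa>0 by (simp add: powr_divide)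
    also have "r powr ((2 - q) / 2) = 1 / r powr (q / 2 - 1)" unfolding e(2) by (rule powr_minus_divide)
    finally show ?thesis by (simp only: e(1) divide_divide_eq_right div_by_1)
  qed
  also have "\<kappa> powr (1 + (- q / 2)) = \<kappa> * \<kappa> powr (- q / 2)" using \<kappa>0 by (subst powr_add) simp
  finally have LL: "L powr (2 - q) = (\<kappa> * \<eta> powr (2 - q)) * (\<kappa> powr (- q / 2) * r powr (q / 2 - 1))" by (simp add: mult_ac)
  have "ennreal (sq high) \<le> ennreal (L powr (2 - q)) * ?W" by (rule sq_high_le[OF L0 q])
  also have "\<dots> = ennreal (\<kappa> * \<eta> powr (2 - q)) * (ennreal (\<kappa> powr (- q / 2) * r powr (q / 2 - 1)) * ?W)"
    unfolding LL using \<kappa>0 by (subst ennreal_mult) (auto simp: mult.assoc)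
  also have "\<dots> = ennreal (\<kappa> * \<eta> powr (2 - q)) * ennreal x" using x by (simp add: r_def)
  also have "\<dots> = ennreal (\<kappa> * \<eta> powr (2 - q) * x)" using \<kappa>0 x0 by (subst ennreal_mult) auto
  finally show ?thesis using \<kappa>0 x0 by (simp add: ennreal_le_iff mult_ac)
qed

definition "Us \<omega> = (\<Sum>r\<in>{0..<n}. \<Sum>s\<in>{0..<n} - {r}. K (Xs r \<omega>) (Xs s \<omega>) * Ys r \<omega> * Ys s \<omega>) / (real n * (real n - 1))"

lemma cells_eq: "cells \<omega> = map (\<lambda>r. cell N X (Xs r \<omega>)) [0..<n]"
  by (simp add: cells_def)

lemma Us_eq: "Us \<omega> = esum ker NN \<omega> / (real n * (real n - 1))"
  unfolding Us_def ker_def by (simp add: sum_pairs)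

lemma E_Us: "(\<integral>\<omega>. Us \<omega> \<partial>P) = E\<^sub>f / (real n * (real n - 1))"
  unfolding Us_eq using sample_variance(4)[OF kernels(1)] by simp

lemma Us_centered: "Us \<omega> - (\<integral>\<omega>'. Us \<omega>' \<partial>P) = (esum ker NN \<omega> - E\<^sub>f) / (real n * (real n - 1))"
  by (simp only: E_Us, simp only: Us_eq diff_divide_distrib)

lemma var_Us: "(\<integral>\<omega>. (Us \<omega> - (\<integral>\<omega>'. Us \<omega>' \<partial>P))\<^sup>2 \<partial>P) = Vf / (real n * (real n - 1))\<^sup>2"
  unfolding Us_centered Vf_def power_divide by simp

lemma standardized_Us:
  "(Us \<omega> - (\<integral>\<omega>'. Us \<omega>' \<partial>P)) / sqrt (\<integral>\<omega>. (Us \<omega> - (\<integral>\<omega>'. Us \<omega>' \<partial>P))\<^sup>2 \<partial>P) = (esum ker NN \<omega> - E\<^sub>f) / sqrt Vf"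
proof -
  have "0 < real n * (real n - 1)" using n2 by simp
  then show ?thesis unfolding var_Us unfolding Us_centered by (rule standardize_scale)
qed

end

section \<open>Limits\<close>

text \<open>Fix \<open>t\<close> first, then let \<open>n\<close> grow: the remainder vanishes for
  every fixed \<open>t\<close>, and \<open>t * w n\<close> stays below any prescribed size.\<close>

lemma tendsto_diff_of_perturbation:
  fixes x w r :: "nat \<Rightarrow> real"
  assumes le: "\<And>t. 0 < t \<Longrightarrow> eventually (\<lambda>n. \<bar>x n - w n\<bar> \<le> t * w n + (1 + 1 / t) * r n) sequentially"
    and w: "w \<longlonglongrightarrow> 1" and r: "r \<longlonglongrightarrow> 0"
  shows "x \<longlonglongrightarrow> 1"
proof -
  have "(\<lambda>n. x n - w n) \<longlonglongrightarrow> 0"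
  proof (rule LIMSEQ_I)
    fix e :: real assume e: "0 < e"
    \<comment> \<open>Since \<open>w\<close> is eventually below 2, this makes
      \<open>t * w n\<close> less than e / 2.\<close>
    define t where "t = e / 4"
    have t: "0 < t" using e by (simp add: t_def)
    have "eventually (\<lambda>n. w n < 2) sequentially" using w by (rule order_tendstoD) simp
    moreover have "eventually (\<lambda>n. (1 + 1 / t) * r n < e / 2) sequentially"
    proof (rule order_tendstoD)
      show "(\<lambda>n. (1 + 1 / t) * r n) \<longlonglongrightarrow> (1 + 1 / t) * 0" by (intro tendsto_intros r)
    qed (use e in simp)
    ultimately have "eventually (\<lambda>n. norm (x n - w n - 0) < e) sequentially"
      using le[OF t]
    proof eventually_elim
      case (elim n)
      have "t * w n \<le> t * 2" using elim t by (intro mult_left_mono) auto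
      then show ?case using elim by (simp add: t_def)
    qed
    then show "\<exists>no. \<forall>n\<ge>no. norm (x n - w n - 0) < e" by (simp add: eventually_sequentially)
  qed
  from tendsto_add[OF this w] show ?thesis by simp
qed

context design_sample
begin

text \<open>Exports the estimates with the ratio \<open>g.\<kappa> / \<kappa>\<close> hidden behind
  an existential \<open>gk\<close>, so that they no longer mention objects of the locale and can be
  used as \<open>n\<close> varies.\<close>

lemma summary:
  fixes c0 R e1 e3 :: real
  assumes "0 < \<kappa>" and "0 < c0" and "\<And>m. m \<in> {1..N} \<Longrightarrow> c0 \<le> real n * p m"
    and "\<And>m. m \<in> {1..N} \<Longrightarrow> \<kappa>m m \<le> R * \<kappa>"
    and "sq high \<le> \<kappa> * e1"
    and "\<And>m. m \<in> {1..N} \<Longrightarrow> L\<^sup>2 * p m \<le> e3 * \<kappa> * real n"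
  defines "Dn \<equiv> 35 * ((1 - (\<Sum>m\<in>{1..N}. \<kappa>m m) / \<kappa>) + e1 + C\<^sup>2 * Bd\<^sup>2 / c0 * (real n / \<kappa>))"
  defines "v \<equiv> (\<integral>\<omega>. (Us \<omega> - (\<integral>\<omega>'. Us \<omega>' \<partial>P))\<^sup>2 \<partial>P)"
  defines "Vn \<equiv> v / (2 * \<kappa> / (real n)\<^sup>2) * ((real n - 1) / real n)\<^sup>2"
  obtains gk where
    "\<And>t. 0 < t \<Longrightarrow> \<bar>gk - 1\<bar> \<le> t * 1 + (1 + 1 / t) * Dn"
    "\<And>t. 0 < t \<Longrightarrow> \<bar>Vn - (real n - 1) / real n * gk\<bar>
        \<le> t * ((real n - 1) / real n * gk) + (1 + 1 / t) * (2 * (C\<^sup>2 * Bd\<^sup>2) * (real n / \<kappa>) + Dn)"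
    "\<And>\<epsilon> \<delta>. clt_threshold TYPE('w) \<epsilon> \<delta> \<Longrightarrow> 0 < \<delta> \<Longrightarrow> 1 / 2 \<le> Vn \<Longrightarrow>
        \<bar>(real n - 1) / real n * gk / Vn - 1\<bar> \<le> \<delta> / 2 \<Longrightarrow>
       P.prob {\<omega> \<in> space P. bl_dist (distr (uniform_measure P {\<omega>' \<in> space P.
           map (\<lambda>r. cell N X (Xs r \<omega>')) [0..<n] = map (\<lambda>r. cell N X (Xs r \<omega>)) [0..<n]}) borel
         (\<lambda>x. (Us x - (\<integral>\<omega>'. Us \<omega>' \<partial>P)) / sqrt v)) std_normal_distribution > \<epsilon>}
       \<le> (4 * (C\<^sup>2 * Bd\<^sup>2) * (real n / \<kappa>) + 2 * Dn) / \<delta> + 4 * ((1600 / c0 + 800 / c0\<^sup>2) * R) / (\<delta> / 2)\<^sup>2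
      + ((81920 / c0 + 2099520) * e3 + 26214400 * R) / \<delta>"
proof -
  have D: "Dn = 35 * ((1 - (\<Sum>m\<in>{1..N}. \<kappa>m m) / \<kappa>) + e1 + C\<^sup>2 * Bd\<^sup>2 / c0 * (real n / \<kappa>))"
    by (simp only: Dn_def)
  note as = assms(1-6) D
  have V: "Vf / (2 * (real n)\<^sup>2 * \<kappa>) = Vn"
    unfolding Vn_def v_def var_Us using assms(1) n2 by (intro variance_scale) auto
  show thesis
  proof (rule that[of "g.\<kappa> / \<kappa>"])
    show "\<bar>g.\<kappa> / \<kappa> - 1\<bar> \<le> t * 1 + (1 + 1 / t) * Dn" if "0 < t" for t
      using g_ratio[OF as that] by simp
    show "\<bar>Vn - (real n - 1) / real n * (g.\<kappa> / \<kappa>)\<bar>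
        \<le> t * ((real n - 1) / real n * (g.\<kappa> / \<kappa>)) + (1 + 1 / t) * (2 * (C\<^sup>2 * Bd\<^sup>2) * (real n / \<kappa>) + Dn)" if "0 < t" for t
      using V_ratio[OF as that] unfolding V .
    fix \<epsilon> \<delta> :: real
    assume a: "clt_threshold TYPE('w) \<epsilon> \<delta>" "0 < \<delta>" "1 / 2 \<le> Vn"
      "\<bar>(real n - 1) / real n * (g.\<kappa> / \<kappa>) / Vn - 1\<bar> \<le> \<delta> / 2"
    note b = prob_bound[OF as a(1) a(2) a(3)[folded V] a(4)[folded V]]
    show "P.prob {\<omega> \<in> space P. bl_dist (distr (uniform_measure P {\<omega>' \<in> space P.
           map (\<lambda>r. cell N X (Xs r \<omega>')) [0..<n] = map (\<lambda>r. cell N X (Xs r \<omega>)) [0..<n]}) borel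
         (\<lambda>x. (Us x - (\<integral>\<omega>'. Us \<omega>' \<partial>P)) / sqrt v)) std_normal_distribution > \<epsilon>}
       \<le> (4 * (C\<^sup>2 * Bd\<^sup>2) * (real n / \<kappa>) + 2 * Dn) / \<delta> + 4 * ((1600 / c0 + 800 / c0\<^sup>2) * R) / (\<delta> / 2)\<^sup>2
      + ((81920 / c0 + 2099520) * e3 + 26214400 * R) / \<delta>"
      unfolding v_def standardized_Us cells_eq[symmetric]
      by (rule b)
  qed
qed

end

theorem theorem1:
  fixes M :: "'x measure" and P :: "'w measure" and H :: "('x \<times> real) measure"
    and X :: "nat \<Rightarrow> nat \<Rightarrow> 'w \<Rightarrow> 'x" and Y :: "nat \<Rightarrow> nat \<Rightarrow> 'w \<Rightarrow> real"
    and K :: "nat \<Rightarrow> 'x \<Rightarrow> 'x \<Rightarrow> real" and mu :: "real \<Rightarrow> 'x \<Rightarrow> ennreal"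
    and Mn :: "nat \<Rightarrow> nat" and Xp :: "nat \<Rightarrow> nat \<Rightarrow> 'x set" and C :: real
  defines "G \<equiv> distr H M fst"
  defines "k \<equiv> \<lambda>n. enn2real (\<integral>\<^sup>+z. ennreal ((K n (fst z) (snd z))\<^sup>2) * mu 2 (fst z) * mu 2 (snd z)
                  \<partial>(G \<Otimes>\<^sub>M G))"
  defines "U \<equiv> \<lambda>n \<omega>. (\<Sum>r\<in>{0..<n}. \<Sum>s\<in>{0..<n} - {r}. K n (X n r \<omega>) (X n s \<omega>) * Y n r \<omega> * Y n s \<omega>)
                  / (real n * (real n - 1))"
  defines "Z \<equiv> \<lambda>n \<omega>. (U n \<omega> - (\<integral>\<omega>'. U n \<omega>' \<partial>P))
                  / sqrt (\<integral>\<omega>'. (U n \<omega>' - (\<integral>\<omega>''. U n \<omega>'' \<partial>P))\<^sup>2 \<partial>P)"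
  defines "I \<equiv> \<lambda>n \<omega>. map (\<lambda>r. cell (Mn n) (Xp n) (X n r \<omega>)) [0..<n]"
  assumes P: "prob_space P"
    and indep: "\<And>n. n \<ge> 2 \<Longrightarrow>
      prob_space.indep_vars P (\<lambda>_. M \<Otimes>\<^sub>M borel) (\<lambda>r \<omega>. (X n r \<omega>, Y n r \<omega>)) {0..<n}"
    and ident: "\<And>n r. n \<ge> 2 \<Longrightarrow> r < n \<Longrightarrow>
      distr P (M \<Otimes>\<^sub>M borel) (\<lambda>\<omega>. (X n r \<omega>, Y n r \<omega>)) = H"
    and mu: "\<And>q. q > 0 \<Longrightarrow> cond_moment H M q (mu q)"
    and mu2_bdd: "\<And>x. x \<in> space M \<Longrightarrow> mu 2 x \<le> ennreal C"
    and K_sym: "\<And>n x y. n \<ge> 2 \<Longrightarrow> x \<in> space M \<Longrightarrow> y \<in> space M \<Longrightarrow> K n x y = K n y x"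
    and K_meas: "\<And>n. n \<ge> 2 \<Longrightarrow> (\<lambda>z. K n (fst z) (snd z)) \<in> borel_measurable (M \<Otimes>\<^sub>M M)"
    and K_L2: "\<And>n. n \<ge> 2 \<Longrightarrow> (\<integral>\<^sup>+z. ennreal ((K n (fst z) (snd z))\<^sup>2) \<partial>(G \<Otimes>\<^sub>M G)) < \<infinity>"
    and condA: "\<exists>B::real. \<forall>n\<ge>2. kernel_op_norm G (K n) \<le> ennreal B"
    and condB: "filterlim (\<lambda>n. k n / real n) at_top sequentially"
    and part_meas: "\<And>n m. n \<ge> 2 \<Longrightarrow> m \<in> {1..Mn n} \<Longrightarrow> Xp n m \<in> sets M"
    and part_cover: "\<And>n. n \<ge> 2 \<Longrightarrow> (\<Union>m\<in>{1..Mn n}. Xp n m) = space M"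
    and part_disj: "\<And>n m m'. n \<ge> 2 \<Longrightarrow> m \<in> {1..Mn n} \<Longrightarrow> m' \<in> {1..Mn n} \<Longrightarrow> m \<noteq> m' \<Longrightarrow>
      Xp n m \<inter> Xp n m' = {}"
    and C1: "(\<lambda>n. (\<Sum>m\<in>{1..Mn n}. enn2real (\<integral>\<^sup>+z\<in>Xp n m \<times> Xp n m.
               ennreal ((K n (fst z) (snd z))\<^sup>2) * mu 2 (fst z) * mu 2 (snd z) \<partial>(G \<Otimes>\<^sub>M G))) / k n)
             \<longlonglongrightarrow> 1"
    and C2: "(\<lambda>n. (MAX m\<in>{1..Mn n}. enn2real (\<integral>\<^sup>+z\<in>Xp n m \<times> Xp n m.
               ennreal ((K n (fst z) (snd z))\<^sup>2) * mu 2 (fst z) * mu 2 (snd z) \<partial>(G \<Otimes>\<^sub>M G))) / k n)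
             \<longlonglongrightarrow> 0"
    and C3: "(\<lambda>n. MAX m\<in>{1..Mn n}. measure G (Xp n m)) \<longlonglongrightarrow> 0"
    and C4: "liminf (\<lambda>n. ereal (real n * (MIN m\<in>{1..Mn n}. measure G (Xp n m)))) > 0"
    and C5: "\<exists>q>2. (\<lambda>n. ennreal (k n powr (- q / 2)
                 * (MAX m\<in>{1..Mn n}. measure G (Xp n m) / real n) powr (q / 2 - 1))
               * (\<Sum>m\<in>{1..Mn n}. \<integral>\<^sup>+z\<in>Xp n m \<times> Xp n m.
                   ennreal (\<bar>K n (fst z) (snd z)\<bar> powr q) * mu q (fst z) * mu q (snd z) \<partial>(G \<Otimes>\<^sub>M G)))
             \<longlonglongrightarrow> 0"
  shows "(\<forall>\<epsilon>>0. (\<lambda>n. measure P {\<omega> \<in> space P.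
             bl_dist (distr (uniform_measure P {\<omega>' \<in> space P. I n \<omega>' = I n \<omega>}) borel (Z n))
                     (density lborel std_normal_density) > \<epsilon>}) \<longlonglongrightarrow> 0)
         \<and> (\<lambda>n. (\<integral>\<omega>. (U n \<omega> - (\<integral>\<omega>'. U n \<omega>' \<partial>P))\<^sup>2 \<partial>P) / (2 * k n / (real n)\<^sup>2)) \<longlonglongrightarrow> 1"
proof -
  interpret P: prob_space P by (rule P)
  let ?S = "M \<Otimes>\<^sub>M borel :: ('x \<times> real) measure"
  have rv: "(\<lambda>\<omega>. (X n r \<omega>, Y n r \<omega>)) \<in> measurable P ?S" if "n \<ge> 2" "r < n" for n r
    using indep[OF that(1)] that(2) unfolding P.indep_vars_def by auto
  \<comment> \<open>A single pair suffices to see that \<open>H\<close> is a probability measure on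
    the product sigma-algebra.\<close>
  have H2: "distr P ?S (\<lambda>\<omega>. (X 2 0 \<omega>, Y 2 0 \<omega>)) = H" by (rule ident) auto
  have pH: "prob_space H" unfolding H2[symmetric] by (rule P.prob_space_distr[OF rv]) auto
  have sH: "sets H = sets ?S" unfolding H2[symmetric] by simp
  obtain B0 where B0: "\<And>n. n \<ge> 2 \<Longrightarrow> kernel_op_norm G (K n) \<le> ennreal B0" using condA by auto
  \<comment> \<open>\<open>ennreal\<close> sends negative numbers to 0, so replacing the constants
    by their nonnegative parts preserves the bounds.\<close>
  define Bd where "Bd = max 0 B0"
  define C' where "C' = max 0 C"
  define b where "b = C'\<^sup>2 * Bd\<^sup>2"
  have Bd: "0 \<le> Bd" "ennreal B0 = ennreal Bd" by (simp_all add: Bd_def ennreal_max_0)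
  have C': "0 \<le> C'" "ennreal C = ennreal C'" by (simp_all add: C'_def ennreal_max_0)
  have des: "design H M mu C'"
    by (intro design.intro design_axioms.intro pH sH mu C'(1)) (assumption, rule mu2_bdd[unfolded C'(2)])
  interpret De: design H M mu C' by (rule des)
  have G: "De.G = G" by (simp add: De.G_def G_def)
  define km where "km n m = enn2real (\<integral>\<^sup>+z\<in>Xp n m \<times> Xp n m.
               ennreal ((K n (fst z) (snd z))\<^sup>2) * mu 2 (fst z) * mu 2 (snd z) \<partial>(G \<Otimes>\<^sub>M G))" for n m
  define R where "R n = (MAX m\<in>{1..Mn n}. km n m) / k n" for n
  define pmax where "pmax n = (MAX m\<in>{1..Mn n}. measure G (Xp n m))" for n
  obtain q where q: "q > 2" and C5: "(\<lambda>n. ennreal (k n powr (- q / 2)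
                 * (MAX m\<in>{1..Mn n}. measure G (Xp n m) / real n) powr (q / 2 - 1))
               * (\<Sum>m\<in>{1..Mn n}. \<integral>\<^sup>+z\<in>Xp n m \<times> Xp n m.
                   ennreal (\<bar>K n (fst z) (snd z)\<bar> powr q) * mu q (fst z) * mu q (snd z) \<partial>(G \<Otimes>\<^sub>M G)))
             \<longlonglongrightarrow> 0" using C5 by auto
  define xe where "xe n = ennreal (k n powr (- q / 2)
                 * (MAX m\<in>{1..Mn n}. measure G (Xp n m) / real n) powr (q / 2 - 1))
               * (\<Sum>m\<in>{1..Mn n}. \<integral>\<^sup>+z\<in>Xp n m \<times> Xp n m.
                   ennreal (\<bar>K n (fst z) (snd z)\<bar> powr q) * mu q (fst z) * mu q (snd z) \<partial>(G \<Otimes>\<^sub>M G))" for n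
  have xe0: "xe \<longlonglongrightarrow> 0" using C5 by (simp add: xe_def[abs_def])
  \<comment> \<open>The (C5) quantity, shifted by 1/n to be positive. The exponent in \<eta> is
    chosen so that \<eta> powr (2 - q) is y powr (-1/2): the truncation error is then at most sqrt
    y, while \<eta> itself still tends to 0.\<close>
  define y where "y n = enn2real (xe n) + 1 / real n" for n
  define \<eta> where "\<eta> n = y n powr (1 / (2 * (q - 2)))" for n
  define L where "L n = \<eta> n * sqrt (k n * real n / pmax n)" for n
  define Dn where "Dn c0 n = 35 * ((1 - (\<Sum>m\<in>{1..Mn n}. km n m) / k n) + sqrt (y n) + b / c0 * (real n / k n))" for c0 n

  have xr0: "(\<lambda>n. enn2real (xe n)) \<longlonglongrightarrow> 0"
    using tendsto_enn2real[of xe 0 sequentially] xe0 by simp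
  have y0: "y \<longlonglongrightarrow> 0"
    unfolding y_def[abs_def] using tendsto_add[OF xr0 lim_1_over_n] by simp
  have \<eta>0: "\<eta> \<longlonglongrightarrow> 0"
    unfolding \<eta>_def[abs_def]
  proof (rule tendsto_zero_powrI[OF y0 tendsto_const])
    show "\<forall>\<^sub>F n in sequentially. 0 \<le> y n" by (rule always_eventually) (simp add: y_def)
    show "0 < 1 / (2 * (q - 2))" using q by simp
  qed
  have nk0: "(\<lambda>n. real n / k n) \<longlonglongrightarrow> 0"
    using tendsto_inverse_0_at_top[OF condB] by (simp add: inverse_eq_divide)
  have R0: "R \<longlonglongrightarrow> 0" using C2 by (simp add: R_def[abs_def] km_def)
  have sum0: "(\<lambda>n. 1 - (\<Sum>m\<in>{1..Mn n}. km n m) / k n) \<longlonglongrightarrow> 0"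
    using tendsto_diff[OF tendsto_const C1, of 1] by (simp add: km_def)
  have sy0: "(\<lambda>n. sqrt (y n)) \<longlonglongrightarrow> 0" using tendsto_real_sqrt[OF y0] by simp

  \<comment> \<open>Any number strictly between 0 and the limit inferior in (C4) bounds n times the
    cell probabilities from below eventually.\<close>
  obtain c where c: "0 < ereal c" "ereal c < liminf (\<lambda>n. ereal (real n * (MIN m\<in>{1..Mn n}. measure G (Xp n m))))"
    using ereal_dense2[OF C4] by auto
  then have c0: "0 < c" by simp
  have ev_min: "\<forall>\<^sub>F n in sequentially. c < real n * (MIN m\<in>{1..Mn n}. measure G (Xp n m))"
    using less_LiminfD[OF c(2)] by simp
  have ev_k: "\<forall>\<^sub>F n in sequentially. 1 \<le> k n / real n"
    using condB by (simp add: filterlim_at_top)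
  have ev_x: "\<forall>\<^sub>F n in sequentially. xe n < 1" using xe0 by (rule order_tendstoD) simp
  have ev_2: "\<forall>\<^sub>F n in sequentially. 2 \<le> n" by (rule eventually_ge_at_top)

  define var where "var n = (\<integral>\<omega>. (U n \<omega> - (\<integral>\<omega>'. U n \<omega>' \<partial>P))\<^sup>2 \<partial>P)" for n
  define V where "V n = var n / (2 * k n / (real n)\<^sup>2) * ((real n - 1) / real n)\<^sup>2" for n
  define pr where "pr n \<epsilon> = measure P {\<omega> \<in> space P.
             bl_dist (distr (uniform_measure P {\<omega>' \<in> space P. I n \<omega>' = I n \<omega>}) borel (Z n))
                     (density lborel std_normal_density) > \<epsilon>}" for n \<epsilon>
  define bound where "bound n \<delta> = (4 * b * (real n / k n) + 2 * Dn c n) / \<delta> + 4 * ((1600 / c + 800 / c\<^sup>2) * R n) / (\<delta> / 2)\<^sup>2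
      + ((81920 / c + 2099520) * (\<eta> n)\<^sup>2 + 26214400 * R n) / \<delta>" for n \<delta>
  \<comment> \<open>The locale is interpreted separately for each large \<open>n\<close>, with
    \<open>K n\<close>, the partition and \<open>L n\<close> as parameters; this predicate carries
    the resulting estimates out of that scope.\<close>
  define good where "good n gk \<longleftrightarrow>
    (\<forall>t>0. \<bar>gk - 1\<bar> \<le> t * 1 + (1 + 1 / t) * Dn c n) \<and>
    (\<forall>t>0. \<bar>V n - (real n - 1) / real n * gk\<bar> \<le> t * ((real n - 1) / real n * gk) + (1 + 1 / t) * (2 * b * (real n / k n) + Dn c n)) \<and>
    (\<forall>\<epsilon> \<delta>. clt_threshold TYPE('w) \<epsilon> \<delta> \<longrightarrow> 0 < \<delta> \<longrightarrow> 1 / 2 \<le> V n \<longrightarrow>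
        \<bar>(real n - 1) / real n * gk / V n - 1\<bar> \<le> \<delta> / 2 \<longrightarrow> pr n \<epsilon> \<le> bound n \<delta>)" for n gk

  have goodD: "\<And>t. good n gk \<Longrightarrow> 0 < t \<Longrightarrow> \<bar>gk - 1\<bar> \<le> t * 1 + (1 + 1 / t) * Dn c n"
    "\<And>t. good n gk \<Longrightarrow> 0 < t \<Longrightarrow> \<bar>V n - (real n - 1) / real n * gk\<bar>
        \<le> t * ((real n - 1) / real n * gk) + (1 + 1 / t) * (2 * b * (real n / k n) + Dn c n)"
    "\<And>\<epsilon> \<delta>. good n gk \<Longrightarrow> clt_threshold TYPE('w) \<epsilon> \<delta> \<Longrightarrow> 0 < \<delta> \<Longrightarrow> 1 / 2 \<le> V n \<Longrightarrow>
        \<bar>(real n - 1) / real n * gk / V n - 1\<bar> \<le> \<delta> / 2 \<Longrightarrow> pr n \<epsilon> \<le> bound n \<delta>" for n gk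
    unfolding good_def by blast+

  have ev_ex: "\<forall>\<^sub>F n in sequentially. \<exists>gk. good n gk"
    using ev_min ev_k ev_x ev_2
  proof eventually_elim
    case (elim n)
    have n: "2 \<le> n" and n0: "0 < real n" using elim by auto
    have k0: "0 < k n" using elim(2) n0 by (simp add: pos_le_divide_eq)
    \<comment> \<open>An empty partition would make the space empty, contradicting that
      \<open>H\<close> is a probability measure. The maxima and minima below are then over nonempty
      sets.\<close>
    have Mn: "{1..Mn n} \<noteq> {}"
    proof
      assume e: "{1..Mn n} = {}"
      have "space M = {}" using part_cover[OF n] unfolding e by simp
      moreover have "space H = space M \<times> UNIV" by (rule De.space_H)
      ultimately show False using prob_space.not_empty[OF pH] by simp
    qed
    have pc: "c \<le> real n * measure G (Xp n m)" if "m \<in> {1..Mn n}" for m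
    proof -
      have "(MIN m\<in>{1..Mn n}. measure G (Xp n m)) \<le> measure G (Xp n m)" using that by (intro Min_le) auto
      then have "real n * (MIN m\<in>{1..Mn n}. measure G (Xp n m)) \<le> real n * measure G (Xp n m)" by (rule mult_left_mono) simp
      then show ?thesis using elim(1) by linarith
    qed
    have pp: "0 < measure G (Xp n m)" if "m \<in> {1..Mn n}" for m
    proof -
      have "0 < real n * measure G (Xp n m)" using pc[OF that] c0 by linarith
      then show ?thesis using n0 by (simp add: zero_less_mult_iff)
    qed
    have pmle: "measure G (Xp n m) \<le> pmax n" if "m \<in> {1..Mn n}" for m
      unfolding pmax_def using that by (intro Max_ge) auto
    have pm0: "0 < pmax n"
    proof -
      obtain m where "m \<in> {1..Mn n}" using Mn by blast
      then show ?thesis using pp pmle by (blast intro: less_le_trans)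
    qed
    have yp: "0 < y n" using n0 by (simp add: y_def add_nonneg_pos)
    have \<eta>p: "0 < \<eta> n" using yp by (simp add: \<eta>_def)
    have Lp: "0 \<le> L n" using \<eta>p k0 pm0 by (simp add: L_def)
    have "design_sample H M mu C' (K n) Bd (Mn n) (Xp n) (L n) P (X n) (Y n) n"
    proof (intro design_sample.intro design_blocks.intro design_kernel.intro des
        design_kernel_axioms.intro design_blocks_axioms.intro design_sample_axioms.intro)
      show "K n x y = K n y x" if "x \<in> space M" "y \<in> space M" for x y by (rule K_sym[OF n that])
      show "(\<lambda>z. K n (fst z) (snd z)) \<in> borel_measurable (M \<Otimes>\<^sub>M M)" by (rule K_meas[OF n])
      show "(\<integral>\<^sup>+z. ennreal ((K n (fst z) (snd z))\<^sup>2) \<partial>(De.G \<Otimes>\<^sub>M De.G)) < \<infinity>" unfolding G by (rule K_L2[OF n])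
      show "kernel_op_norm De.G (K n) \<le> ennreal Bd" unfolding G Bd(2)[symmetric] by (rule B0[OF n])
      show "0 \<le> Bd" by (rule Bd)
      show "Xp n m \<in> sets M" if "m \<in> {1..Mn n}" for m by (rule part_meas[OF n that])
      show "(\<Union>m\<in>{1..Mn n}. Xp n m) = space M" by (rule part_cover[OF n])
      show "Xp n m \<inter> Xp n m' = {}" if "m \<in> {1..Mn n}" "m' \<in> {1..Mn n}" "m \<noteq> m'" for m m'
        by (rule part_disj[OF n that])
      show "0 < measure De.G (Xp n m)" if "m \<in> {1..Mn n}" for m unfolding G by (rule pp[OF that])
      show "0 \<le> L n" by (rule Lp)
      show "prob_space P" by (rule P)
      show "2 \<le> n" by (rule n)
      show "P.indep_vars (\<lambda>_. ?S) (\<lambda>r \<omega>. (X n r \<omega>, Y n r \<omega>)) {0..<n}" by (rule indep[OF n])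
      show "distr P ?S (\<lambda>\<omega>. (X n r \<omega>, Y n r \<omega>)) = H" if "r < n" for r by (rule ident[OF n that])
    qed
    then interpret s: design_sample H M mu C' "K n" Bd "Mn n" "Xp n" "L n" P "X n" "Y n" n .
    have \<kappa>: "s.\<kappa> = k n" unfolding s.\<kappa>_eq G k_def ..
    have \<kappa>m: "s.\<kappa>m m = km n m" if "m \<in> {1..Mn n}" for m unfolding s.\<kappa>m_eq[OF that] G km_def ..
    have sum\<kappa>m: "(\<Sum>m\<in>{1..Mn n}. s.\<kappa>m m) = (\<Sum>m\<in>{1..Mn n}. km n m)" by (rule sum.cong[OF refl \<kappa>m])
    have p: "s.p m = measure G (Xp n m)" if "m \<in> {1..Mn n}" for m using s.p_eq[OF that] unfolding G .
    have Us: "s.Us = U n" by (rule ext) (simp only: s.Us_def U_def)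
    have h1: "0 < s.\<kappa>" using k0 unfolding \<kappa> .
    have h3: "c \<le> real n * s.p m" if "m \<in> {1..Mn n}" for m unfolding p[OF that] by (rule pc[OF that])
    have h4: "s.\<kappa>m m \<le> R n * s.\<kappa>" if "m \<in> {1..Mn n}" for m
    proof -
      have "km n m \<le> (MAX m\<in>{1..Mn n}. km n m)" using that by (intro Max_ge) auto
      also have "\<dots> = R n * k n" using k0 by (simp add: R_def)
      finally show ?thesis unfolding \<kappa>m[OF that] \<kappa> .
    qed
    have h5: "s.sq s.high \<le> s.\<kappa> * sqrt (y n)"
    proof -
      let ?W = "\<Sum>m\<in>{1..Mn n}. \<integral>\<^sup>+z\<in>Xp n m \<times> Xp n m.
                   ennreal (\<bar>K n (fst z) (snd z)\<bar> powr q) * mu q (fst z) * mu q (snd z) \<partial>(G \<Otimes>\<^sub>M G)"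
      have mx: "(MAX m\<in>{1..Mn n}. measure G (Xp n m) / real n) = pmax n / real n"
      proof -
        have "mono (\<lambda>x. x / real n)" by (intro monoI divide_right_mono) auto
        from mono_Max_commute[OF this, of "(\<lambda>m. measure G (Xp n m)) ` {1..Mn n}"] Mn
        show ?thesis unfolding pmax_def by (simp add: image_image)
      qed
      \<comment> \<open>Eventually the (C5) quantity is below 1, hence finite, and
        \<open>enn2real\<close> loses nothing.\<close>
      have xr: "ennreal (enn2real (xe n)) = xe n"
        using elim(3) by (intro ennreal_enn2real) (simp add: less_trans[OF _ ennreal_one_less_top])
      have "ennreal (s.\<kappa> powr (- q / 2) * (pmax n / real n) powr (q / 2 - 1)) * ?W = ennreal (enn2real (xe n))"
        unfolding xr unfolding xe_def mx \<kappa> ..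
      then have hs: "s.sq s.high \<le> s.\<kappa> * (\<eta> n powr (2 - q) * enn2real (xe n))"
        by (intro s.sq_high_small[OF q \<eta>p pm0 h1, unfolded G]) (simp_all add: L_def \<kappa>)
      have "\<eta> n powr (2 - q) = y n powr (- (1 / 2))"
      proof -
        have "1 / (2 * (q - 2)) * (2 - q) = - (1 / 2)" using q by (simp add: field_simps)
        then show ?thesis unfolding \<eta>_def powr_powr by simp
      qed
      then have "\<eta> n powr (2 - q) * enn2real (xe n) \<le> y n powr (- (1 / 2)) * y n"
        using n0 by (simp add: y_def mult_left_mono)
      also have "\<dots> = y n powr (- (1 / 2) + 1)" using yp by (subst powr_add) simp
      also have "\<dots> = sqrt (y n)" using yp by (simp add: powr_half_sqrt)
      finally have "s.\<kappa> * (\<eta> n powr (2 - q) * enn2real (xe n)) \<le> s.\<kappa> * sqrt (y n)"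
        using h1 by (intro mult_left_mono) auto
      with hs show ?thesis by (rule order_trans)
    qed
    have h6: "(L n)\<^sup>2 * s.p m \<le> (\<eta> n)\<^sup>2 * s.\<kappa> * real n" if "m \<in> {1..Mn n}" for m
    proof -
      have "(L n)\<^sup>2 * s.p m \<le> (L n)\<^sup>2 * pmax n" unfolding p[OF that] by (intro mult_left_mono pmle that) simp
      also have "\<dots> = (\<eta> n)\<^sup>2 * k n * real n" using k0 n0 pm0 by (simp add: L_def power_mult_distrib)
      finally show ?thesis unfolding \<kappa> .
    qed
    obtain gk where
      "\<And>t. 0 < t \<Longrightarrow> \<bar>gk - 1\<bar> \<le> t * 1 + (1 + 1 / t) * Dn c n"
      "\<And>t. 0 < t \<Longrightarrow> \<bar>V n - (real n - 1) / real n * gk\<bar>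
          \<le> t * ((real n - 1) / real n * gk) + (1 + 1 / t) * (2 * b * (real n / k n) + Dn c n)"
      "\<And>\<epsilon> \<delta>. clt_threshold TYPE('w) \<epsilon> \<delta> \<Longrightarrow> 0 < \<delta> \<Longrightarrow> 1 / 2 \<le> V n \<Longrightarrow>
          \<bar>(real n - 1) / real n * gk / V n - 1\<bar> \<le> \<delta> / 2 \<Longrightarrow> pr n \<epsilon> \<le> bound n \<delta>"
      using s.summary[OF h1 c0 h3 h4 h5 h6, unfolded \<kappa> sum\<kappa>m Us, folded b_def var_def, folded V_def Dn_def]
      unfolding pr_def bound_def Z_def I_def var_def by blast
    then show ?case unfolding good_def by blast
  qed
  define gk where "gk n = (SOME gk. good n gk)" for n
  have ev_good: "\<forall>\<^sub>F n in sequentially. good n (gk n)"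
    using ev_ex unfolding gk_def by eventually_elim (rule someI_ex)
  define w where "w n = (real n - 1) / real n * gk n" for n
  have Dn0: "Dn c \<longlonglongrightarrow> 0"
  proof -
    have "Dn c \<longlonglongrightarrow> 35 * (0 + 0 + b / c * 0)"
      unfolding Dn_def[abs_def] by (intro tendsto_intros sum0 sy0 nk0)
    then show ?thesis by simp
  qed
  \<comment> \<open>The perturbation lemma is used twice: against the constant 1 for the ratio of
    second moments, and then against \<open>w\<close> for the normalised variance.\<close>
  have gk1: "gk \<longlonglongrightarrow> 1"
  proof (rule tendsto_diff_of_perturbation[OF _ tendsto_const Dn0])
    show "\<forall>\<^sub>F n in sequentially. \<bar>gk n - 1\<bar> \<le> t * 1 + (1 + 1 / t) * Dn c n" if "0 < t" for t
      using ev_good by eventually_elim (rule goodD(1)[OF _ that])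
  qed
  have n1: "(\<lambda>n. (real n - 1) / real n) \<longlonglongrightarrow> 1"
  proof (rule Lim_transform_eventually)
    show "(\<lambda>n. 1 - 1 / real n) \<longlonglongrightarrow> 1" using tendsto_diff[OF tendsto_const lim_1_over_n, of 1] by simp
    show "\<forall>\<^sub>F n in sequentially. 1 - 1 / real n = (real n - 1) / real n"
      using ev_2 by eventually_elim (simp add: diff_divide_distrib)
  qed
  have w1: "w \<longlonglongrightarrow> 1" unfolding w_def[abs_def] using tendsto_mult[OF n1 gk1] by simp
  have r0: "(\<lambda>n. 2 * b * (real n / k n) + Dn c n) \<longlonglongrightarrow> 0"
    using tendsto_add[OF tendsto_mult[OF tendsto_const nk0] Dn0, of "2 * b"] by simp
  have V1: "V \<longlonglongrightarrow> 1"
  proof (rule tendsto_diff_of_perturbation[OF _ w1 r0])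
    show "\<forall>\<^sub>F n in sequentially. \<bar>V n - w n\<bar> \<le> t * w n + (1 + 1 / t) * (2 * b * (real n / k n) + Dn c n)" if "0 < t" for t
      unfolding w_def using ev_good by eventually_elim (rule goodD(2)[OF _ that])
  qed
  have "(\<lambda>n. measure P {\<omega> \<in> space P.
             bl_dist (distr (uniform_measure P {\<omega>' \<in> space P. I n \<omega>' = I n \<omega>}) borel (Z n))
                     (density lborel std_normal_density) > \<epsilon>}) \<longlonglongrightarrow> 0" if \<epsilon>: "0 < \<epsilon>" for \<epsilon>
  proof -
    \<comment> \<open>\<delta> depends on \<epsilon> only; for it fixed, every term of
      \<open>bound n \<delta>\<close> tends to 0.\<close>
    obtain \<delta> where \<delta>: "0 < \<delta>" and thr: "clt_threshold TYPE('w) \<epsilon> \<delta>" by (rule clt_threshold_exists[OF \<epsilon>])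
    have "(\<lambda>n. bound n \<delta>) \<longlonglongrightarrow> (4 * b * 0 + 2 * 0) / \<delta> + 4 * ((1600 / c + 800 / c\<^sup>2) * 0) / (\<delta> / 2)\<^sup>2
      + ((81920 / c + 2099520) * 0\<^sup>2 + 26214400 * 0) / \<delta>"
      unfolding bound_def by (intro tendsto_intros nk0 Dn0 R0 \<eta>0) (use \<delta> in auto)
    then have b0: "(\<lambda>n. bound n \<delta>) \<longlonglongrightarrow> 0" by simp
    have "(\<lambda>n. w n / V n) \<longlonglongrightarrow> 1" using tendsto_divide[OF w1 V1] by simp
    then have evw: "\<forall>\<^sub>F n in sequentially. dist (w n / V n) 1 < \<delta> / 2" by (rule tendstoD) (use \<delta> in simp)
    have evV: "\<forall>\<^sub>F n in sequentially. 1 / 2 < V n" using V1 by (rule order_tendstoD) simp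
    have "\<forall>\<^sub>F n in sequentially. pr n \<epsilon> \<le> bound n \<delta>"
      using ev_good evw evV
    proof eventually_elim
      case (elim n)
      then have "\<bar>w n / V n - 1\<bar> \<le> \<delta> / 2" "1 / 2 \<le> V n" by (auto simp: dist_real_def)
      then show ?case unfolding w_def by (intro goodD(3)[OF elim(1) thr \<delta>])
    qed
    then have "(\<lambda>n. pr n \<epsilon>) \<longlonglongrightarrow> 0"
      by (intro tendsto_sandwich[OF _ _ tendsto_const b0]) (simp_all add: pr_def)
    then show ?thesis unfolding pr_def .
  qed
  moreover have "(\<lambda>n. var n / (2 * k n / (real n)\<^sup>2)) \<longlonglongrightarrow> 1"
  \<comment> \<open>\<open>V\<close> normalises the variance of the sum over pairs by 2 n^2 k,
    whereas U is divided by n (n - 1); the squared factor (n - 1) / n converts between the two and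
    tends to 1.\<close>
  proof (rule Lim_transform_eventually)
    show "(\<lambda>n. V n / ((real n - 1) / real n)\<^sup>2) \<longlonglongrightarrow> 1"
      using tendsto_divide[OF V1 tendsto_power[OF n1, of 2]] by simp
    show "\<forall>\<^sub>F n in sequentially. V n / ((real n - 1) / real n)\<^sup>2 = var n / (2 * k n / (real n)\<^sup>2)"
      using ev_2
    proof eventually_elim
      case (elim n)
      then have "((real n - 1) / real n)\<^sup>2 \<noteq> 0" by simp
      then show ?case unfolding V_def by (rule nonzero_mult_div_cancel_right)
    qed
  qed
  ultimately show ?thesis unfolding var_def by blast
qed

end
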